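(* For $0<a<\pi/2$ let $\varphi_a:B^n\to\mathbb{S}^n$ be the map $\varphi_a(x)=\left(\sin a\,\frac{x}{|x|},\,\cos a\right)$. Then: (i) $\varphi_a$ is a proper weakly $ES$-$3$-harmonic (equivalently, proper weakly $3$-harmonic) map if and only if $n=7$ and $a=a_3=\frac12\arccos\left(\frac19\left(2\sqrt{10}-11\right)\right)$; (ii) $\varphi_a$ is a proper weakly $ES$-$4$-harmonic (equivalently, proper weakly $4$-harmonic) map if and only if $n=9$ and $a=a_4=\frac12\arccos\left(\frac1{16}\left(\sqrt{105}-19\right)\right)$; (iii) $\varphi_a$ is a proper weakly $ES$-$5$-harmonic (equivalently, proper weakly $5$-harmonic) map if and only if $n=11$ and $a=a_5=\frac12\arccos\left(\frac1{25}\left(6\sqrt{6}-29\right)\right)$.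
   Context: $B^n\subset\mathbb{R}^n$ is the Euclidean unit ball with centre $O$ and $\mathbb{S}^n\subset\mathbb{R}^n\times\mathbb{R}$ the Euclidean unit sphere. $\varphi_a$ is smooth away from $O$. For a smooth map $\varphi:(M,g_M)\to(N,g_N)$ of Riemannian manifolds, $m=\dim M$, $\tau(\varphi)=-d^*d\varphi=\mathrm{trace}_{g_M}\nabla d\varphi$ is the tension field, a section of $\varphi^{-1}TN$; $d,d^*$ denote exterior covariant differentiation and codifferential on $\varphi^{-1}TN$-valued forms ($d^*$ vanishes on $0$-forms). $\varphi$ is harmonic if $\tau(\varphi)=0$. The rough Laplacian on sections of $\varphi^{-1}TN$ is $\overline{\Delta}=d^*d=-\sum_{i=1}^m\left(\nabla^\varphi_{e_i}\nabla^\varphi_{e_i}-\nabla^\varphi_{\nabla^M_{e_i}e_i}\right)$, $\{e_i\}$ a local orthonormal frame. The $r$-energy is $E_{2s}(\varphi)=\frac12\int_M|\overline{\Delta}^{s-1}\tau(\varphi)|^2\,dV$ and $E_{2s+1}(\varphi)=\frac12\int_M\sum_{j=1}^m|\nabla^\varphi_{e_j}\overline{\Delta}^{s-1}\tau(\varphi)|^2\,dV$ ($s\ge1$). The $ES$-$r$-energy is $E_r^{ES}(\varphi)=\frac12\int_M|(d^*+d)^r(\varphi)|^2\,dV$, where $(d^*+d)\varphi=d\varphi$, $(d^*+d)^2\varphi=-\tau(\varphi)$ and $(d^*+d)^r\varphi=-(d^*+d)^{r-2}\tau(\varphi)$ for $r\geq 3$. A smooth map is $r$-harmonic ($ES$-$r$-harmonic)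 if it is a critical point of $E_r$ ($E_r^{ES}$). $W^{r,2}(B^n,\mathbb{S}^n)$ is the set of $\varphi\in W^{r,2}(B^n,\mathbb{R}^{n+1})$ with $\varphi(x)\in\mathbb{S}^n$ a.e. A map is weakly $r$-harmonic (weakly $ES$-$r$-harmonic) if it belongs to $W^{r,2}(B^n,\mathbb{S}^n)$ and solves the Euler-Lagrange equation of $E_r$ ($E_r^{ES}$) in the sense of distributions. For the maps $\varphi_a$ this is used in the equivalent form: $\varphi_a\in W^{r,2}(B^n,\mathbb{S}^n)$ and $\varphi_a$ is $r$-harmonic ($ES$-$r$-harmonic) on $B^n\setminus\{O\}$. Such a map is proper if it is not (weakly) harmonic. *)

theory Defs
  imports "HOL-Analysis.Analysis"
begin

section \<open>Iterated derivatives, smoothness, Sobolev spaces\<close>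

primrec iter_deriv ::
  "'a::real_normed_vector list \<Rightarrow> ('a \<Rightarrow> 'b::real_normed_vector) \<Rightarrow> 'a \<Rightarrow> 'b" where
  "iter_deriv [] f = f"
| "iter_deriv (v # vs) f = (\<lambda>x. frechet_derivative (iter_deriv vs f) (at x) v)"

text \<open>For open \<open>U\<close> this is C-infinity: all iterated directional derivatives exist and are
  Frechet differentiable on \<open>U\<close>, hence continuous there.\<close>

definition smooth_on ::
  "'a::real_normed_vector set \<Rightarrow> ('a \<Rightarrow> 'b::real_normed_vector) \<Rightarrow> bool" where
  "smooth_on U f \<longleftrightarrow> (\<forall>vs. \<forall>x\<in>U. iter_deriv vs f differentiable (at x))"

definition test_function :: "'a::euclidean_space set \<Rightarrow> ('a \<Rightarrow> real) \<Rightarrow> bool" where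
  "test_function U \<psi> \<longleftrightarrow> smooth_on UNIV \<psi> \<and> (\<exists>K. compact K \<and> K \<subseteq> U \<and> (\<forall>x. x \<notin> K \<longrightarrow> \<psi> x = 0))"

definition L2_on :: "'a::euclidean_space set \<Rightarrow> ('a \<Rightarrow> 'b::euclidean_space) \<Rightarrow> bool" where
  "L2_on U f \<longleftrightarrow> set_borel_measurable lebesgue U f \<and> set_integrable lebesgue U (\<lambda>x. (norm (f x))\<^sup>2)"

definition weak_derivative ::
  "'a::euclidean_space set \<Rightarrow> 'a list \<Rightarrow> ('a \<Rightarrow> 'b::euclidean_space) \<Rightarrow> ('a \<Rightarrow> 'b) \<Rightarrow> bool" where
  "weak_derivative U vs f g \<longleftrightarrow>
     (\<forall>\<psi>. test_function U \<psi> \<longrightarrow>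
       (LINT x:U|lebesgue. iter_deriv vs \<psi> x *\<^sub>R f x)
         = (- 1) ^ length vs *\<^sub>R (LINT x:U|lebesgue. \<psi> x *\<^sub>R g x))"

text \<open>\<open>W\<^sup>k\<^sup>,\<^sup>2(U)\<close>; a multi-index of order at most \<open>k\<close> is given as a list of coordinate vectors.\<close>

definition sobolev :: "nat \<Rightarrow> 'a::euclidean_space set \<Rightarrow> ('a \<Rightarrow> 'b::euclidean_space) \<Rightarrow> bool" where
  "sobolev k U f \<longleftrightarrow> L2_on U f \<and>
     (\<forall>vs. set vs \<subseteq> Basis \<and> length vs \<le> k \<longrightarrow> (\<exists>g. L2_on U g \<and> weak_derivative U vs f g))"

definition sobolev_sphere :: "nat \<Rightarrow> 'a::euclidean_space set \<Rightarrow> ('a \<Rightarrow> 'b::euclidean_space) \<Rightarrow> bool" where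
  "sobolev_sphere k U \<phi> \<longleftrightarrow> sobolev k U \<phi> \<and> (AE x in lebesgue. x \<in> U \<longrightarrow> \<phi> x \<in> sphere 0 1)"


section \<open>The pull-back connection and the Laplace-type operators\<close>

text \<open>
  Maps go from an open subset of the flat space \<open>'a\<close> into the unit sphere of \<open>'b\<close>, with the induced
  metric; sections of the pull-back bundle are \<open>'b\<close>-valued functions tangent to the sphere along
  \<open>\<phi>\<close>. The Levi-Civita connection of the sphere is the tangential part of the flat derivative.
  \<open>Basis\<close> is used as global parallel orthonormal frame, so all terms containing the
  covariant derivative of a frame field vanish.
\<close>

definition sphere_proj :: "'b::real_inner \<Rightarrow> 'b \<Rightarrow> 'b" where
  "sphere_proj p w = w - (w \<bullet> p) *\<^sub>R p"

definition pull_conn ::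
  "('a::euclidean_space \<Rightarrow> 'b::euclidean_space) \<Rightarrow> 'a \<Rightarrow> ('a \<Rightarrow> 'b) \<Rightarrow> 'a \<Rightarrow> 'b" where
  "pull_conn \<phi> v V x = sphere_proj (\<phi> x) (frechet_derivative V (at x) v)"

definition tension :: "('a::euclidean_space \<Rightarrow> 'b::euclidean_space) \<Rightarrow> 'a \<Rightarrow> 'b" where
  "tension \<phi> x = (\<Sum>e\<in>Basis. pull_conn \<phi> e (\<lambda>y. frechet_derivative \<phi> (at y) e) x)"

definition rough_laplacian ::
  "('a::euclidean_space \<Rightarrow> 'b::euclidean_space) \<Rightarrow> ('a \<Rightarrow> 'b) \<Rightarrow> 'a \<Rightarrow> 'b" where
  "rough_laplacian \<phi> V x = - (\<Sum>e\<in>Basis. pull_conn \<phi> e (pull_conn \<phi> e V) x)"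


section \<open>Bundle-valued differential forms\<close>

text \<open>
  A form of mixed degree with values in the pull-back bundle: its degree \<open>p\<close> component at \<open>x\<close> is the
  restriction of \<open>\<omega> x\<close> to argument lists of length \<open>p\<close>. In \<open>ext_deriv\<close> and
  \<open>codiff\<close> the arguments are extended to constant vector fields, so no bracket or frame terms occur.
\<close>

type_synonym ('a, 'b) form = "'a \<Rightarrow> 'a list \<Rightarrow> 'b"

definition section_form :: "('a \<Rightarrow> 'b::zero) \<Rightarrow> ('a, 'b) form" where
  "section_form V x vs = (if vs = [] then V x else 0)"

definition differential_form :: "('a::euclidean_space \<Rightarrow> 'b::euclidean_space) \<Rightarrow> ('a, 'b) form" where
  "differential_form \<phi> x vs = (if length vs = 1 then frechet_derivative \<phi> (at x) (hd vs) else 0)"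

definition ext_deriv ::
  "('a::euclidean_space \<Rightarrow> 'b::euclidean_space) \<Rightarrow> ('a, 'b) form \<Rightarrow> ('a, 'b) form" where
  "ext_deriv \<phi> \<omega> x vs =
     (\<Sum>k<length vs. (- 1) ^ k *\<^sub>R pull_conn \<phi> (vs ! k) (\<lambda>y. \<omega> y (take k vs @ drop (Suc k) vs)) x)"

definition codiff ::
  "('a::euclidean_space \<Rightarrow> 'b::euclidean_space) \<Rightarrow> ('a, 'b) form \<Rightarrow> ('a, 'b) form" where
  "codiff \<phi> \<omega> x vs = - (\<Sum>e\<in>Basis. pull_conn \<phi> e (\<lambda>y. \<omega> y (e # vs)) x)"

definition hodge_dirac ::
  "('a::euclidean_space \<Rightarrow> 'b::euclidean_space) \<Rightarrow> ('a, 'b) form \<Rightarrow> ('a, 'b) form" where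
  "hodge_dirac \<phi> \<omega> x vs = codiff \<phi> \<omega> x vs + ext_deriv \<phi> \<omega> x vs"

text \<open>Forms of different degree are orthogonal, and in degree \<open>p\<close> the sum over all \<open>p\<close>-tuples of basis
  vectors divided by \<open>p!\<close> is the sum over increasing tuples.\<close>

definition form_norm_sq :: "('a::euclidean_space, 'b::euclidean_space) form \<Rightarrow> 'a \<Rightarrow> real" where
  "form_norm_sq \<omega> x =
     (\<Sum>p\<le>DIM('a). (\<Sum>vs\<in>{vs. set vs \<subseteq> Basis \<and> length vs = p}. (norm (\<omega> x vs))\<^sup>2) / fact p)"

lemma tension_eq_codiff: "tension \<phi> x = - codiff \<phi> (differential_form \<phi>) x []"
  by (simp add: tension_def codiff_def differential_form_def)

lemma codiff_section_form: "codiff \<phi> (section_form V) = (\<lambda>x vs. 0)"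
  by (intro ext)
    (simp add: codiff_def section_form_def pull_conn_def sphere_proj_def frechet_derivative_const)

lemma rough_laplacian_eq_codiff_ext_deriv:
  "rough_laplacian \<phi> V x = codiff \<phi> (ext_deriv \<phi> (section_form V)) x []"
  by (simp add: rough_laplacian_def codiff_def ext_deriv_def section_form_def)


section \<open>Energies and their critical points\<close>

text \<open>Density of \<open>2 E\<^sub>r\<close>, for \<open>r \<ge> 2\<close>; with \<open>s = r div 2\<close> the two branches are
  \<open>r = 2 s\<close> and \<open>r = 2 s + 1\<close>.\<close>

definition r_density :: "nat \<Rightarrow> ('a::euclidean_space \<Rightarrow> 'b::euclidean_space) \<Rightarrow> 'a \<Rightarrow> real" where
  "r_density r \<phi> x =
     (let V = (rough_laplacian \<phi> ^^ (r div 2 - 1)) (tension \<phi>)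
      in if even r then (norm (V x))\<^sup>2 else (\<Sum>e\<in>Basis. (norm (pull_conn \<phi> e V x))\<^sup>2))"

text \<open>\<open>(d\<^sup>* + d)\<^sup>r \<phi>\<close> for \<open>r \<ge> 1\<close>.\<close>

definition ES_form :: "nat \<Rightarrow> ('a::euclidean_space \<Rightarrow> 'b::euclidean_space) \<Rightarrow> ('a, 'b) form" where
  "ES_form r \<phi> =
     (if r \<le> 1 then differential_form \<phi>
      else (\<lambda>x vs. - (hodge_dirac \<phi> ^^ (r - 2)) (section_form (tension \<phi>)) x vs))"

definition ES_density :: "nat \<Rightarrow> ('a::euclidean_space \<Rightarrow> 'b::euclidean_space) \<Rightarrow> 'a \<Rightarrow> real" where
  "ES_density r \<phi> = form_norm_sq (ES_form r \<phi>)"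

text \<open>
  Compactly supported smooth variations \<open>F t\<close> of \<open>\<phi>\<close> through maps from \<open>U\<close> to the sphere. As the total
  energy over \<open>U\<close> may be infinite, it is integrated over a compact set containing the support of
  the variation.
\<close>

definition variation ::
  "'a::euclidean_space set \<Rightarrow> ('a \<Rightarrow> 'b::euclidean_space) \<Rightarrow> real \<Rightarrow> 'a set \<Rightarrow> (real \<Rightarrow> 'a \<Rightarrow> 'b) \<Rightarrow> bool" where
  "variation U \<phi> \<epsilon> K F \<longleftrightarrow>
     \<epsilon> > 0 \<and> compact K \<and> K \<subseteq> U \<and>
     smooth_on ({- \<epsilon><..<\<epsilon>} \<times> U) (\<lambda>(t, x). F t x) \<and>
     (\<forall>t\<in>{- \<epsilon><..<\<epsilon>}. \<forall>x\<in>U. F t x \<in> sphere 0 1) \<and>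
     (\<forall>x\<in>U. F 0 x = \<phi> x) \<and>
     (\<forall>t\<in>{- \<epsilon><..<\<epsilon>}. \<forall>x\<in>U - K. F t x = \<phi> x)"

definition smooth_sphere_map :: "'a::euclidean_space set \<Rightarrow> ('a \<Rightarrow> 'b::euclidean_space) \<Rightarrow> bool" where
  "smooth_sphere_map U \<phi> \<longleftrightarrow> smooth_on U \<phi> \<and> (\<forall>x\<in>U. \<phi> x \<in> sphere 0 1)"

definition critical_point ::
  "(('a::euclidean_space \<Rightarrow> 'b::euclidean_space) \<Rightarrow> 'a \<Rightarrow> real) \<Rightarrow> 'a set \<Rightarrow> ('a \<Rightarrow> 'b) \<Rightarrow> bool" where
  "critical_point e U \<phi> \<longleftrightarrow>
     (\<forall>\<epsilon> K F. variation U \<phi> \<epsilon> K F \<longrightarrow>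
        ((\<lambda>t. 1 / 2 * (LINT x:K|lebesgue. e (F t) x)) has_real_derivative 0) (at 0))"

definition harmonic_on :: "'a::euclidean_space set \<Rightarrow> ('a \<Rightarrow> 'b::euclidean_space) \<Rightarrow> bool" where
  "harmonic_on U \<phi> \<longleftrightarrow> smooth_sphere_map U \<phi> \<and> (\<forall>x\<in>U. tension \<phi> x = 0)"

definition r_harmonic_on :: "nat \<Rightarrow> 'a::euclidean_space set \<Rightarrow> ('a \<Rightarrow> 'b::euclidean_space) \<Rightarrow> bool" where
  "r_harmonic_on r U \<phi> \<longleftrightarrow> smooth_sphere_map U \<phi> \<and> critical_point (r_density r) U \<phi>"

definition ES_r_harmonic_on :: "nat \<Rightarrow> 'a::euclidean_space set \<Rightarrow> ('a \<Rightarrow> 'b::euclidean_space) \<Rightarrow> bool" where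
  "ES_r_harmonic_on r U \<phi> \<longleftrightarrow> smooth_sphere_map U \<phi> \<and> critical_point (ES_density r) U \<phi>"


section \<open>Weakly harmonic maps of the unit ball\<close>

text \<open>The weak notions are stated in the form appropriate to maps that are smooth away from the
  centre of the ball.\<close>

definition weakly_harmonic :: "('a::euclidean_space \<Rightarrow> 'b::euclidean_space) \<Rightarrow> bool" where
  "weakly_harmonic \<phi> \<longleftrightarrow> sobolev_sphere 1 (ball 0 1) \<phi> \<and> harmonic_on (ball 0 1 - {0}) \<phi>"

definition weakly_r_harmonic :: "nat \<Rightarrow> ('a::euclidean_space \<Rightarrow> 'b::euclidean_space) \<Rightarrow> bool" where
  "weakly_r_harmonic r \<phi> \<longleftrightarrow> sobolev_sphere r (ball 0 1) \<phi> \<and> r_harmonic_on r (ball 0 1 - {0}) \<phi>"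

definition weakly_ES_r_harmonic :: "nat \<Rightarrow> ('a::euclidean_space \<Rightarrow> 'b::euclidean_space) \<Rightarrow> bool" where
  "weakly_ES_r_harmonic r \<phi> \<longleftrightarrow>
     sobolev_sphere r (ball 0 1) \<phi> \<and> ES_r_harmonic_on r (ball 0 1 - {0}) \<phi>"

definition proper_weakly_r_harmonic :: "nat \<Rightarrow> ('a::euclidean_space \<Rightarrow> 'b::euclidean_space) \<Rightarrow> bool" where
  "proper_weakly_r_harmonic r \<phi> \<longleftrightarrow> weakly_r_harmonic r \<phi> \<and> \<not> weakly_harmonic \<phi>"

definition proper_weakly_ES_r_harmonic :: "nat \<Rightarrow> ('a::euclidean_space \<Rightarrow> 'b::euclidean_space) \<Rightarrow> bool" where
  "proper_weakly_ES_r_harmonic r \<phi> \<longleftrightarrow> weakly_ES_r_harmonic r \<phi> \<and> \<not> weakly_harmonic \<phi>"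

text \<open>The value at \<open>0\<close> is irrelevant. The norm of the product type is Euclidean, so
  \<open>sphere 0 1\<close> in \<open>(real ^ 'n) \<times> real\<close> is the \<open>n\<close>-sphere.\<close>

definition phi_map :: "real \<Rightarrow> real ^ 'n \<Rightarrow> (real ^ 'n) \<times> real" where
  "phi_map a x = ((sin a / norm x) *\<^sub>R x, cos a)"

end

theory Submission
  imports Defs "HOL-Computational_Algebra.Polynomial"
begin

text \<open>Write \<open>u = x / |x|\<close>, \<open>s = sin a\<close>, \<open>c = cos a\<close>, so that the map is \<open>\<phi> = (s u, c)\<close>, and let \<open>n\<close> be the
dimension of the domain. Two independent facts are combined: \<open>\<phi>\<close> is \<open>W\<^sup>r\<^sup>,\<^sup>2\<close> without being
harmonic exactly if \<open>n > 2 r\<close>, and \<open>\<phi>\<close> is critical on the punctured ball exactly if an explicit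
number vanishes.

The unit field \<open>\<eta> = (c u, - s)\<close> is tangent to the sphere and orthogonal to the image of \<open>d\<phi>\<close>.
Therefore the fields \<open>|x|\<^sup>-\<^sup>m \<eta>\<close> have derivatives that are already tangent, and the rough Laplacian
maps \<open>|x|\<^sup>-\<^sup>m \<eta>\<close> to \<open>(m (n - 2 - m) + (n - 1) c\<^sup>2) |x|\<^sup>-\<^sup>m\<^sup>-\<^sup>2 \<eta>\<close>. The tension field is
\<open>- (n - 1) s c |x|\<^sup>-\<^sup>2 \<eta>\<close>, so all its iterated Laplacians are known.
For an arbitrary compactly supported variation with velocity \<open>W\<close>, the time derivative of the energy is
computed at time 0 by exchanging time and space derivatives and integrating by parts until only \<open>W\<close>
remains (\<open>int_eq_dt0_tension\<close>, \<open>int_eq_dt0_nabla\<close>, \<open>int_eq_dt0_laplacian\<close>). Since the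
fields onto which the derivatives are moved are multiples of \<open>\<eta>\<close>, the outcome is a constant times the integral of
\<open>|x|\<^sup>-\<^sup>2\<^sup>r \<eta> \<bullet> W\<close>. Thus \<open>\<phi>\<close> is critical if the constant is 0, and rotating \<open>\<phi>\<close> towards \<open>\<eta>\<close> with a bump
function shows the converse (\<open>critical_point_radial_iff\<close>).

The ES-energies differ from the r-energies by terms in the curvature form \<open>d\<^sup>2 \<tau>\<close>, which vanishes
for \<open>\<phi>\<close>. Terms quadratic in it have no first variation. For \<open>r = 5\<close> there is one term that is linear
in it; integrated by parts, it pairs an antisymmetric form with a symmetric second derivative
(\<open>int_eq_curvature_terms\<close>).

The map is homogeneous of degree 0, so its derivatives of order \<open>k\<close> are homogeneous of degree \<open>- k\<close>.
For \<open>n > 2 r\<close> they are square integrable up to order \<open>r\<close>, and cutting out a small ball shows that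
they are weak derivatives on the whole ball (\<open>sobolev_homogeneous\<close>). For \<open>n \<le> 2 r\<close>, if there are
square integrable weak derivatives of order \<open>r\<close>, then scaling forces the classical ones to vanish
(\<open>sobolev_derivatives_vanish\<close>); by Euler's relation the first derivatives vanish as well, and \<open>\<phi>\<close> is
harmonic, hence not proper.

What remains is algebra in \<open>y = cos (2 a)\<close>. For \<open>n = 2 r + 1\<close> the constant vanishes
exactly at one of the two roots of a quadratic, and for larger \<open>n\<close> it has no zero.\<close>

section \<open>Calculus of smooth functions\<close>

abbreviation pd :: "('a::real_normed_vector \<Rightarrow> 'b::real_normed_vector) \<Rightarrow> 'a \<Rightarrow> 'a \<Rightarrow> 'b" where
  "pd f v x \<equiv> frechet_derivative f (at x) v"

lemma frechet_derivative_eqI: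
  "(f has_derivative f') (at x) \<Longrightarrow> pd f v x = f' v"
  by (metis frechet_derivative_at)

lemma iter_deriv_append: "iter_deriv (vs @ ws) f = iter_deriv vs (iter_deriv ws f)"
  by (induction vs) auto

lemma frechet_derivative_cong_open:
  assumes "open U" "x \<in> U" "\<And>y. y \<in> U \<Longrightarrow> f y = g y"
  shows "frechet_derivative f (at x) = frechet_derivative g (at x)"
proof -
  have "(f has_derivative f') (at x) \<longleftrightarrow> (g has_derivative f') (at x)" for f'
    using assms by (metis (full_types) has_derivative_transform_within_open)
  then show ?thesis by (simp add: frechet_derivative_def)
qed

lemma differentiable_cong_open:
  assumes "open U" "x \<in> U" "\<And>y. y \<in> U \<Longrightarrow> f y = g y"
  shows "f differentiable (at x) \<longleftrightarrow> g differentiable (at x)"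
  unfolding differentiable_def
  using assms by (metis (full_types) has_derivative_transform_within_open)

lemma iter_deriv_cong_open:
  assumes "open U" "\<And>y. y \<in> U \<Longrightarrow> f y = g y" "x \<in> U"
  shows "iter_deriv vs f x = iter_deriv vs g x"
  using assms(3)
proof (induction vs arbitrary: x)
  case Nil
  then show ?case using assms by simp
next
  case (Cons v vs)
  have "frechet_derivative (iter_deriv vs f) (at x) = frechet_derivative (iter_deriv vs g) (at x)"
    by (rule frechet_derivative_cong_open[OF assms(1) Cons.prems]) (rule Cons.IH)
  then show ?case by simp
qed

text \<open>Closure properties of smoothness are proved by induction on the order of
differentiability, which the definition of smoothness does not mention.\<close>

definition diff_upto :: "nat \<Rightarrow> 'a::real_normed_vector set \<Rightarrow> ('a \<Rightarrow> 'b::real_normed_vector) \<Rightarrow> bool"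
  where "diff_upto n U f \<longleftrightarrow> (\<forall>vs. length vs \<le> n \<longrightarrow> (\<forall>x\<in>U. iter_deriv vs f differentiable (at x)))"

lemma smooth_on_iff_diff_upto: "smooth_on U f \<longleftrightarrow> (\<forall>n. diff_upto n U f)"
  by (auto simp: smooth_on_def diff_upto_def)

lemma diff_upto_0: "diff_upto 0 U f \<longleftrightarrow> (\<forall>x\<in>U. f differentiable (at x))"
  by (auto simp: diff_upto_def)

text \<open>The head of a list is the outermost derivative, so the innermost one, which has to be split off
here, is its last entry.\<close>

lemma diff_upto_Suc:
  "diff_upto (Suc n) U f \<longleftrightarrow>
     (\<forall>x\<in>U. f differentiable (at x)) \<and> (\<forall>v. diff_upto n U (pd f v))"
  (is "?L \<longleftrightarrow> ?R")
proof
  assume L: ?L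
  have "f differentiable (at x)" if "x \<in> U" for x
    using L that unfolding diff_upto_def by (metis iter_deriv.simps(1) le0 list.size(3))
  moreover have "iter_deriv vs (pd f v) differentiable (at x)"
    if "length vs \<le> n" "x \<in> U" for vs v x
  proof -
    have "length (vs @ [v]) \<le> Suc n" using that by simp
    then have "iter_deriv (vs @ [v]) f differentiable (at x)"
      using L that unfolding diff_upto_def by blast
    then show ?thesis by (simp add: iter_deriv_append)
  qed
  ultimately show ?R by (auto simp: diff_upto_def)
next
  assume R: ?R
  have "iter_deriv vs f differentiable (at x)" if "length vs \<le> Suc n" "x \<in> U" for vs x
  proof (cases vs rule: rev_cases)
    case Nil
    then show ?thesis using R that by simp
  next
    case (snoc ws v)
    then show ?thesis using R that by (simp add: iter_deriv_append diff_upto_def)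
  qed
  then show ?L by (auto simp: diff_upto_def)
qed

lemma diff_upto_cong:
  assumes "open U" "\<And>x. x \<in> U \<Longrightarrow> f x = g x"
  shows "diff_upto n U f \<longleftrightarrow> diff_upto n U g"
proof -
  have "iter_deriv vs f differentiable (at x) \<longleftrightarrow> iter_deriv vs g differentiable (at x)"
    if "x \<in> U" for x vs
    by (rule differentiable_cong_open[OF assms(1) that iter_deriv_cong_open[OF assms]])
  then show ?thesis by (simp add: diff_upto_def)
qed

lemma smooth_on_cong:
  assumes "open U" "\<And>x. x \<in> U \<Longrightarrow> f x = g x"
  shows "smooth_on U f \<longleftrightarrow> smooth_on U g"
  unfolding smooth_on_iff_diff_upto using diff_upto_cong[OF assms] by simp

lemma smooth_on_subset: "smooth_on U f \<Longrightarrow> V \<subseteq> U \<Longrightarrow> smooth_on V f"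
  by (auto simp: smooth_on_def)

lemma smooth_on_differentiable: "smooth_on U f \<Longrightarrow> x \<in> U \<Longrightarrow> f differentiable (at x)"
  unfolding smooth_on_def using iter_deriv.simps(1)[of f] by (elim allE[of _ "[]"]) simp

lemma smooth_on_has_derivative:
  "smooth_on U f \<Longrightarrow> x \<in> U \<Longrightarrow> (f has_derivative frechet_derivative f (at x)) (at x)"
  using smooth_on_differentiable frechet_derivative_works by blast

lemma smooth_on_iter_deriv: "smooth_on U f \<Longrightarrow> smooth_on U (iter_deriv vs f)"
  unfolding smooth_on_def by (simp flip: iter_deriv_append)

lemma smooth_on_frechet_derivative:
  "smooth_on U f \<Longrightarrow> smooth_on U (pd f v)"
  using smooth_on_iter_deriv[of U f "[v]"] by simp

lemma smooth_on_isCont: "smooth_on U f \<Longrightarrow> x \<in> U \<Longrightarrow> isCont f x"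
  by (simp add: differentiable_imp_continuous_within smooth_on_differentiable)

lemma smooth_on_continuous_on: "smooth_on U f \<Longrightarrow> continuous_on U f"
  by (simp add: continuous_at_imp_continuous_on smooth_on_isCont)

lemma iter_deriv_const: "vs \<noteq> [] \<Longrightarrow> iter_deriv vs (\<lambda>x. c) = (\<lambda>x. 0)"
proof (induction vs)
  case (Cons v vs)
  then show ?case by (cases vs) auto
qed simp

lemma diff_upto_const: "diff_upto n U (\<lambda>x. c)"
  by (induction n arbitrary: c) (auto simp: diff_upto_0 diff_upto_Suc)

lemma smooth_on_const [intro]: "smooth_on U (\<lambda>x. c)"
  by (simp add: smooth_on_iff_diff_upto diff_upto_const)

lemma diff_upto_mono: "diff_upto n U f \<Longrightarrow> m \<le> n \<Longrightarrow> diff_upto m U f"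
  by (auto simp: diff_upto_def)

lemma diff_upto_differentiable: "diff_upto n U f \<Longrightarrow> x \<in> U \<Longrightarrow> f differentiable (at x)"
  using diff_upto_mono[of n U f 0] by (simp add: diff_upto_0)

lemma diff_upto_has_derivative:
  "diff_upto n U f \<Longrightarrow> x \<in> U \<Longrightarrow> (f has_derivative frechet_derivative f (at x)) (at x)"
  using diff_upto_differentiable frechet_derivative_works by blast

lemma diff_upto_add:
  assumes "open U"
  shows "diff_upto n U f \<Longrightarrow> diff_upto n U g \<Longrightarrow> diff_upto n U (\<lambda>x. f x + g x)"
proof (induction n arbitrary: f g)
  case 0
  then show ?case by (auto simp: diff_upto_0)
next
  case (Suc n)
  have "diff_upto n U (\<lambda>x. pd (\<lambda>x. f x + g x) v x)" for v
  proof -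
    have "diff_upto n U (\<lambda>x. pd f v x + pd g v x)"
      using Suc unfolding diff_upto_Suc by blast
    moreover have "pd (\<lambda>x. f x + g x) v x
        = pd f v x + pd g v x" if "x \<in> U" for x
      by (rule frechet_derivative_eqI)
        (intro has_derivative_add diff_upto_has_derivative[OF Suc.prems(1) that]
          diff_upto_has_derivative[OF Suc.prems(2) that])
    ultimately show ?thesis by (subst diff_upto_cong[OF assms]) auto
  qed
  then show ?case using Suc.prems unfolding diff_upto_Suc by auto
qed

lemma diff_upto_bilinear:
  assumes "open U" and B: "bounded_bilinear B"
  shows "diff_upto n U f \<Longrightarrow> diff_upto n U g \<Longrightarrow> diff_upto n U (\<lambda>x. B (f x) (g x))"
proof (induction n arbitrary: f g)
  case 0
  then show ?case
    using bounded_bilinear.FDERIV[OF B] by (auto simp: diff_upto_0 differentiable_def) blast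
next
  case (Suc n)
  have der: "((\<lambda>x. B (f x) (g x)) has_derivative
      (\<lambda>h. B (f x) (pd g h x) + B (pd f h x) (g x))) (at x)"
    if "x \<in> U" for x
    by (intro bounded_bilinear.FDERIV[OF B] diff_upto_has_derivative[OF Suc.prems(1) that]
          diff_upto_has_derivative[OF Suc.prems(2) that])
  have "diff_upto n U (\<lambda>x. pd (\<lambda>x. B (f x) (g x)) v x)" for v
  proof -
    have "diff_upto n U f" "diff_upto n U g"
      using Suc.prems by (auto intro: diff_upto_mono[of "Suc n"])
    then have "diff_upto n U (\<lambda>x. B (f x) (pd g v x)
        + B (pd f v x) (g x))"
      using Suc unfolding diff_upto_Suc by (intro diff_upto_add[OF assms(1)]) blast+
    moreover have "pd (\<lambda>x. B (f x) (g x)) v x =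
        B (f x) (pd g v x) + B (pd f v x) (g x)"
      if "x \<in> U" for x
      by (rule frechet_derivative_eqI[OF der[OF that]])
    ultimately show ?thesis by (subst diff_upto_cong[OF assms(1)]) auto
  qed
  then show ?case using der unfolding diff_upto_Suc differentiable_def by blast
qed

lemma smooth_on_bilinear:
  assumes "open U" "bounded_bilinear B" "smooth_on U f" "smooth_on U g"
  shows "smooth_on U (\<lambda>x. B (f x) (g x))"
  using assms diff_upto_bilinear unfolding smooth_on_iff_diff_upto by blast

lemma smooth_on_add:
  "open U \<Longrightarrow> smooth_on U f \<Longrightarrow> smooth_on U g \<Longrightarrow> smooth_on U (\<lambda>x. f x + g x)"
  using diff_upto_add unfolding smooth_on_iff_diff_upto by blast

lemmas smooth_on_scaleR = smooth_on_bilinear[OF _ bounded_bilinear_scaleR]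
lemmas smooth_on_inner = smooth_on_bilinear[OF _ bounded_bilinear_inner]
lemmas smooth_on_mult = smooth_on_bilinear[OF _ bounded_bilinear_mult]

lemma smooth_on_minus: "open U \<Longrightarrow> smooth_on U f \<Longrightarrow> smooth_on U (\<lambda>x. - f x)"
  using smooth_on_scaleR[of U "\<lambda>x. -1" f] by (simp add: smooth_on_const)

lemma smooth_on_diff:
  "open U \<Longrightarrow> smooth_on U f \<Longrightarrow> smooth_on U g \<Longrightarrow> smooth_on U (\<lambda>x. f x - g x)"
  using smooth_on_add[of U f "\<lambda>x. - g x"] smooth_on_minus by fastforce

lemma smooth_on_sum:
  assumes "open U"
  shows "(\<And>i. i \<in> S \<Longrightarrow> smooth_on U (f i)) \<Longrightarrow> smooth_on U (\<lambda>x. \<Sum>i\<in>S. f i x)"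
  by (induction S rule: infinite_finite_induct) (auto simp: assms intro: smooth_on_add)

text \<open>The affine maps of interest are embeddings of time slices, projections of space-time,
translations and dilations.\<close>

lemma iter_deriv_affine:
  assumes "open V" "open U" "bounded_linear L" "smooth_on V f" "\<And>x. x \<in> U \<Longrightarrow> L x + b \<in> V" "x \<in> U"
  shows "iter_deriv vs (\<lambda>x. f (L x + b)) x = iter_deriv (map L vs) f (L x + b)"
  using assms(6)
proof (induction vs arbitrary: x)
  case Nil
  then show ?case by simp
next
  case (Cons v vs)
  have "((\<lambda>x. iter_deriv (map L vs) f (L x + b)) has_derivative
      (\<lambda>h. pd (iter_deriv (map L vs) f) (L h) (L x + b))) (at x)"
  proof (rule has_derivative_compose[where g = "iter_deriv (map L vs) f"])
    show "((\<lambda>x. L x + b) has_derivative L) (at x)"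
      using bounded_linear.has_derivative[OF assms(3) has_derivative_ident]
      by (auto intro!: derivative_eq_intros)
    show "(iter_deriv (map L vs) f has_derivative
        frechet_derivative (iter_deriv (map L vs) f) (at (L x + b))) (at (L x + b))"
      using assms Cons.prems smooth_on_has_derivative smooth_on_iter_deriv by blast
  qed
  then have "pd (\<lambda>x. iter_deriv (map L vs) f (L x + b)) v x =
     pd (iter_deriv (map L vs) f) (L v) (L x + b)"
    by (rule frechet_derivative_eqI)
  then show ?case
    using frechet_derivative_cong_open[OF assms(2) Cons.prems Cons.IH] by simp
qed

lemma smooth_on_affine:
  assumes "open V" "open U" "bounded_linear L" "smooth_on V f" "\<And>x. x \<in> U \<Longrightarrow> L x + b \<in> V"
  shows "smooth_on U (\<lambda>x. f (L x + b))"
  unfolding smooth_on_def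
proof (intro allI ballI)
  fix vs x assume x: "x \<in> U"
  have "(\<lambda>x. iter_deriv (map L vs) f (L x + b)) differentiable (at x)"
  proof (rule differentiable_compose[where g = "\<lambda>x. L x + b"])
    show "(\<lambda>x. L x + b) differentiable (at x)"
      by (intro differentiable_add bounded_linear_imp_differentiable[OF assms(3)]) auto
    show "iter_deriv (map L vs) f differentiable (at (L x + b))"
      using assms(4,5) x unfolding smooth_on_def by blast
  qed
  then show "iter_deriv vs (\<lambda>x. f (L x + b)) differentiable (at x)"
    by (subst differentiable_cong_open[OF assms(2) x iter_deriv_affine[OF assms]]) auto
qed

lemma smooth_on_bounded_linear: "bounded_linear L \<Longrightarrow> smooth_on U L"
proof -
  assume L: "bounded_linear L"
  have "diff_upto n UNIV L" for n
  proof (cases n)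
    case 0
    then show ?thesis using L bounded_linear_imp_differentiable diff_upto_0 by blast
  next
    case (Suc m)
    have "pd L v x = L v" for x v
      by (rule frechet_derivative_eqI) (use L bounded_linear_imp_has_derivative in blast)
    then show ?thesis
      using L Suc bounded_linear_imp_differentiable diff_upto_const by (auto simp: diff_upto_Suc)
  qed
  then show ?thesis
    using smooth_on_subset smooth_on_iff_diff_upto by blast
qed

lemma smooth_on_id: "smooth_on U (\<lambda>x. x)"
  by (rule smooth_on_bounded_linear) (rule bounded_linear_ident)

lemma smooth_on_linear_compose:
  fixes L :: "'b::real_normed_vector \<Rightarrow> 'c::real_normed_vector"
  assumes "open U" "bounded_linear L" "smooth_on U f"
  shows "smooth_on U (\<lambda>x. L (f x))"
proof -
  have "bounded_bilinear (\<lambda>r x. r *\<^sub>R L x :: 'c)"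
    using bounded_bilinear.comp[OF bounded_bilinear_scaleR bounded_linear_ident assms(2)] .
  from smooth_on_bilinear[OF assms(1) this, of "\<lambda>x. 1"] assms(3) show ?thesis
    by (simp add: smooth_on_const)
qed

lemma smooth_on_Pair:
  fixes f :: "'a::real_normed_vector \<Rightarrow> 'c::real_normed_vector" and g :: "'a \<Rightarrow> 'd::real_normed_vector"
  assumes "open U" "smooth_on U f" "smooth_on U g"
  shows "smooth_on U (\<lambda>x. (f x, g x))"
proof -
  have "smooth_on U (\<lambda>x. (f x, 0::'d))"
    by (rule smooth_on_linear_compose[OF assms(1) _ assms(2)])
      (intro bounded_linear_Pair bounded_linear_ident bounded_linear_zero)
  moreover have "smooth_on U (\<lambda>x. (0::'c, g x))"
    by (rule smooth_on_linear_compose[OF assms(1) _ assms(3)])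
      (intro bounded_linear_Pair bounded_linear_ident bounded_linear_zero)
  ultimately show ?thesis using smooth_on_add[OF assms(1)] by fastforce
qed

text \<open>By the chain rule, the derivative of \<open>h \<circ> g\<close> is a derivative of \<open>g\<close> times \<open>h' \<circ> g\<close> with \<open>h'\<close> in
the same family \<open>S\<close>. Hence an induction on the order works for all members of \<open>S\<close> at once, without
any formula for higher derivatives of a composition.\<close>

lemma smooth_on_real_compose:
  fixes g :: "'a::real_normed_vector \<Rightarrow> real" and S :: "(real \<Rightarrow> real) set"
  assumes U: "open U" and g: "smooth_on U g" and gV: "\<And>x. x \<in> U \<Longrightarrow> g x \<in> V"
    and S: "\<And>h. h \<in> S \<Longrightarrow> \<exists>h'\<in>S. \<forall>y\<in>V. (h has_real_derivative h' y) (at y)"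
    and h: "h \<in> S"
  shows "smooth_on U (\<lambda>x. h (g x))"
proof -
  have "diff_upto n U (\<lambda>x. h (g x))" if "h \<in> S" for h n
    using that
  proof (induction n arbitrary: h)
    case 0
    then obtain h' where h': "\<forall>y\<in>V. (h has_real_derivative h' y) (at y)" using S by blast
    have "(\<lambda>x. h (g x)) differentiable (at x)" if "x \<in> U" for x
    proof (rule differentiable_compose[of h])
      show "h differentiable (at (g x))"
        using h' gV[OF that] real_differentiable_def by (metis)
      show "g differentiable at x" using g that smooth_on_differentiable by blast
    qed
    then show ?case by (simp add: diff_upto_0)
  next
    case (Suc n)
    from Suc.prems obtain h' where h': "h' \<in> S" "\<forall>y\<in>V. (h has_real_derivative h' y) (at y)"
      using S by blast
    have der: "((\<lambda>x. h (g x)) has_derivative (\<lambda>v. pd g v x * h' (g x))) (at x)"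
      if "x \<in> U" for x
      using has_derivative_compose[OF smooth_on_has_derivative[OF g that], of h "\<lambda>v. h' (g x) * v"]
        h'(2) gV[OF that] by (simp add: has_field_derivative_def mult_commute_abs) (simp add: mult.commute)
    have "diff_upto n U (\<lambda>x. pd g v x * h' (g x))" for v
      using Suc.IH[OF h'(1)] smooth_on_frechet_derivative[OF g]
      by (intro diff_upto_bilinear[OF U bounded_bilinear_mult]) (auto simp: smooth_on_iff_diff_upto)
    moreover have "pd (\<lambda>x. h (g x)) v x = pd g v x * h' (g x)"
      if "x \<in> U" for x v
      by (rule frechet_derivative_eqI[OF der[OF that]])
    ultimately have "diff_upto n U (\<lambda>x. pd (\<lambda>x. h (g x)) v x)" for v
      by (subst diff_upto_cong[OF U]) auto
    then show ?case using der unfolding diff_upto_Suc differentiable_def by blast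
  qed
  with h show ?thesis by (simp add: smooth_on_iff_diff_upto)
qed

lemma smooth_on_sin:
  assumes "open U" "smooth_on U g"
  shows "smooth_on U (\<lambda>x. sin (g x :: real))"
  by (rule smooth_on_real_compose[OF assms, where V = UNIV and S = "{sin, cos, \<lambda>x. - sin x, \<lambda>x. - cos x}"])
    (auto intro!: derivative_eq_intros)

lemma smooth_on_cos:
  assumes "open U" "smooth_on U g"
  shows "smooth_on U (\<lambda>x. cos (g x :: real))"
  by (rule smooth_on_real_compose[OF assms, where V = UNIV and S = "{sin, cos, \<lambda>x. - sin x, \<lambda>x. - cos x}"])
    (auto intro!: derivative_eq_intros)

lemma smooth_on_powr:
  assumes "open U" "smooth_on U g" "\<And>x. x \<in> U \<Longrightarrow> g x > (0::real)"
  shows "smooth_on U (\<lambda>x. g x powr p)"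
proof (rule smooth_on_real_compose[OF assms(1,2), where V = "{0<..}" and S = "{\<lambda>y. c * y powr q | c q. True}"])
  fix h :: "real \<Rightarrow> real" assume "h \<in> {\<lambda>y. c * y powr q |c q. True}"
  then obtain c q where h: "h = (\<lambda>y. c * y powr q)" by blast
  have "\<forall>y\<in>{0<..}. (h has_real_derivative (c * q) * y powr (q - 1)) (at y)"
    unfolding h by (auto intro!: derivative_eq_intros)
  then show "\<exists>h'\<in>{\<lambda>y. c * y powr q |c q. True}. \<forall>y\<in>{0<..}. (h has_real_derivative h' y) (at y)"
    by (intro bexI[of _ "\<lambda>y. (c * q) * y powr (q - 1)"]) auto
next
  show "(\<lambda>y. y powr p) \<in> {\<lambda>y. c * y powr q |c q. True}"
    by (rule CollectI, rule exI[of _ 1], rule exI[of _ p]) simp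
qed (use assms in auto)

lemma smooth_on_inverse_norm: "smooth_on (- {0}) (\<lambda>x::'a::real_inner. inverse (norm x))"
proof -
  have "smooth_on (- {0}) (\<lambda>x::'a. (x \<bullet> x) powr (- 1/2))"
    by (intro smooth_on_powr smooth_on_inner smooth_on_id) auto
  moreover have "(x \<bullet> x) powr (- 1/2) = inverse (norm x)" if "x \<in> - {0}" for x :: 'a
    using that by (simp add: powr_minus norm_eq_sqrt_inner powr_half_sqrt)
  ultimately show ?thesis by (subst smooth_on_cong) auto
qed

lemma smooth_on_power: "open U \<Longrightarrow> smooth_on U f \<Longrightarrow> smooth_on U (\<lambda>x. (f x :: real) ^ n)"
  by (induction n) (auto intro: smooth_on_mult)

section \<open>Flat functions\<close>

text \<open>For \<open>p = 1\<close> this is the standard example of a smooth function that is flat at 0. The polynomial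
factor makes the family closed under differentiation.\<close>

definition flat_exp :: "real poly \<Rightarrow> real \<Rightarrow> real" where
  "flat_exp p y = (if y > 0 then poly p (1 / y) * exp (- 1 / y) else 0)"

lemma tendsto_poly_exp_0: "((\<lambda>w. poly p w * exp (- w)) \<longlongrightarrow> (0::real)) at_top"
proof -
  have "((\<lambda>w. \<Sum>i\<le>degree p. coeff p i * (w ^ i / exp w)) \<longlongrightarrow> (\<Sum>i\<le>degree p. coeff p i * 0)) at_top"
    by (intro tendsto_sum tendsto_mult tendsto_const tendsto_power_div_exp_0)
  moreover have "(\<Sum>i\<le>degree p. coeff p i * (w ^ i / exp w)) = poly p w * exp (- w)" for w
    by (simp add: poly_altdef sum_distrib_right exp_minus divide_inverse mult.assoc)
  ultimately show ?thesis by simp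
qed

text \<open>At 0 the difference quotient from the right is \<open>w p(w) exp(- w)\<close> with \<open>w = 1 / y\<close> tending to infinity.\<close>

lemma flat_exp_has_derivative:
  "(flat_exp p has_real_derivative flat_exp ((p - pderiv p) * [:0, 0, 1:]) y) (at y)"
proof -
  consider "y > 0" | "y < 0" | "y = 0" by linarith
  then show ?thesis
  proof cases
    case 1
    have "((\<lambda>y. poly p (1 / y) * exp (- 1 / y)) has_real_derivative
        flat_exp ((p - pderiv p) * [:0, 0, 1:]) y) (at y)"
      using 1 by (auto intro!: derivative_eq_intros DERIV_chain'[of "\<lambda>y. 1 / y", OF _ poly_DERIV]
          simp: flat_exp_def field_simps power2_eq_square)
    then show ?thesis
      by (rule has_field_derivative_transform_within_open[where S = "{0<..}"])
        (use 1 in \<open>auto simp: flat_exp_def\<close>)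
  next
    case 2
    have "((\<lambda>y. 0) has_real_derivative flat_exp ((p - pderiv p) * [:0, 0, 1:]) y) (at y)"
      using 2 by (auto simp: flat_exp_def)
    then show ?thesis
      by (rule has_field_derivative_transform_within_open[where S = "{..<0}"])
        (use 2 in \<open>auto simp: flat_exp_def\<close>)
  next
    case 3
    have "((\<lambda>h. flat_exp p h / h) \<longlongrightarrow> 0) (at_right 0)"
    proof (rule Lim_transform_eventually)
      show "((\<lambda>h. poly (pCons 0 p) (inverse h) * exp (- inverse h)) \<longlongrightarrow> 0) (at_right (0::real))"
        by (rule filterlim_compose[OF tendsto_poly_exp_0 filterlim_inverse_at_top_right])
      show "\<forall>\<^sub>F h in at_right 0. poly (pCons 0 p) (inverse h) * exp (- inverse h) = flat_exp p h / h"
        by (rule eventually_at_right_less[THEN eventually_mono])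
          (auto simp: flat_exp_def field_simps)
    qed
    moreover have "((\<lambda>h. flat_exp p h / h) \<longlongrightarrow> 0) (at_left 0)"
      by (rule Lim_transform_eventually[OF tendsto_const])
        (auto simp: flat_exp_def eventually_at_filter)
    ultimately have "((\<lambda>h. flat_exp p h / h) \<longlongrightarrow> 0) (at 0)"
      by (intro filterlim_split_at)
    then show ?thesis
      using 3 by (simp add: has_field_derivative_iff flat_exp_def)
  qed
qed

lemma smooth_on_flat_exp:
  assumes "open U" "smooth_on U g"
  shows "smooth_on U (\<lambda>x. flat_exp p (g x))"
  by (rule smooth_on_real_compose[OF assms, where V = UNIV and S = "range flat_exp"])
    (use flat_exp_has_derivative in blast)+

lemma flat_exp_1_pos: "y > 0 \<Longrightarrow> flat_exp 1 y > 0"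
  and flat_exp_nonpos: "y \<le> 0 \<Longrightarrow> flat_exp p y = 0"
  and flat_exp_1_nonneg: "flat_exp 1 y \<ge> 0"
  by (auto simp: flat_exp_def)

section \<open>Symmetry of second derivatives\<close>

lemma line_has_vector_derivative:
  assumes "smooth_on U f" "p + \<sigma> *\<^sub>R v \<in> U"
  shows "((\<lambda>\<sigma>. f (p + \<sigma> *\<^sub>R v)) has_vector_derivative pd f v (p + \<sigma> *\<^sub>R v)) (at \<sigma>)"
proof -
  have "((\<lambda>\<sigma>. p + \<sigma> *\<^sub>R v) has_vector_derivative v) (at \<sigma>)"
    by (auto intro!: derivative_eq_intros)
  from vector_derivative_diff_chain_within[OF this, where g = f and g' = "frechet_derivative f (at (p + \<sigma> *\<^sub>R v))"]
    smooth_on_has_derivative[OF assms]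
  show ?thesis by (auto simp: o_def intro: has_derivative_at_withinI)
qed

text \<open>Two applications of the mean value theorem. The quotient is symmetric in \<open>v\<close> and \<open>w\<close>, so
uniqueness of the limit yields the symmetry of second derivatives.\<close>

lemma second_difference_limit:
  fixes f :: "'a::real_normed_vector \<Rightarrow> real"
  assumes U: "open U" and f: "smooth_on U f" and x: "x \<in> U"
  shows "((\<lambda>s. (f (x + s *\<^sub>R v + s *\<^sub>R w) - f (x + s *\<^sub>R v) - f (x + s *\<^sub>R w) + f x) / s\<^sup>2)
     \<longlongrightarrow> pd (pd f v) w x) (at_right 0)"
proof (rule tendstoI)
  fix e :: real assume e: "e > 0"
  let ?g = "\<lambda>y. pd f v y"
  let ?h = "\<lambda>y. pd ?g w y"
  have g: "smooth_on U ?g" and h: "smooth_on U ?h"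
    using f by (auto intro!: smooth_on_frechet_derivative)
  obtain r where r: "r > 0" "ball x r \<subseteq> U"
    using U x open_contains_ball by blast
  obtain d where d: "d > 0" "\<And>y. dist y x < d \<Longrightarrow> dist (?h y) (?h x) < e"
    using smooth_on_isCont[OF h x] e unfolding continuous_at_eps_delta by blast
  define m where "m = min r d / (norm v + norm w + 1)"
  have m: "m > 0" using r d by (simp add: m_def add_nonneg_pos)
  have near: "dist (x + \<sigma> *\<^sub>R v + \<zeta> *\<^sub>R w) x < min r d"
    if "0 \<le> \<sigma>" "\<sigma> < m" "0 \<le> \<zeta>" "\<zeta> < m" for \<sigma> \<zeta>
  proof -
    have "dist (x + \<sigma> *\<^sub>R v + \<zeta> *\<^sub>R w) x \<le> \<sigma> * norm v + \<zeta> * norm w"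
      using norm_triangle_ineq[of "\<sigma> *\<^sub>R v" "\<zeta> *\<^sub>R w"] that by (simp add: dist_norm add.assoc)
    also have "\<dots> \<le> m * norm v + m * norm w"
      using that by (intro add_mono mult_right_mono) auto
    also have "\<dots> < m * (norm v + norm w + 1)" using m by (simp add: algebra_simps)
    also have "\<dots> = min r d" by (simp add: m_def add_nonneg_pos add_nonneg_eq_0_iff)
    finally show ?thesis .
  qed
  have inU: "x + \<sigma> *\<^sub>R v + \<zeta> *\<^sub>R w \<in> U"
    if "0 \<le> \<sigma>" "\<sigma> < m" "0 \<le> \<zeta>" "\<zeta> < m" for \<sigma> \<zeta>
    using near[OF that] r(2) by (auto simp: dist_commute)
  have "dist ((f (x + s *\<^sub>R v + s *\<^sub>R w) - f (x + s *\<^sub>R v) - f (x + s *\<^sub>R w) + f x) / s\<^sup>2) (?h x) < e"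
    if s: "0 < s" "s < m" for s
  proof -
    have "\<exists>\<xi>>0. \<xi> < s \<and> (f (x + s *\<^sub>R w + s *\<^sub>R v) - f (x + s *\<^sub>R v)) - (f (x + s *\<^sub>R w + 0 *\<^sub>R v) - f (x + 0 *\<^sub>R v))
        = (s - 0) * (?g (x + s *\<^sub>R w + \<xi> *\<^sub>R v) - ?g (x + \<xi> *\<^sub>R v))"
    proof (rule MVT2[OF s(1)])
      fix \<xi> assume \<xi>: "0 \<le> \<xi>" "\<xi> \<le> s"
      have "x + s *\<^sub>R w + \<xi> *\<^sub>R v \<in> U" "x + \<xi> *\<^sub>R v \<in> U"
        using inU[of \<xi> s] inU[of \<xi> 0] \<xi> s by (auto simp: add_ac)
      then show "((\<lambda>\<sigma>. f (x + s *\<^sub>R w + \<sigma> *\<^sub>R v) - f (x + \<sigma> *\<^sub>R v)) has_real_derivative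
          ?g (x + s *\<^sub>R w + \<xi> *\<^sub>R v) - ?g (x + \<xi> *\<^sub>R v)) (at \<xi>)"
        unfolding has_real_derivative_iff_has_vector_derivative
        by (intro has_vector_derivative_diff line_has_vector_derivative[OF f])
    qed
    then obtain \<xi> where \<xi>: "0 < \<xi>" "\<xi> < s"
      "(f (x + s *\<^sub>R w + s *\<^sub>R v) - f (x + s *\<^sub>R v)) - (f (x + s *\<^sub>R w) - f x)
        = s * (?g (x + s *\<^sub>R w + \<xi> *\<^sub>R v) - ?g (x + \<xi> *\<^sub>R v))" by auto
    have "\<exists>\<zeta>>0. \<zeta> < s \<and> ?g (x + \<xi> *\<^sub>R v + s *\<^sub>R w) - ?g (x + \<xi> *\<^sub>R v + 0 *\<^sub>R w)
        = (s - 0) * ?h (x + \<xi> *\<^sub>R v + \<zeta> *\<^sub>R w)"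
    proof (rule MVT2[OF s(1)])
      fix \<zeta> assume \<zeta>: "0 \<le> \<zeta>" "\<zeta> \<le> s"
      have "x + \<xi> *\<^sub>R v + \<zeta> *\<^sub>R w \<in> U" using inU[of \<xi> \<zeta>] \<xi> \<zeta> s by auto
      then show "((\<lambda>\<zeta>. ?g (x + \<xi> *\<^sub>R v + \<zeta> *\<^sub>R w)) has_real_derivative
          ?h (x + \<xi> *\<^sub>R v + \<zeta> *\<^sub>R w)) (at \<zeta>)"
        unfolding has_real_derivative_iff_has_vector_derivative
        by (intro line_has_vector_derivative[OF g])
    qed
    then obtain \<zeta> where \<zeta>: "0 < \<zeta>" "\<zeta> < s"
      "?g (x + \<xi> *\<^sub>R v + s *\<^sub>R w) - ?g (x + \<xi> *\<^sub>R v) = s * ?h (x + \<xi> *\<^sub>R v + \<zeta> *\<^sub>R w)" by auto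
    have "f (x + s *\<^sub>R v + s *\<^sub>R w) - f (x + s *\<^sub>R v) - f (x + s *\<^sub>R w) + f x
        = s * (s * ?h (x + \<xi> *\<^sub>R v + \<zeta> *\<^sub>R w))"
      using \<xi>(3) \<zeta>(3) by (simp add: add_ac diff_diff_eq2)
    then have "(f (x + s *\<^sub>R v + s *\<^sub>R w) - f (x + s *\<^sub>R v) - f (x + s *\<^sub>R w) + f x) / s\<^sup>2
        = ?h (x + \<xi> *\<^sub>R v + \<zeta> *\<^sub>R w)"
      using s by (simp add: power2_eq_square)
    then show ?thesis using d(2) near[of \<xi> \<zeta>] \<xi> \<zeta> s by auto
  qed
  then show "\<forall>\<^sub>F s in at_right 0. dist ((f (x + s *\<^sub>R v + s *\<^sub>R w) - f (x + s *\<^sub>R v) - f (x + s *\<^sub>R w) + f x) / s\<^sup>2) (?h x) < e"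
    unfolding eventually_at_right_field using m by blast
qed

lemma mixed_partials_real:
  fixes f :: "'a::real_normed_vector \<Rightarrow> real"
  assumes "open U" "smooth_on U f" "x \<in> U"
  shows "pd (pd f v) w x
       = pd (pd f w) v x"
proof (rule tendsto_unique[OF _ second_difference_limit[OF assms]])
  have "(\<lambda>s. (f (x + s *\<^sub>R v + s *\<^sub>R w) - f (x + s *\<^sub>R v) - f (x + s *\<^sub>R w) + f x) / s\<^sup>2)
      = (\<lambda>s. (f (x + s *\<^sub>R w + s *\<^sub>R v) - f (x + s *\<^sub>R w) - f (x + s *\<^sub>R v) + f x) / s\<^sup>2)"
    by (simp add: algebra_simps)
  then show "((\<lambda>s. (f (x + s *\<^sub>R v + s *\<^sub>R w) - f (x + s *\<^sub>R v) - f (x + s *\<^sub>R w) + f x) / s\<^sup>2)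
     \<longlongrightarrow> pd (pd f w) v x) (at_right 0)"
    using second_difference_limit[OF assms, of w v] by simp
qed simp

lemma frechet_derivative_diff:
  "f differentiable (at x) \<Longrightarrow> g differentiable (at x) \<Longrightarrow>
    pd (\<lambda>y. f y - g y) v x = pd f v x - pd g v x"
  by (rule frechet_derivative_eqI) (intro has_derivative_diff, auto simp: frechet_derivative_works)

lemma frechet_derivative_scaleR:
  "f differentiable (at x) \<Longrightarrow> g differentiable (at x) \<Longrightarrow>
    pd (\<lambda>y. f y *\<^sub>R g y) v x
      = f x *\<^sub>R pd g v x + pd f v x *\<^sub>R g x"
  by (rule frechet_derivative_eqI) (intro has_derivative_scaleR, auto simp: frechet_derivative_works)

lemma frechet_derivative_sum:
  assumes "\<And>i. i \<in> S \<Longrightarrow> f i differentiable (at x)"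
  shows "pd (\<lambda>y. \<Sum>i\<in>S. f i y) v x = (\<Sum>i\<in>S. pd (f i) v x)"
  by (rule frechet_derivative_eqI) (intro has_derivative_sum, use assms in \<open>auto simp: frechet_derivative_works\<close>)

lemma frechet_derivative_inner_const:
  assumes "f differentiable (at x)"
  shows "pd (\<lambda>y. f y \<bullet> b) v x = pd f v x \<bullet> b"
  by (rule frechet_derivative_eqI)
    (use assms in \<open>auto simp: frechet_derivative_works intro!: has_derivative_inner_left\<close>)

lemma mixed_partials:
  fixes f :: "'a::real_normed_vector \<Rightarrow> 'b::euclidean_space"
  assumes U: "open U" and f: "smooth_on U f" and x: "x \<in> U"
  shows "pd (pd f v) w x
       = pd (pd f w) v x"
proof (rule euclidean_eqI)
  fix b :: 'b
  have fb: "smooth_on U (\<lambda>y. f y \<bullet> b)"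
    by (intro smooth_on_inner U f smooth_on_const)
  have eq: "pd (\<lambda>y. pd (\<lambda>y. f y \<bullet> b) v y) w x
      = pd (pd f v) w x \<bullet> b" for v w
  proof -
    have "frechet_derivative (\<lambda>y. pd (\<lambda>y. f y \<bullet> b) v y) (at x)
      = frechet_derivative (\<lambda>y. pd f v y \<bullet> b) (at x)"
      by (rule frechet_derivative_cong_open[OF U x])
        (simp add: frechet_derivative_inner_const smooth_on_differentiable[OF f])
    then show ?thesis
      by (simp add: frechet_derivative_inner_const smooth_on_differentiable[OF smooth_on_frechet_derivative[OF f] x])
  qed
  show "pd (pd f v) w x \<bullet> b
       = pd (pd f w) v x \<bullet> b"
    using mixed_partials_real[OF U fb x] by (simp add: eq)
qed

section \<open>Differentiation under the integral and integration by parts\<close>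

lemma set_integrable_continuous_compact:
  fixes f :: "'a::euclidean_space \<Rightarrow> 'b::{banach, second_countable_topology}"
  assumes "compact K" "continuous_on K f"
  shows "set_integrable lebesgue K f"
proof -
  have *: "integrable lborel (\<lambda>x. indicator K x *\<^sub>R f x)"
    by (rule borel_integrable_compact[OF assms])
  then show ?thesis
    unfolding set_integrable_def by (subst integrable_completion) auto
qed

text \<open>Dominated convergence: on a smaller, compact time interval the difference quotients are bounded by
the maximum of the time derivative.\<close>

lemma leibniz_compact:
  fixes D :: "real \<Rightarrow> 'a::euclidean_space \<Rightarrow> real"
  assumes K: "compact K" and \<epsilon>: "\<epsilon> > 0"
    and der: "\<And>t x. \<bar>t\<bar> < \<epsilon> \<Longrightarrow> x \<in> K \<Longrightarrow> ((\<lambda>t. D t x) has_real_derivative D' t x) (at t)"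
    and cont': "continuous_on ({- \<epsilon><..<\<epsilon>} \<times> K) (\<lambda>(t, x). D' t x)"
    and cont: "\<And>t. \<bar>t\<bar> < \<epsilon> \<Longrightarrow> continuous_on K (D t)"
  shows "((\<lambda>t. LINT x:K|lebesgue. D t x) has_real_derivative (LINT x:K|lebesgue. D' 0 x)) (at 0)"
proof -
  have int: "set_integrable lebesgue K (D t)" if "\<bar>t\<bar> < \<epsilon>" for t
    using set_integrable_continuous_compact[OF K cont[OF that]] .
  have "compact ({- (\<epsilon>/2)..\<epsilon>/2} \<times> K)" using K by (intro compact_Times) auto
  moreover have "continuous_on ({- (\<epsilon>/2)..\<epsilon>/2} \<times> K) (\<lambda>(t, x). D' t x)"
    by (rule continuous_on_subset[OF cont']) (use \<epsilon> in auto)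
  ultimately have "bounded ((\<lambda>(t, x). D' t x) ` ({- (\<epsilon>/2)..\<epsilon>/2} \<times> K))"
    by (intro compact_imp_bounded compact_continuous_image)
  then obtain M where M: "\<And>t x. \<bar>t\<bar> \<le> \<epsilon>/2 \<Longrightarrow> x \<in> K \<Longrightarrow> \<bar>D' t x\<bar> \<le> M"
    unfolding bounded_iff by (force simp: abs_le_iff)
  have bound: "\<bar>(D t x - D 0 x) / t\<bar> \<le> M" if "t \<noteq> 0" "\<bar>t\<bar> \<le> \<epsilon>/2" "x \<in> K" for t x
  proof -
    have "norm (D t x - D 0 x) \<le> M * norm (t - 0)"
    proof (rule field_differentiable_bound[of "{- (\<epsilon>/2)..\<epsilon>/2}" "\<lambda>t. D t x" "\<lambda>t. D' t x"])
      fix z assume z: "z \<in> {- (\<epsilon>/2)..\<epsilon>/2}"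
      then have "\<bar>z\<bar> < \<epsilon>" using \<epsilon> by auto
      then show "((\<lambda>t. D t x) has_real_derivative D' z x) (at z within {- (\<epsilon>/2)..\<epsilon>/2})"
        using der[of z x] that(3) by (auto intro: has_field_derivative_at_within)
      show "norm (D' z x) \<le> M" using M[of z x] z that by auto
    qed (use that \<epsilon> in auto)
    then show ?thesis using that by (simp add: abs_divide divide_le_eq)
  qed
  have "((\<lambda>t. ((LINT x:K|lebesgue. D t x) - (LINT x:K|lebesgue. D 0 x)) / (t - 0))
      \<longlongrightarrow> (LINT x:K|lebesgue. D' 0 x)) (at 0)"
    unfolding tendsto_at_iff_sequentially
  proof (intro allI impI)
    fix X :: "nat \<Rightarrow> real" assume X: "\<forall>i. X i \<in> UNIV - {0}" "X \<longlonglongrightarrow> 0"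
    obtain N where N: "\<And>i. i \<ge> N \<Longrightarrow> \<bar>X i\<bar> < \<epsilon>/2"
      using LIMSEQ_D[OF X(2), of "\<epsilon>/2"] \<epsilon> by auto
    \<comment> \<open>the bound on the difference quotients requires times of modulus at most \<open>\<epsilon> / 2\<close>\<close>
    define Y where "Y = (\<lambda>i. X (i + N))"
    have Y: "Y i \<noteq> 0" "\<bar>Y i\<bar> < \<epsilon>/2" for i using X(1) N by (auto simp: Y_def)
    have Y0: "Y \<longlonglongrightarrow> 0" unfolding Y_def by (rule LIMSEQ_ignore_initial_segment[OF X(2)])
    have eq: "((LINT x:K|lebesgue. D (Y i) x) - (LINT x:K|lebesgue. D 0 x)) / (Y i - 0)
        = (LINT x:K|lebesgue. (D (Y i) x - D 0 x) / Y i)" for i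
      using int[of "Y i"] int[of 0] Y[of i] \<epsilon> by (simp add: set_integral_diff)
    have "(\<lambda>i. LINT x:K|lebesgue. (D (Y i) x - D 0 x) / Y i) \<longlonglongrightarrow> (LINT x:K|lebesgue. D' 0 x)"
      unfolding set_lebesgue_integral_def
    proof (rule integral_dominated_convergence[where w = "\<lambda>x. indicator K x *\<^sub>R M"])
      have "continuous_on K (\<lambda>x. (0::real, x))" by (intro continuous_intros)
      then have "continuous_on K (\<lambda>x. (\<lambda>(t, x). D' t x) (0, x))"
        by (rule continuous_on_compose2[OF cont']) (use \<epsilon> in auto)
      then have "continuous_on K (\<lambda>x. D' 0 x)" by simp
      from set_integrable_continuous_compact[OF K this]
      show "(\<lambda>x. indicator K x *\<^sub>R D' 0 x) \<in> borel_measurable lebesgue"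
        by (simp add: set_integrable_def)
      show "(\<lambda>x. indicator K x *\<^sub>R ((D (Y i) x - D 0 x) / Y i)) \<in> borel_measurable lebesgue" for i
      proof -
        have "set_integrable lebesgue K (\<lambda>x. (D (Y i) x - D 0 x) / Y i)"
          using int[of "Y i"] int[of 0] Y[of i] \<epsilon> by (intro set_integral_diff set_integrable_divide) auto
        then show ?thesis by (simp add: set_integrable_def)
      qed
      show "integrable lebesgue (\<lambda>x. indicator K x *\<^sub>R M)"
        using set_integrable_continuous_compact[OF K, of "\<lambda>x. M"]
        by (simp add: set_integrable_def)
      show "AE x in lebesgue. norm (indicator K x *\<^sub>R ((D (Y i) x - D 0 x) / Y i)) \<le> indicator K x *\<^sub>R M" for i
        using bound[OF Y(1)[of i] less_imp_le[OF Y(2)[of i]]]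
        by (intro AE_I2) (auto simp: indicator_def)
      show "AE x in lebesgue. (\<lambda>i. indicator K x *\<^sub>R ((D (Y i) x - D 0 x) / Y i)) \<longlonglongrightarrow> indicator K x *\<^sub>R D' 0 x"
      proof (intro AE_I2)
        fix x
        show "(\<lambda>i. indicator K x *\<^sub>R ((D (Y i) x - D 0 x) / Y i)) \<longlonglongrightarrow> indicator K x *\<^sub>R D' 0 x"
        proof (cases "x \<in> K")
          case True
          have "((\<lambda>t. (D t x - D 0 x) / (t - 0)) \<longlongrightarrow> D' 0 x) (at 0)"
            using der[of 0 x] True \<epsilon> by (simp add: has_field_derivative_iff)
          then have "((\<lambda>t. (D t x - D 0 x) / (t - 0)) \<circ> Y) \<longlonglongrightarrow> D' 0 x"
            unfolding tendsto_at_iff_sequentially using Y Y0 by auto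
          then show ?thesis using True by (simp add: o_def)
        qed auto
      qed
    qed
    then have "(\<lambda>i. ((\<lambda>t. ((LINT x:K|lebesgue. D t x) - (LINT x:K|lebesgue. D 0 x)) / (t - 0)) \<circ> X) (i + N))
        \<longlonglongrightarrow> (LINT x:K|lebesgue. D' 0 x)"
      unfolding eq[symmetric] by (simp add: Y_def o_def)
    then show "((\<lambda>t. ((LINT x:K|lebesgue. D t x) - (LINT x:K|lebesgue. D 0 x)) / (t - 0)) \<circ> X)
        \<longlonglongrightarrow> (LINT x:K|lebesgue. D' 0 x)"
      by (rule LIMSEQ_offset)
  qed
  then show ?thesis by (simp add: has_field_derivative_iff)
qed

lemma leibniz_smooth:
  fixes D :: "real \<times> 'a::euclidean_space \<Rightarrow> real"
  assumes "open U" and K: "compact K" "K \<subseteq> U" and \<epsilon>: "\<epsilon> > 0"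
    and D: "smooth_on ({- \<epsilon><..<\<epsilon>} \<times> U) D"
  shows "((\<lambda>t. LINT x:K|lebesgue. D (t, x)) has_real_derivative
      (LINT x:K|lebesgue. pd D (1, 0) (0, x))) (at 0)"
proof (rule leibniz_compact[OF K(1) \<epsilon>])
  fix t x assume t: "\<bar>t\<bar> < \<epsilon>" and x: "x \<in> K"
  have "((\<lambda>s. D ((0, x) + s *\<^sub>R (1, 0))) has_vector_derivative
      pd D (1, 0) ((0, x) + t *\<^sub>R (1, 0))) (at t)"
    by (rule line_has_vector_derivative[OF D]) (use t x K in auto)
  then show "((\<lambda>t. D (t, x)) has_real_derivative pd D (1, 0) (t, x)) (at t)"
    by (simp add: has_real_derivative_iff_has_vector_derivative)
next
  have "continuous_on ({- \<epsilon><..<\<epsilon>} \<times> U) (pd D (1, 0))"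
    by (intro smooth_on_continuous_on smooth_on_frechet_derivative D)
  then show "continuous_on ({- \<epsilon><..<\<epsilon>} \<times> K) (\<lambda>(t, x). pd D (1, 0) (t, x))"
    by (rule continuous_on_subset[THEN continuous_on_eq]) (use K in auto)
next
  fix t assume t: "\<bar>t\<bar> < \<epsilon>"
  show "continuous_on K (\<lambda>x. D (t, x))"
    by (rule continuous_on_compose2[OF smooth_on_continuous_on[OF D]])
      (use t K in \<open>auto intro!: continuous_intros\<close>)
qed

lemma lebesgue_integral_translation:
  fixes f :: "'a::euclidean_space \<Rightarrow> real"
  assumes "f \<in> borel_measurable borel"
  shows "(LINT x|lebesgue. f (x + c)) = (LINT x|lebesgue. f x)"
proof -
  have [measurable]: "f \<in> borel_measurable borel" by fact
  have "(LINT x|lebesgue. f x) = (LINT x|lborel. f x)"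
    by (rule integral_completion) simp
  also have "\<dots> = (LINT x|distr lborel borel ((+) c). f x)"
    by (simp add: lborel_distr_plus)
  also have "\<dots> = (LINT x|lborel. f (c + x))"
    by (rule integral_distr) auto
  also have "\<dots> = (LINT x|lebesgue. f (c + x))"
    by (rule integral_completion[symmetric]) simp
  finally show ?thesis by (simp add: add.commute)
qed

lemma set_integral_eq_UNIV:
  assumes "\<And>x. x \<notin> K \<Longrightarrow> f x = 0"
  shows "(LINT x:K|M. f x) = (LINT x|M. f x)"
  unfolding set_lebesgue_integral_def
  by (rule arg_cong[where f = "integral\<^sup>L M"]) (use assms in \<open>auto simp: indicator_def fun_eq_iff\<close>)

lemma frechet_derivative_zero_open:
  assumes "open V" "x \<in> V" "\<And>y. y \<in> V \<Longrightarrow> f y = 0"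
  shows "pd f v x = 0"
  using frechet_derivative_cong_open[OF assms(1,2), of f "\<lambda>_. 0"] assms(3) by simp

text \<open>By translation invariance the integral of \<open>H (x + t e)\<close> does not depend on \<open>t\<close>, and the integral in
question is its derivative at \<open>t = 0\<close>.\<close>

lemma integral_derivative_compact_support:
  fixes H :: "'a::euclidean_space \<Rightarrow> real"
  assumes H: "smooth_on UNIV H" and K: "compact K" and HK: "\<And>x. x \<notin> K \<Longrightarrow> H x = 0"
  shows "(LINT x:K|lebesgue. pd H e x) = 0"
proof -
  \<comment> \<open>contains the supports of all translates with \<open>|t| < 1\<close>\<close>
  define K' where "K' = {x + y |x y. x \<in> K \<and> y \<in> cball 0 (norm e)}"
  have K': "compact K'" unfolding K'_def by (rule compact_sums[OF K compact_cball])
  have D0: "H (x + t *\<^sub>R e) = 0" if "\<bar>t\<bar> < 1" "x \<notin> K'" for t x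
  proof (rule HK, rule notI)
    assume "x + t *\<^sub>R e \<in> K"
    moreover have "x = (x + t *\<^sub>R e) + (- t *\<^sub>R e)" by simp
    moreover have "- t *\<^sub>R e \<in> cball 0 (norm e)" using that by (simp add: mult_left_le_one_le)
    ultimately show False using that unfolding K'_def by blast
  qed
  have L: "bounded_linear (\<lambda>p::real \<times> 'a. snd p + fst p *\<^sub>R e)"
    by (intro bounded_linear_add bounded_linear_snd bounded_linear_scaleR_left[THEN bounded_linear_compose] bounded_linear_fst)
  have sm: "smooth_on ({-1<..<1} \<times> UNIV) (\<lambda>p::real \<times> 'a. H ((snd p + fst p *\<^sub>R e) + 0))"
    by (rule smooth_on_affine[OF _ _ L H]) (auto intro: open_Times)
  have deriv: "pd (\<lambda>p::real \<times> 'a. H (snd p + fst p *\<^sub>R e)) (1, 0) (0, x)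
      = pd H e x" for x
    using iter_deriv_affine[OF _ _ L H, of UNIV 0 "(0, x)" "[(1, 0)]"] by simp
  have "((\<lambda>t. LINT x:K'|lebesgue. H (x + t *\<^sub>R e)) has_real_derivative
      (LINT x:K'|lebesgue. pd H e x)) (at 0)"
    using leibniz_smooth[OF open_UNIV K' _ _ sm] by (simp add: deriv)
  moreover have "(LINT x:K'|lebesgue. H (x + t *\<^sub>R e)) = (LINT x|lebesgue. H x)" if "t \<in> {-1<..<1}" for t
  proof -
    have "(LINT x:K'|lebesgue. H (x + t *\<^sub>R e)) = (LINT x|lebesgue. H (x + t *\<^sub>R e))"
      by (rule set_integral_eq_UNIV) (use D0 that in auto)
    also have "\<dots> = (LINT x|lebesgue. H x)"
      by (intro lebesgue_integral_translation borel_measurable_continuous_onI smooth_on_continuous_on H)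
    finally show ?thesis .
  qed
  then have "((\<lambda>t. LINT x:K'|lebesgue. H (x + t *\<^sub>R e)) has_real_derivative 0) (at 0)"
    by (intro has_field_derivative_transform_within_open[OF DERIV_const, of "{-1<..<1}" 0]) auto
  ultimately have "(LINT x:K'|lebesgue. pd H e x) = 0"
    by (rule DERIV_unique)
  moreover have "pd H e x = 0" if "x \<notin> K" for x
    by (rule frechet_derivative_zero_open[of "- K"]) (use that HK K compact_imp_closed in auto)
  moreover have "K \<subseteq> K'"
  proof
    fix x assume "x \<in> K"
    then have "x = x + 0 \<and> x \<in> K \<and> 0 \<in> cball 0 (norm e)" by simp
    then show "x \<in> K'" unfolding K'_def by blast
  qed
  ultimately show ?thesis
    by (subst (asm) set_integral_eq_UNIV, blast, subst set_integral_eq_UNIV) auto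
qed

lemma smooth_on_Un: "smooth_on U f \<Longrightarrow> smooth_on V f \<Longrightarrow> smooth_on (U \<union> V) f"
  by (auto simp: smooth_on_def)

lemma smooth_on_zero_extension:
  assumes "open U" "closed K" "K \<subseteq> U" "smooth_on U h" "\<And>x. x \<in> U - K \<Longrightarrow> h x = 0"
  shows "smooth_on UNIV (\<lambda>x. if x \<in> K then h x else 0)"
proof -
  have "smooth_on U (\<lambda>x. if x \<in> K then h x else 0)"
    using assms by (subst smooth_on_cong[of U _ h]) auto
  moreover have "smooth_on (- K) (\<lambda>x. if x \<in> K then h x else 0)"
    using assms by (subst smooth_on_cong[of "- K" _ "\<lambda>_. 0"]) (auto simp: smooth_on_const)
  moreover have "U \<union> - K = UNIV" using assms by auto
  ultimately show ?thesis using smooth_on_Un by metis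
qed

lemma integral_derivative_supported:
  fixes h :: "'a::euclidean_space \<Rightarrow> real"
  assumes U: "open U" and K: "compact K" "K \<subseteq> U" and h: "smooth_on U h" "\<And>x. x \<in> U - K \<Longrightarrow> h x = 0"
  shows "(LINT x:K|lebesgue. pd h e x) = 0"
proof -
  let ?H = "\<lambda>x. if x \<in> K then h x else 0"
  have "(LINT x:K|lebesgue. pd ?H e x) = 0"
    by (rule integral_derivative_compact_support[OF _ K(1)])
      (auto intro!: smooth_on_zero_extension[OF U _ K(2) h] compact_imp_closed K)
  moreover have "frechet_derivative ?H (at x) = frechet_derivative h (at x)" if "x \<in> K" for x
    by (rule frechet_derivative_cong_open[OF U]) (use that K h in auto)
  then have "(LINT x:K|lebesgue. pd ?H e x) = (LINT x:K|lebesgue. pd h e x)"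
    unfolding set_lebesgue_integral_def by (intro Bochner_Integration.integral_cong) (auto simp: indicator_def)
  ultimately show ?thesis by simp
qed

lemma frechet_derivative_inner:
  assumes "f differentiable (at x)" "g differentiable (at x)"
  shows "pd (\<lambda>y. f y \<bullet> g y) v x
     = f x \<bullet> pd g v x + pd f v x \<bullet> g x"
  by (rule frechet_derivative_eqI) (intro has_derivative_inner assms[unfolded frechet_derivative_works])

lemma integration_by_parts:
  fixes Z Y :: "'a::euclidean_space \<Rightarrow> 'b::euclidean_space"
  assumes U: "open U" and K: "compact K" "K \<subseteq> U" and Z: "smooth_on U Z" and Y: "smooth_on U Y"
    and Y0: "\<And>x. x \<in> U - K \<Longrightarrow> Y x = 0"
  shows "(LINT x:K|lebesgue. Z x \<bullet> pd Y e x)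
       = - (LINT x:K|lebesgue. pd Z e x \<bullet> Y x)"
proof -
  have ZY: "smooth_on U (\<lambda>x. Z x \<bullet> Y x)" by (intro smooth_on_inner U Z Y)
  have int: "set_integrable lebesgue K g" if "smooth_on U g" for g :: "'a \<Rightarrow> real"
    by (rule set_integrable_continuous_compact[OF K(1)])
      (rule continuous_on_subset[OF smooth_on_continuous_on[OF that] K(2)])
  have "0 = (LINT x:K|lebesgue. pd (\<lambda>x. Z x \<bullet> Y x) e x)"
    by (rule integral_derivative_supported[OF U K ZY, symmetric]) (simp add: Y0)
  also have "\<dots> = (LINT x:K|lebesgue. Z x \<bullet> pd Y e x + pd Z e x \<bullet> Y x)"
    unfolding set_lebesgue_integral_def
    by (intro Bochner_Integration.integral_cong)
      (use K in \<open>auto simp: indicator_def frechet_derivative_inner smooth_on_differentiable[OF Z] smooth_on_differentiable[OF Y] subset_iff\<close>)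
  also have "\<dots> = (LINT x:K|lebesgue. Z x \<bullet> pd Y e x)
      + (LINT x:K|lebesgue. pd Z e x \<bullet> Y x)"
    by (intro set_integral_add int smooth_on_inner U Z Y smooth_on_frechet_derivative)
  finally show ?thesis by simp
qed

section \<open>Sections along a variation of a sphere-valued map\<close>

definition first_variation ::
  "(('a::euclidean_space \<Rightarrow> 'b::euclidean_space) \<Rightarrow> 'a \<Rightarrow> real) \<Rightarrow> 'a set \<Rightarrow> (real \<Rightarrow> 'a \<Rightarrow> 'b) \<Rightarrow> real \<Rightarrow> bool" where
  "first_variation e K F l \<longleftrightarrow>
     ((\<lambda>t. 1 / 2 * (LINT x:K|lebesgue. e (F t) x)) has_real_derivative l) (at 0)"

text \<open>Sections along the variation are functions on the space-time cylinder, where time and space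
derivatives are directional derivatives of the same kind and therefore commute. The operators of the
pull-back connection are transferred to the cylinder for that purpose.\<close>

locale sphere_variation =
  fixes U :: "'a::euclidean_space set" and \<phi> :: "'a \<Rightarrow> 'b::euclidean_space"
    and \<epsilon> :: real and K :: "'a set" and F :: "real \<Rightarrow> 'a \<Rightarrow> 'b"
  assumes open_U: "open U" and variation: "variation U \<phi> \<epsilon> K F"
begin

definition cyl :: "(real \<times> 'a) set" where "cyl = {- \<epsilon><..<\<epsilon>} \<times> U"

definition joint :: "real \<times> 'a \<Rightarrow> 'b" where "joint = (\<lambda>(t, x). F t x)"

definition dx :: "'a \<Rightarrow> (real \<times> 'a \<Rightarrow> 'b) \<Rightarrow> real \<times> 'a \<Rightarrow> 'b" where
  "dx e X p = pd X (0, e) p"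

definition nabla :: "'a \<Rightarrow> (real \<times> 'a \<Rightarrow> 'b) \<Rightarrow> real \<times> 'a \<Rightarrow> 'b" where
  "nabla e X p = sphere_proj (joint p) (dx e X p)"

definition joint_tension :: "real \<times> 'a \<Rightarrow> 'b" where
  "joint_tension p = (\<Sum>e\<in>Basis. nabla e (dx e joint) p)"

definition joint_laplacian :: "(real \<times> 'a \<Rightarrow> 'b) \<Rightarrow> real \<times> 'a \<Rightarrow> 'b" where
  "joint_laplacian X p = - (\<Sum>e\<in>Basis. nabla e (nabla e X) p)"

definition dt0 :: "(real \<times> 'a \<Rightarrow> 'c::real_normed_vector) \<Rightarrow> 'a \<Rightarrow> 'c" where
  "dt0 X x = pd X (1, 0) (0, x)"

text \<open>Sections that do not change with time outside the compact set \<open>K\<close>: their time derivatives have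
compact support in \<open>U\<close>, so that integrating by parts produces no boundary terms.\<close>

definition varied :: "(real \<times> 'a \<Rightarrow> 'c::real_normed_vector) \<Rightarrow> bool" where
  "varied X \<longleftrightarrow> smooth_on cyl X \<and> (\<forall>t\<in>{- \<epsilon><..<\<epsilon>}. \<forall>x\<in>U - K. X (t, x) = X (0, x))"

lemma joint_eq: "joint (t, x) = F t x" by (simp add: joint_def)

lemma eps: "\<epsilon> > 0" and compact_K: "compact K" and K_subset: "K \<subseteq> U"
  and smooth_joint: "smooth_on cyl joint"
  and norm_F: "t \<in> {- \<epsilon><..<\<epsilon>} \<Longrightarrow> x \<in> U \<Longrightarrow> F t x \<bullet> F t x = 1"
  and F_0: "x \<in> U \<Longrightarrow> F 0 x = \<phi> x"
  and F_off_K: "t \<in> {- \<epsilon><..<\<epsilon>} \<Longrightarrow> x \<in> U - K \<Longrightarrow> F t x = \<phi> x"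
  using variation by (auto simp: variation_def cyl_def joint_def dot_square_norm)

lemma open_cyl: "open cyl" unfolding cyl_def by (intro open_Times open_U) auto

lemma cyl_0: "x \<in> U \<Longrightarrow> (0, x) \<in> cyl" using eps by (simp add: cyl_def)

lemma joint_0: "x \<in> U \<Longrightarrow> joint (0, x) = \<phi> x" by (simp add: joint_def F_0)

lemma norm_joint: "p \<in> cyl \<Longrightarrow> joint p \<bullet> joint p = 1"
  using norm_F by (auto simp: cyl_def joint_def)

lemma nabla_alt: "nabla e X = (\<lambda>p. dx e X p - (dx e X p \<bullet> joint p) *\<^sub>R joint p)"
  by (simp add: nabla_def sphere_proj_def fun_eq_iff)

lemma smooth_dx: "smooth_on cyl X \<Longrightarrow> smooth_on cyl (dx e X)"
  using smooth_on_frechet_derivative[of cyl X "(0, e)"] by (simp add: dx_def[abs_def])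

lemma smooth_nabla: "smooth_on cyl X \<Longrightarrow> smooth_on cyl (nabla e X)"
  unfolding nabla_alt
  by (intro smooth_on_diff smooth_on_scaleR smooth_on_inner open_cyl smooth_dx smooth_joint)

lemma nabla_tangent: "p \<in> cyl \<Longrightarrow> nabla e X p \<bullet> joint p = 0"
  by (simp add: nabla_alt inner_diff_left norm_joint)

lemma smooth_slice:
  assumes "smooth_on cyl X" "t \<in> {- \<epsilon><..<\<epsilon>}"
  shows "smooth_on U (\<lambda>y. X (t, y))"
proof -
  have "smooth_on U (\<lambda>y. X ((0, y) + (t, 0)))"
    by (rule smooth_on_affine[OF open_cyl open_U _ assms(1)])
      (use assms(2) in \<open>auto simp: cyl_def intro!: bounded_linear_Pair bounded_linear_zero bounded_linear_ident\<close>)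
  then show ?thesis by simp
qed

lemma derivative_slice:
  assumes "smooth_on cyl X" "t \<in> {- \<epsilon><..<\<epsilon>}" "x \<in> U"
  shows "pd (\<lambda>y. X (t, y)) e x = pd X (0, e) (t, x)"
proof -
  have "iter_deriv [e] (\<lambda>y. X ((0, y) + (t, 0))) x = iter_deriv (map (\<lambda>y. (0, y)) [e]) X ((0, x) + (t, 0))"
    by (rule iter_deriv_affine[OF open_cyl open_U _ assms(1) _ assms(3)])
      (use assms(2) in \<open>auto simp: cyl_def intro!: bounded_linear_Pair bounded_linear_zero bounded_linear_ident\<close>)
  then show ?thesis by simp
qed

lemma derivative_slice_eq:
  assumes "smooth_on cyl X" "t \<in> {- \<epsilon><..<\<epsilon>}" "x \<in> U" "\<And>y. y \<in> U \<Longrightarrow> V y = X (t, y)"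
  shows "pd V e x = dx e X (t, x)"
  using derivative_slice[OF assms(1-3)] frechet_derivative_cong_open[OF open_U assms(3), of V, OF assms(4)]
  by (simp add: dx_def)

lemma pull_conn_slice:
  assumes "smooth_on cyl X" "t \<in> {- \<epsilon><..<\<epsilon>}" "x \<in> U" "\<And>y. y \<in> U \<Longrightarrow> V y = X (t, y)"
  shows "pull_conn (F t) e V x = nabla e X (t, x)"
  using derivative_slice_eq[OF assms] by (simp add: pull_conn_def nabla_def joint_def)

lemma pull_conn_base:
  assumes "smooth_on cyl X" "x \<in> U" "\<And>y. y \<in> U \<Longrightarrow> X (0, y) = V y"
  shows "nabla e X (0, x) = pull_conn \<phi> e V x" "dx e X (0, x) = pd V e x"
  using derivative_slice_eq[OF assms(1) _ assms(2), of 0 V] assms eps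
  by (auto simp: pull_conn_def nabla_def joint_0)

lemma tension_slice:
  assumes "t \<in> {- \<epsilon><..<\<epsilon>}" "x \<in> U"
  shows "tension (F t) x = joint_tension (t, x)"
  unfolding tension_def joint_tension_def
  by (intro sum.cong refl pull_conn_slice[OF smooth_dx[OF smooth_joint] assms])
    (auto intro!: derivative_slice_eq[OF smooth_joint] assms simp: joint_eq)

lemma rough_laplacian_slice:
  assumes "smooth_on cyl X" "t \<in> {- \<epsilon><..<\<epsilon>}" "x \<in> U" "\<And>y. y \<in> U \<Longrightarrow> V y = X (t, y)"
  shows "rough_laplacian (F t) V x = joint_laplacian X (t, x)"
  unfolding rough_laplacian_def joint_laplacian_def
  by (intro arg_cong[where f = uminus] sum.cong refl
      pull_conn_slice[OF smooth_nabla[OF assms(1)] assms(2,3)] pull_conn_slice[OF assms(1,2)] assms(4))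

lemma joint_tension_base:
  assumes "x \<in> U"
  shows "joint_tension (0, x) = tension \<phi> x"
  unfolding tension_def joint_tension_def
  by (intro sum.cong refl pull_conn_base(1)[OF smooth_dx[OF smooth_joint] assms]
       pull_conn_base(2)[OF smooth_joint]) (auto simp: joint_0)

lemma joint_laplacian_base:
  assumes "smooth_on cyl X" "x \<in> U" "\<And>y. y \<in> U \<Longrightarrow> X (0, y) = V y"
  shows "joint_laplacian X (0, x) = rough_laplacian \<phi> V x"
  unfolding rough_laplacian_def joint_laplacian_def
  by (intro arg_cong[where f = uminus] sum.cong refl
      pull_conn_base(1)[OF smooth_nabla[OF assms(1)] assms(2)] pull_conn_base(1)[OF assms(1)] assms(3))

lemma smooth_joint_tension: "smooth_on cyl joint_tension"
  unfolding joint_tension_def[abs_def]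
  by (intro smooth_on_sum open_cyl smooth_nabla smooth_dx smooth_joint)

lemma smooth_joint_laplacian: "smooth_on cyl X \<Longrightarrow> smooth_on cyl (joint_laplacian X)"
  unfolding joint_laplacian_def[abs_def]
  by (intro smooth_on_sum smooth_on_minus open_cyl smooth_nabla)

lemma joint_tension_tangent: "p \<in> cyl \<Longrightarrow> joint_tension p \<bullet> joint p = 0"
  by (simp add: joint_tension_def inner_sum_left nabla_tangent)

lemma joint_laplacian_tangent: "p \<in> cyl \<Longrightarrow> joint_laplacian X p \<bullet> joint p = 0"
  by (simp add: joint_laplacian_def inner_sum_left nabla_tangent)

lemma variedI:
  assumes "smooth_on cyl X" "\<And>t x. t \<in> {- \<epsilon><..<\<epsilon>} \<Longrightarrow> x \<in> U - K \<Longrightarrow> X (t, x) = X (0, x)"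
  shows "varied X"
  using assms unfolding varied_def by blast

lemma varied_off_K: "varied X \<Longrightarrow> t \<in> {- \<epsilon><..<\<epsilon>} \<Longrightarrow> x \<in> U - K \<Longrightarrow> X (t, x) = X (0, x)"
  unfolding varied_def by blast

lemma varied_joint: "varied joint"
  by (rule variedI[OF smooth_joint]) (use F_off_K F_0 in \<open>simp add: joint_eq\<close>)

lemma varied_smooth: "varied X \<Longrightarrow> smooth_on cyl X" by (simp add: varied_def)

lemma open_off_K: "open (U - K)" by (intro open_Diff open_U compact_imp_closed compact_K)

lemma varied_dx:
  assumes "varied X"
  shows "varied (dx e X)"
proof -
  have "dx e X (t, x) = dx e X (0, x)" if t: "t \<in> {- \<epsilon><..<\<epsilon>}" and x: "x \<in> U - K" for t x
  proof -
    have "frechet_derivative (\<lambda>y. X (t, y)) (at x) = frechet_derivative (\<lambda>y. X (0, y)) (at x)"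
      by (rule frechet_derivative_cong_open[OF open_off_K x varied_off_K[OF assms t]])
    then show ?thesis
      using derivative_slice[of X t x e] derivative_slice[of X 0 x e] t x eps varied_smooth[OF assms]
      by (simp add: dx_def)
  qed
  then show ?thesis by (rule variedI[OF smooth_dx[OF varied_smooth[OF assms]]])
qed

lemma varied_nabla:
  assumes "varied X"
  shows "varied (nabla e X)"
proof (rule variedI)
  show "smooth_on cyl (nabla e X)" by (rule smooth_nabla[OF varied_smooth[OF assms]])
  show "nabla e X (t, x) = nabla e X (0, x)" if "t \<in> {- \<epsilon><..<\<epsilon>}" "x \<in> U - K" for t x
    using varied_off_K[OF varied_dx[OF assms, of e] that] varied_off_K[OF varied_joint that]
    by (simp add: nabla_def)
qed

lemma varied_diff: "varied X \<Longrightarrow> varied Y \<Longrightarrow> varied (\<lambda>p. X p - Y p)"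
  by (rule variedI, intro smooth_on_diff open_cyl varied_smooth) (auto intro!: arg_cong2[where f = minus] intro: varied_off_K)

lemma varied_sum: "(\<And>i. i \<in> S \<Longrightarrow> varied (X i)) \<Longrightarrow> varied (\<lambda>p. \<Sum>i\<in>S. X i p)"
  by (rule variedI, intro smooth_on_sum open_cyl varied_smooth) (auto intro!: sum.cong intro: varied_off_K)

lemma varied_minus: "varied X \<Longrightarrow> varied (\<lambda>p. - X p)"
  by (rule variedI, intro smooth_on_minus open_cyl varied_smooth) (auto intro!: arg_cong[where f = uminus] intro: varied_off_K)

lemma varied_joint_tension: "varied joint_tension"
  unfolding joint_tension_def[abs_def] by (intro varied_sum varied_nabla varied_dx varied_joint)

lemma varied_joint_laplacian: "varied X \<Longrightarrow> varied (joint_laplacian X)"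
  unfolding joint_laplacian_def[abs_def] by (intro varied_sum varied_minus varied_nabla)

lemma smooth_dt0:
  assumes "smooth_on cyl X"
  shows "smooth_on U (dt0 X)"
  using smooth_slice[OF smooth_on_frechet_derivative[OF assms], of 0 "(1, 0)"] eps
  by (simp add: dt0_def[abs_def])

lemma dt0_off_K:
  assumes X: "varied X" and x: "x \<in> U - K"
  shows "dt0 X x = 0"
proof -
  have c: "(0, x) + 0 *\<^sub>R (1, 0) \<in> cyl" using x cyl_0 by simp
  have "((\<lambda>s. X ((0, x) + s *\<^sub>R (1, 0))) has_vector_derivative dt0 X x) (at 0)"
    using line_has_vector_derivative[OF varied_smooth[OF X] c] by (simp add: dt0_def)
  moreover have "((\<lambda>s. X ((0, x) + s *\<^sub>R (1, 0))) has_vector_derivative 0) (at 0)"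
    by (rule has_vector_derivative_transform_within_open[OF has_vector_derivative_const[of "X (0, x)"], of "{- \<epsilon><..<\<epsilon>}"])
      (auto simp: eps intro!: varied_off_K[OF X _ x, symmetric])
  ultimately show ?thesis by (rule vector_derivative_unique_at)
qed

lemma dt0_dx:
  assumes X: "smooth_on cyl X" and x: "x \<in> U"
  shows "dt0 (dx e X) x = pd (dt0 X) e x"
proof -
  have "dt0 (dx e X) x = pd (pd X (1, 0)) (0, e) (0, x)"
    unfolding dt0_def dx_def[abs_def] by (rule mixed_partials[OF open_cyl X cyl_0[OF x]])
  also have "\<dots> = pd (\<lambda>y. pd X (1, 0) (0, y)) e x"
    using derivative_slice[OF smooth_on_frechet_derivative[OF X] _ x, of 0 "(1, 0)"] eps by simp
  finally show ?thesis by (simp add: dt0_def[abs_def])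
qed

text \<open>The last term comes from the time derivative of the projection onto the tangent space; it is where
the curvature of the sphere enters. Testing against a tangent vector removes all multiples of \<open>\<phi> x\<close>.\<close>

lemma inner_dt0_nabla:
  assumes X: "smooth_on cyl X" and x: "x \<in> U" and g: "g \<bullet> \<phi> x = 0"
  shows "g \<bullet> dt0 (nabla e X) x
    = g \<bullet> pd (dt0 X) e x - (dx e X (0, x) \<bullet> \<phi> x) * (g \<bullet> dt0 joint x)"
proof -
  have d: "Z differentiable (at (0, x))" if "smooth_on cyl Z" for Z :: "real \<times> 'a \<Rightarrow> 'c::real_normed_vector"
    by (rule smooth_on_differentiable[OF that cyl_0[OF x]])
  have s: "smooth_on cyl (\<lambda>p. dx e X p \<bullet> joint p)"
    by (intro smooth_on_inner open_cyl smooth_dx X smooth_joint)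
  have "dt0 (nabla e X) x = dt0 (dx e X) x - ((dx e X (0, x) \<bullet> joint (0, x)) *\<^sub>R dt0 joint x
      + dt0 (\<lambda>p. dx e X p \<bullet> joint p) x *\<^sub>R joint (0, x))"
    unfolding nabla_alt dt0_def
    by ((subst frechet_derivative_diff frechet_derivative_scaleR;
       (intro d smooth_dx X smooth_on_scaleR open_cyl smooth_joint s)?)+, rule refl)
  then show ?thesis
    using g by (simp add: dt0_dx[OF X x] joint_0[OF x] inner_diff_right inner_add_right)
qed

text \<open>Integration by parts changes integrands without changing their integrals over \<open>K\<close>. Smoothness is
part of the relation because it makes it compatible with sums.\<close>

definition int_eq :: "('a \<Rightarrow> real) \<Rightarrow> ('a \<Rightarrow> real) \<Rightarrow> bool" where
  "int_eq f g \<longleftrightarrow> smooth_on U f \<and> smooth_on U g \<and> (LINT x:K|lebesgue. f x) = (LINT x:K|lebesgue. g x)"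

lemma set_integrable_smooth: "smooth_on U g \<Longrightarrow> set_integrable lebesgue K (g :: 'a \<Rightarrow> real)"
  by (rule set_integrable_continuous_compact[OF compact_K])
    (rule continuous_on_subset[OF smooth_on_continuous_on K_subset])

lemma set_integral_cong_U:
  "(\<And>x. x \<in> U \<Longrightarrow> f x = (g x :: real)) \<Longrightarrow> (LINT x:K|lebesgue. f x) = (LINT x:K|lebesgue. g x)"
  unfolding set_lebesgue_integral_def using K_subset
  by (intro Bochner_Integration.integral_cong) (auto simp: indicator_def)

lemma int_eq_cong:
  assumes "smooth_on U f" "\<And>x. x \<in> U \<Longrightarrow> f x = g x"
  shows "int_eq f g"
proof -
  have "smooth_on U g" using assms(1) smooth_on_cong[OF open_U assms(2)] by simp
  then show ?thesis using assms(1) set_integral_cong_U[OF assms(2)] by (simp add: int_eq_def)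
qed

lemma int_eq_trans [trans]: "int_eq f g \<Longrightarrow> int_eq g h \<Longrightarrow> int_eq f h"
  by (simp add: int_eq_def)

lemma int_eq_add: "int_eq f g \<Longrightarrow> int_eq f' g' \<Longrightarrow> int_eq (\<lambda>x. f x + f' x) (\<lambda>x. g x + g' x)"
  by (simp add: int_eq_def smooth_on_add open_U set_integral_add set_integrable_smooth)

lemma int_eq_cmult: "int_eq f g \<Longrightarrow> int_eq (\<lambda>x. k * f x) (\<lambda>x. k * g x)"
  by (simp add: int_eq_def smooth_on_mult smooth_on_const open_U)

lemma int_eq_refl: "smooth_on U f \<Longrightarrow> int_eq f f" by (simp add: int_eq_def)

lemma int_eq_sum:
  "(\<And>i. i \<in> S \<Longrightarrow> int_eq (f i) (g i)) \<Longrightarrow> int_eq (\<lambda>x. \<Sum>i\<in>S. f i x) (\<lambda>x. \<Sum>i\<in>S. g i x)"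
  by (induction S rule: infinite_finite_induct) (auto intro: int_eq_add int_eq_refl smooth_on_const)

lemma smooth_phi: "smooth_on U \<phi>"
  using smooth_slice[OF smooth_joint, of 0] eps
  by (subst smooth_on_cong[OF open_U, of _ "\<lambda>y. joint (0, y)"]) (auto simp: joint_0)

lemma int_eq_parts:
  fixes X :: "real \<times> 'a \<Rightarrow> 'b"
  assumes Y: "smooth_on U Y" and X: "varied X"
  shows "int_eq (\<lambda>x. Y x \<bullet> pd (dt0 X) e x) (\<lambda>x. - (pd Y e x \<bullet> dt0 X x))"
  unfolding int_eq_def
proof (intro conjI)
  note X' = varied_smooth[OF X]
  show "(LINT x:K|lebesgue. Y x \<bullet> pd (dt0 X) e x)
      = (LINT x:K|lebesgue. - (pd Y e x \<bullet> dt0 X x))"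
    using integration_by_parts[OF open_U compact_K K_subset Y(1) smooth_dt0[OF X'] dt0_off_K[OF X]]
    by (simp add: set_lebesgue_integral_def)
  show "smooth_on U (\<lambda>x. Y x \<bullet> pd (dt0 X) e x)"
    "smooth_on U (\<lambda>x. - (pd Y e x \<bullet> dt0 X x))"
    by (intro smooth_on_inner smooth_on_minus smooth_on_frechet_derivative open_U Y smooth_dt0 X')+
qed

text \<open>The basic step of every first variation below: the space derivative is moved from the varied field \<open>X\<close>
to the field \<open>Y\<close>, which does not depend on time.\<close>

lemma int_eq_nabla:
  assumes Y: "smooth_on U Y" "\<And>x. x \<in> U \<Longrightarrow> Y x \<bullet> \<phi> x = 0" and X: "varied X"
  shows "int_eq (\<lambda>x. Y x \<bullet> dt0 (nabla e X) x)
    (\<lambda>x. - (pd Y e x \<bullet> dt0 X x) - (dx e X (0, x) \<bullet> \<phi> x) * (Y x \<bullet> dt0 joint x))"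
proof -
  note X' = varied_smooth[OF X]
  have s1: "smooth_on U (\<lambda>x. dx e X (0, x))"
    by (rule smooth_slice[OF smooth_dx[OF X']]) (use eps in auto)
  have s2: "smooth_on U (\<lambda>x. (dx e X (0, x) \<bullet> \<phi> x) * (Y x \<bullet> dt0 joint x))"
    by (intro smooth_on_mult smooth_on_inner open_U s1 smooth_phi Y smooth_dt0 smooth_joint)
  from int_eq_add[OF int_eq_parts[OF Y(1) X] int_eq_cmult[OF int_eq_refl[OF s2], of "-1"]]
  have *: "int_eq (\<lambda>x. Y x \<bullet> pd (dt0 X) e x + - 1 * ((dx e X (0, x) \<bullet> \<phi> x) * (Y x \<bullet> dt0 joint x)))
     (\<lambda>x. - (pd Y e x \<bullet> dt0 X x) + - 1 * ((dx e X (0, x) \<bullet> \<phi> x) * (Y x \<bullet> dt0 joint x)))" .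
  have "int_eq (\<lambda>x. Y x \<bullet> dt0 (nabla e X) x)
     (\<lambda>x. Y x \<bullet> pd (dt0 X) e x + - 1 * ((dx e X (0, x) \<bullet> \<phi> x) * (Y x \<bullet> dt0 joint x)))"
    by (intro int_eq_cong smooth_on_inner open_U Y smooth_dt0 smooth_nabla X')
      (simp add: inner_dt0_nabla[OF X' _ Y(2)])
  from int_eq_trans[OF this *] show ?thesis by simp
qed

text \<open>\<open>X\<close> remains tangent to the sphere during the variation, so the product rule applies to \<open>X \<bullet> joint = 0\<close>.\<close>

lemma inner_dt0_tangent:
  assumes X: "smooth_on cyl X" and tan: "\<And>p. p \<in> cyl \<Longrightarrow> X p \<bullet> joint p = 0" and x: "x \<in> U"
  shows "\<phi> x \<bullet> dt0 X x = - (X (0, x) \<bullet> dt0 joint x)"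
proof -
  have "pd (\<lambda>p. X p \<bullet> joint p) (1, 0) (0, x) = 0"
    by (rule frechet_derivative_zero_open[OF open_cyl cyl_0[OF x] tan])
  then show ?thesis
    by (subst (asm) frechet_derivative_inner)
      (auto intro: smooth_on_differentiable[OF _ cyl_0[OF x]] X smooth_joint simp: dt0_def joint_0[OF x] inner_commute)
qed

lemma inner_phi_dt0_joint:
  assumes x: "x \<in> U"
  shows "\<phi> x \<bullet> dt0 joint x = 0"
proof -
  have "pd (\<lambda>p. joint p \<bullet> joint p) (1, 0) (0, x) = pd (\<lambda>p. 1) (1, 0) (0, x)"
    using frechet_derivative_cong_open[OF open_cyl cyl_0[OF x], of "\<lambda>p. joint p \<bullet> joint p" "\<lambda>p. 1", OF norm_joint] by simp
  moreover have "joint differentiable (at (0, x))"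
    by (rule smooth_on_differentiable[OF smooth_joint cyl_0[OF x]])
  ultimately have "2 * (joint (0, x) \<bullet> dt0 joint x) = 0"
    by (simp add: frechet_derivative_inner dt0_def inner_commute)
  then show ?thesis by (simp add: joint_0[OF x])
qed

lemma energy_derivative:
  assumes D: "smooth_on cyl D" and eq: "\<And>t x. t \<in> {- \<epsilon><..<\<epsilon>} \<Longrightarrow> x \<in> U \<Longrightarrow> e (F t) x = D (t, x)"
    and half: "int_eq (\<lambda>x. 1 / 2 * dt0 D x) g"
  shows "first_variation e K F (LINT x:K|lebesgue. g x)"
proof -
  have "((\<lambda>t. LINT x:K|lebesgue. D (t, x)) has_real_derivative (LINT x:K|lebesgue. dt0 D x)) (at 0)"
    unfolding dt0_def by (rule leibniz_smooth[OF open_U compact_K K_subset eps D[unfolded cyl_def]])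
  from DERIV_cmult[OF this, of "1/2"] half
  have "((\<lambda>t. 1 / 2 * (LINT x:K|lebesgue. D (t, x))) has_real_derivative (LINT x:K|lebesgue. g x)) (at 0)"
    by (simp add: int_eq_def)
  then show ?thesis
    unfolding first_variation_def
    by (rule has_field_derivative_transform_within_open[of _ _ _ "{- \<epsilon><..<\<epsilon>}"])
      (use eps eq in \<open>auto intro!: set_integral_cong_U\<close>)
qed

lemma dt0_norm_sq:
  assumes "smooth_on cyl X" "x \<in> U"
  shows "dt0 (\<lambda>p. (norm (X p))\<^sup>2) x = 2 * (X (0, x) \<bullet> dt0 X x)"
proof -
  have "X differentiable (at (0, x))" by (rule smooth_on_differentiable[OF assms(1) cyl_0[OF assms(2)]])
  then show ?thesis
    by (simp add: dt0_def power2_norm_eq_inner frechet_derivative_inner inner_commute)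
qed

lemma smooth_norm_sq:
  fixes X :: "real \<times> 'a \<Rightarrow> 'c::real_inner"
  shows "smooth_on cyl X \<Longrightarrow> smooth_on cyl (\<lambda>p. (norm (X p))\<^sup>2)"
  unfolding power2_norm_eq_inner by (intro smooth_on_inner open_cyl)

lemma dt0_sum:
  "(\<And>i. i \<in> S \<Longrightarrow> smooth_on cyl (X i)) \<Longrightarrow> x \<in> U \<Longrightarrow> dt0 (\<lambda>p. \<Sum>i\<in>S. X i p) x = (\<Sum>i\<in>S. dt0 (X i) x)"
  unfolding dt0_def by (intro frechet_derivative_sum smooth_on_differentiable[OF _ cyl_0])

end

section \<open>Radial fields\<close>

definition nu :: "'a::euclidean_space \<Rightarrow> real" where "nu x = inverse (norm x)"

text \<open>With \<open>u = x / |x|\<close> this is \<open>|x|\<^sup>-\<^sup>m (\<alpha> u, \<beta>)\<close>. Only negative powers of the norm occur, so powers of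
its inverse are used.\<close>

definition radial :: "real \<Rightarrow> real \<Rightarrow> nat \<Rightarrow> 'a::euclidean_space \<Rightarrow> 'a \<times> real" where
  "radial \<alpha> \<beta> m x = ((\<alpha> * nu x ^ Suc m) *\<^sub>R x, \<beta> * nu x ^ m)"

lemma nu_pos: "x \<noteq> 0 \<Longrightarrow> nu x > 0" by (simp add: nu_def)

lemma nu_sq: "x \<noteq> 0 \<Longrightarrow> nu x ^ 2 * (x \<bullet> x) = 1"
  by (simp add: nu_def power2_norm_eq_inner[symmetric] power_inverse)

lemma nu_power_sq: "x \<noteq> 0 \<Longrightarrow> nu x ^ Suc (Suc k) * (x \<bullet> x) = nu x ^ k"
  using nu_sq[of x] by (simp add: power2_eq_square mult.assoc mult.left_commute)

lemma smooth_nu: "smooth_on (- {0}) nu"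
  unfolding nu_def[abs_def] by (rule smooth_on_inverse_norm)

lemma smooth_radial: "open U \<Longrightarrow> 0 \<notin> U \<Longrightarrow> smooth_on U (radial \<alpha> \<beta> m)"
  unfolding radial_def[abs_def]
  by (intro smooth_on_Pair smooth_on_scaleR smooth_on_mult smooth_on_power smooth_on_const smooth_on_id
      smooth_on_subset[OF smooth_nu]) auto

lemma nu_power_has_derivative:
  assumes "x \<noteq> 0"
  shows "((\<lambda>y. nu y ^ k) has_derivative (\<lambda>v. - (real k * nu x ^ Suc (Suc k) * (x \<bullet> v)))) (at x)"
proof -
  have 1: "(nu has_derivative (\<lambda>v. - (nu x ^ 3 * (x \<bullet> v)))) (at x)"
    unfolding nu_def[abs_def]
    by (rule has_derivative_eq_rhs[OF Deriv.has_derivative_inverse[OF _ has_derivative_norm[OF assms]]])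
      (use assms in \<open>auto simp: fun_eq_iff sgn_div_norm power3_eq_cube inner_commute\<close>)
  show ?thesis
    by (rule has_derivative_eq_rhs[OF has_derivative_power[OF 1]])
      (cases k; auto simp: fun_eq_iff power3_eq_cube algebra_simps)
qed

lemma radial_has_derivative:
  assumes "x \<noteq> 0"
  shows "(radial \<alpha> \<beta> m has_derivative (\<lambda>v.
     ((\<alpha> * nu x ^ Suc m) *\<^sub>R v - (\<alpha> * real (Suc m) * nu x ^ (m + 3) * (x \<bullet> v)) *\<^sub>R x,
      - (\<beta> * real m * nu x ^ (m + 2) * (x \<bullet> v))))) (at x)"
  unfolding radial_def[abs_def]
  by (rule has_derivative_eq_rhs, (rule has_derivative_Pair has_derivative_scaleR has_derivative_mult
       has_derivative_const nu_power_has_derivative assms has_derivative_ident)+)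
    (auto simp: fun_eq_iff algebra_simps eval_nat_numeral)

lemma radial_derivative:
  assumes "x \<noteq> 0"
  shows "pd (radial \<alpha> \<beta> m) v x =
     ((\<alpha> * nu x ^ Suc m) *\<^sub>R v - (\<alpha> * real (Suc m) * nu x ^ (m + 3) * (x \<bullet> v)) *\<^sub>R x,
      - (\<beta> * real m * nu x ^ (m + 2) * (x \<bullet> v)))"
  by (rule frechet_derivative_eqI[OF radial_has_derivative[OF assms]])

lemma radial_second_derivative:
  assumes x: "x \<noteq> 0"
  shows "pd (pd (radial \<alpha> \<beta> m) e) e x =
     (- (2 * \<alpha> * real (Suc m) * nu x ^ (m + 3) * (x \<bullet> e)) *\<^sub>R e
      + (\<alpha> * real (Suc m) * (real (m + 3) * nu x ^ (m + 5) * (x \<bullet> e)\<^sup>2 - nu x ^ (m + 3) * (e \<bullet> e))) *\<^sub>R x,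
      \<beta> * real m * (real (m + 2) * nu x ^ (m + 4) * (x \<bullet> e)\<^sup>2 - nu x ^ (m + 2) * (e \<bullet> e)))"
proof -
  have eq: "frechet_derivative (pd (radial \<alpha> \<beta> m) e) (at x)
    = frechet_derivative (\<lambda>y. ((\<alpha> * nu y ^ Suc m) *\<^sub>R e - (\<alpha> * real (Suc m) * nu y ^ (m + 3) * (y \<bullet> e)) *\<^sub>R y,
      - (\<beta> * real m * nu y ^ (m + 2) * (y \<bullet> e)))) (at x)"
    by (rule frechet_derivative_cong_open[of "- {0}"]) (use x radial_derivative in auto)
  have der: "((\<lambda>y. ((\<alpha> * nu y ^ Suc m) *\<^sub>R e - (\<alpha> * real (Suc m) * nu y ^ (m + 3) * (y \<bullet> e)) *\<^sub>R y,
      - (\<beta> * real m * nu y ^ (m + 2) * (y \<bullet> e)))) has_derivative (\<lambda>v.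
      (- (\<alpha> * real (Suc m) * nu x ^ (m + 3) * (x \<bullet> v)) *\<^sub>R e
        - ((\<alpha> * real (Suc m) * nu x ^ (m + 3) * (x \<bullet> e)) *\<^sub>R v
         + (\<alpha> * real (Suc m) * (nu x ^ (m + 3) * (v \<bullet> e) - real (m + 3) * nu x ^ (m + 5) * (x \<bullet> v) * (x \<bullet> e))) *\<^sub>R x),
       - (\<beta> * real m * (nu x ^ (m + 2) * (v \<bullet> e) - real (m + 2) * nu x ^ (m + 4) * (x \<bullet> v) * (x \<bullet> e)))))) (at x)"
    by (rule has_derivative_eq_rhs, (rule has_derivative_Pair has_derivative_scaleR has_derivative_mult
       has_derivative_diff has_derivative_minus has_derivative_inner_left
       has_derivative_const nu_power_has_derivative x has_derivative_ident)+)
     (auto simp: fun_eq_iff eval_nat_numeral algebra_simps)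
  show ?thesis
    unfolding eq frechet_derivative_eqI[OF der]
    by (simp add: algebra_simps power2_eq_square) (simp add: algebra_simps flip: scaleR_add_left)
qed

text \<open>On the unit sphere of directions, \<open>u\<close> is an eigenfunction of the Laplacian with eigenvalue \<open>n - 1\<close> and
constants have eigenvalue 0; the two components combine this with the radial part of the Laplacian.\<close>

lemma radial_laplacian:
  assumes x: "x \<noteq> (0::'a::euclidean_space)"
  shows "(\<Sum>e\<in>Basis. pd (pd (radial \<alpha> \<beta> m) e) e x) =
     radial (\<alpha> * ((real m + 1) * (real m + 1 - DIM('a)))) (\<beta> * (real m * (real m + 2 - DIM('a)))) (m + 2) x"
proof -
  have s1: "(\<Sum>e\<in>Basis. (x \<bullet> e) *\<^sub>R e) = x" by (rule euclidean_representation)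
  have s2: "(\<Sum>e\<in>Basis. (x \<bullet> e)\<^sup>2) = x \<bullet> x"
    by (simp add: euclidean_inner[of x x] power2_eq_square)
  have s3: "(\<Sum>e\<in>(Basis::'a set). e \<bullet> e) = DIM('a)" by simp
  have p: "nu x ^ (m + 5) * (x \<bullet> x) = nu x ^ (m + 3)" "nu x ^ (m + 4) * (x \<bullet> x) = nu x ^ (m + 2)"
    using nu_power_sq[OF x, of "m + 3"] nu_power_sq[OF x, of "m + 2"] by (simp_all add: eval_nat_numeral)
  have "(\<Sum>e\<in>Basis. - (2 * \<alpha> * real (Suc m) * nu x ^ (m + 3) * (x \<bullet> e)) *\<^sub>R e
      + (\<alpha> * real (Suc m) * (real (m + 3) * nu x ^ (m + 5) * (x \<bullet> e)\<^sup>2 - nu x ^ (m + 3) * (e \<bullet> e))) *\<^sub>R x)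
    = - (2 * \<alpha> * real (Suc m) * nu x ^ (m + 3)) *\<^sub>R (\<Sum>e\<in>Basis. (x \<bullet> e) *\<^sub>R e)
      + (\<alpha> * real (Suc m) * (real (m + 3) * nu x ^ (m + 5) * (\<Sum>e\<in>Basis. (x \<bullet> e)\<^sup>2) - nu x ^ (m + 3) * (\<Sum>e\<in>(Basis::'a set). e \<bullet> e))) *\<^sub>R x"
    by (simp only: sum.distrib scaleR_sum_right scaleR_sum_left[symmetric] sum_distrib_left[symmetric]
        sum_subtractf scaleR_scaleR) simp
  also have "\<dots> = (\<alpha> * ((real m + 1) * (real m + 1 - DIM('a))) * nu x ^ (m + 3)) *\<^sub>R x"
    unfolding s1 s2 s3 mult.assoc p by (simp add: algebra_simps flip: scaleR_add_left scaleR_diff_left)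
  finally have A: "(\<Sum>e\<in>Basis. - (2 * \<alpha> * real (Suc m) * nu x ^ (m + 3) * (x \<bullet> e)) *\<^sub>R e
      + (\<alpha> * real (Suc m) * (real (m + 3) * nu x ^ (m + 5) * (x \<bullet> e)\<^sup>2 - nu x ^ (m + 3) * (e \<bullet> e))) *\<^sub>R x)
     = (\<alpha> * ((real m + 1) * (real m + 1 - DIM('a))) * nu x ^ (m + 3)) *\<^sub>R x" .
  have "(\<Sum>e\<in>(Basis::'a set). \<beta> * real m * (real (m + 2) * nu x ^ (m + 4) * (x \<bullet> e)\<^sup>2 - nu x ^ (m + 2) * (e \<bullet> e)))
    = \<beta> * real m * (real (m + 2) * nu x ^ (m + 4) * (\<Sum>e\<in>Basis. (x \<bullet> e)\<^sup>2) - nu x ^ (m + 2) * (\<Sum>e\<in>(Basis::'a set). e \<bullet> e))"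
    by (simp only: sum_distrib_left[symmetric] sum_subtractf)
  also have "\<dots> = \<beta> * (real m * (real m + 2 - DIM('a))) * nu x ^ (m + 2)"
    unfolding s2 s3 mult.assoc p by (simp add: algebra_simps)
  finally have B: "(\<Sum>e\<in>(Basis::'a set). \<beta> * real m * (real (m + 2) * nu x ^ (m + 4) * (x \<bullet> e)\<^sup>2 - nu x ^ (m + 2) * (e \<bullet> e)))
    = \<beta> * (real m * (real m + 2 - DIM('a))) * nu x ^ (m + 2)" .
  show ?thesis
    unfolding radial_second_derivative[OF x] sum_prod A B radial_def
    by (simp add: eval_nat_numeral)
qed

lemma radial_inner:
  assumes "x \<noteq> 0"
  shows "radial \<alpha> \<beta> m x \<bullet> radial \<alpha>' \<beta>' m' x = (\<alpha> * \<alpha>' + \<beta> * \<beta>') * nu x ^ (m + m')"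
proof -
  have "nu x ^ Suc m * nu x ^ Suc m' * (x \<bullet> x) = nu x ^ (m + m')"
    using nu_power_sq[OF assms, of "m + m'"] by (simp add: power_add ac_simps)
  then have "\<alpha> * \<alpha>' * (nu x ^ Suc m * nu x ^ Suc m' * (x \<bullet> x)) = \<alpha> * \<alpha>' * nu x ^ (m + m')" by simp
  then show ?thesis by (simp add: radial_def power_add algebra_simps)
qed

lemma radial_derivative_inner:
  assumes x: "x \<noteq> 0"
  shows "pd (radial \<alpha> \<beta> m) v x \<bullet> radial \<alpha>' \<beta>' m' x
     = - (real m * (\<alpha> * \<alpha>' + \<beta> * \<beta>') * nu x ^ (m + m' + 2) * (x \<bullet> v))"
proof -
  have p: "nu x ^ (m + 3) * nu x ^ Suc m' * (x \<bullet> x) = nu x ^ (m + m' + 2)"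
    using nu_power_sq[OF x, of "m + m' + 2"] by (simp add: power_add ac_simps eval_nat_numeral)
  have "pd (radial \<alpha> \<beta> m) v x \<bullet> radial \<alpha>' \<beta>' m' x
     = \<alpha> * \<alpha>' * (nu x ^ Suc m * nu x ^ Suc m') * (x \<bullet> v)
       - \<alpha> * \<alpha>' * real (Suc m) * (x \<bullet> v) * (nu x ^ (m + 3) * nu x ^ Suc m' * (x \<bullet> x))
       - \<beta> * \<beta>' * real m * (nu x ^ (m + 2) * nu x ^ m') * (x \<bullet> v)"
    by (simp add: radial_derivative[OF x] radial_def inner_diff_left inner_commute algebra_simps)
  also have "\<dots> = - (real m * (\<alpha> * \<alpha>' + \<beta> * \<beta>') * nu x ^ (m + m' + 2) * (x \<bullet> v))"
    unfolding p by (simp add: power_add algebra_simps eval_nat_numeral)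
  finally show ?thesis .
qed

section \<open>Integration by parts against normal fields\<close>

text \<open>With \<open>N\<close> one less than the dimension, this is the factor by which the rough Laplacian multiplies
\<open>|x|\<^sup>-\<^sup>m \<eta>\<close>, apart from raising \<open>m\<close> by 2.\<close>

definition lap_coeff :: "real \<Rightarrow> real \<Rightarrow> nat \<Rightarrow> real" where
  "lap_coeff N c m = real m * (N - 1 - real m) + N * c\<^sup>2"

locale radial_variation = sphere_variation U "radial s c 0" \<epsilon> K F
  for U :: "'a::euclidean_space set" and s c :: real and \<epsilon> :: real and K :: "'a set"
    and F :: "real \<Rightarrow> 'a \<Rightarrow> 'a \<times> real" +
  assumes zero_notin: "0 \<notin> U" and sc: "s\<^sup>2 + c\<^sup>2 = 1"
begin

abbreviation \<phi> :: "'a \<Rightarrow> 'a \<times> real" where "\<phi> \<equiv> radial s c 0"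

definition N :: real where "N = real DIM('a) - 1"

text \<open>\<open>h |x|\<^sup>-\<^sup>j \<eta>\<close>, where \<open>\<eta> = (c u, - s)\<close> is the unit field that is tangent to the sphere and normal to the
image of \<open>\<phi>\<close>.\<close>

definition normal :: "real \<Rightarrow> nat \<Rightarrow> 'a \<Rightarrow> 'a \<times> real" where
  "normal h j = radial (h * c) (- (h * s)) j"

definition speed :: "'a \<Rightarrow> real" where "speed x = normal 1 0 x \<bullet> dt0 joint x"

lemma nonzero: "x \<in> U \<Longrightarrow> x \<noteq> 0" using zero_notin by auto

lemma smooth_normal: "smooth_on U (normal h j)"
  unfolding normal_def by (rule smooth_radial[OF open_U zero_notin])

lemma normal_tangent: "x \<in> U \<Longrightarrow> normal h j x \<bullet> \<phi> x = 0"
  by (simp add: normal_def radial_inner[OF nonzero])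

lemma pd_normal_tangent: "x \<in> U \<Longrightarrow> pd (normal h j) e x \<bullet> \<phi> x = 0"
  by (simp add: normal_def radial_derivative_inner[OF nonzero])

text \<open>Differentiating \<open>\<eta> \<bullet> \<phi> = 0\<close> and using that \<open>\<eta>\<close> is orthogonal to the derivatives of \<open>\<phi>\<close> shows that the
derivatives of \<open>\<eta>\<close> are orthogonal to \<open>\<phi>\<close>.\<close>

lemma pull_conn_normal: "x \<in> U \<Longrightarrow> pull_conn \<phi> e (normal h j) x = pd (normal h j) e x"
  by (simp add: pull_conn_def sphere_proj_def pd_normal_tangent)

lemma normal_inner_W: "normal h j x \<bullet> dt0 joint x = h * nu x ^ j * speed x"
proof -
  have "normal h j x = (h * nu x ^ j) *\<^sub>R normal 1 0 x"
    by (simp add: normal_def radial_def)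
  then show ?thesis by (simp add: speed_def)
qed

lemma laplacian_normal:
  assumes "x \<in> U"
  shows "(\<Sum>e\<in>Basis. pd (pd (normal h j) e) e x)
     = - normal (h * lap_coeff N c j) (j + 2) x - (h * N * s * c * nu x ^ (j + 2)) *\<^sub>R \<phi> x"
proof -
  have s2: "s\<^sup>2 = 1 - c\<^sup>2" using sc by simp
  have A: "h * c * ((real j + 1) * (real j + 1 - DIM('a))) = - (h * lap_coeff N c j * c) - h * N * s * c * s"
  proof -
    have "h * N * s * c * s = h * N * c * s\<^sup>2" by (simp add: power2_eq_square)
    then show ?thesis unfolding s2 lap_coeff_def N_def by (simp add: algebra_simps power2_eq_square)
  qed
  have B: "- (h * s) * (real j * (real j + 2 - DIM('a))) = h * lap_coeff N c j * s - h * N * s * c * c"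
    unfolding lap_coeff_def N_def by (simp add: algebra_simps power2_eq_square)
  show ?thesis
    unfolding normal_def radial_laplacian[OF nonzero[OF assms]] A B
    by (simp add: radial_def algebra_simps)
qed

lemma laplacian_normal_inner_phi:
  assumes "x \<in> U"
  shows "(\<Sum>e\<in>Basis. pd (pd (normal h j) e) e x \<bullet> \<phi> x) = - (h * N * s * c * nu x ^ (j + 2))"
  unfolding inner_sum_left[symmetric] laplacian_normal[OF assms]
  using sc by (simp add: inner_diff_left normal_tangent[OF assms] radial_inner[OF nonzero[OF assms]] power2_eq_square)

lemma sphere_proj_sum: "sphere_proj p (\<Sum>i\<in>S. f i) = (\<Sum>i\<in>S. sphere_proj p (f i))"
  by (simp add: sphere_proj_def inner_sum_left scaleR_sum_left sum_subtractf)

lemma rough_laplacian_normal: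
  assumes x: "x \<in> U"
  shows "rough_laplacian \<phi> (normal h j) x = normal (h * lap_coeff N c j) (j + 2) x"
proof -
  have "pull_conn \<phi> e (pull_conn \<phi> e (normal h j)) x = sphere_proj (\<phi> x) (pd (pd (normal h j) e) e x)" for e
    unfolding pull_conn_def[of _ _ "pull_conn \<phi> e (normal h j)"]
    using frechet_derivative_cong_open[OF open_U x pull_conn_normal] by simp
  then have "rough_laplacian \<phi> (normal h j) x = - sphere_proj (\<phi> x) (\<Sum>e\<in>Basis. pd (pd (normal h j) e) e x)"
    by (simp add: rough_laplacian_def sphere_proj_sum)
  also have "\<dots> = normal (h * lap_coeff N c j) (j + 2) x"
    unfolding laplacian_normal[OF x] sphere_proj_def
    using sc by (simp add: inner_diff_left normal_tangent[OF x] radial_inner[OF nonzero[OF x]] power2_eq_square)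
  finally show ?thesis .
qed

lemma laplacian_phi:
  assumes "x \<in> U"
  shows "(\<Sum>e\<in>Basis. pd (pd \<phi> e) e x) = normal (- N * s * c) 2 x - (N * s\<^sup>2 * nu x ^ 2) *\<^sub>R \<phi> x"
proof -
  have s2: "s\<^sup>2 = 1 - c\<^sup>2" using sc by simp
  have A: "s * (1 - real DIM('a)) = - N * s * c * c - N * s\<^sup>2 * s"
    unfolding s2 N_def by (simp add: algebra_simps power2_eq_square)
  have B: "0 = - (- N * s * c * s) - N * s\<^sup>2 * c" by (simp add: power2_eq_square)
  have "(\<Sum>e\<in>Basis. pd (pd \<phi> e) e x) = radial (s * (1 - real DIM('a))) 0 2 x"
    using radial_laplacian[OF nonzero[OF assms], of s c 0] by (simp add: numeral_2_eq_2)
  also have "\<dots> = radial (- N * s * c * c - N * s\<^sup>2 * s) (- (- N * s * c * s) - N * s\<^sup>2 * c) 2 x"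
    unfolding A B[symmetric] ..
  also have "\<dots> = normal (- N * s * c) 2 x - (N * s\<^sup>2 * nu x ^ 2) *\<^sub>R \<phi> x"
    by (simp add: normal_def radial_def algebra_simps eval_nat_numeral)
  finally show ?thesis .
qed

lemma laplacian_phi_inner_phi:
  assumes "x \<in> U"
  shows "(\<Sum>e\<in>Basis. pd (pd \<phi> e) e x \<bullet> \<phi> x) = - (N * s\<^sup>2 * nu x ^ 2)"
  unfolding inner_sum_left[symmetric] laplacian_phi[OF assms]
  using sc by (simp add: inner_diff_left normal_tangent[OF assms] radial_inner[OF nonzero[OF assms]] power2_eq_square)

lemma tension_phi:
  assumes x: "x \<in> U"
  shows "tension \<phi> x = normal (- N * s * c) 2 x"
proof -
  have "tension \<phi> x = sphere_proj (\<phi> x) (\<Sum>e\<in>Basis. pd (pd \<phi> e) e x)"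
    by (simp add: tension_def pull_conn_def sphere_proj_sum)
  also have "\<dots> = normal (- N * s * c) 2 x"
    unfolding laplacian_phi[OF x] sphere_proj_def
    using sc by (simp add: inner_diff_left normal_tangent[OF x] radial_inner[OF nonzero[OF x]] power2_eq_square)
  finally show ?thesis .
qed

lemma inner_phi_W: "x \<in> U \<Longrightarrow> \<phi> x \<bullet> dt0 joint x = 0" by (rule inner_phi_dt0_joint)

lemma smooth_nu_power: "smooth_on U (\<lambda>x. nu x ^ k)"
  by (intro smooth_on_power open_U smooth_on_subset[OF smooth_nu]) (use zero_notin in auto)

lemma smooth_speed: "smooth_on U speed"
  unfolding speed_def[abs_def] by (intro smooth_on_inner open_U smooth_normal smooth_dt0 smooth_joint)

lemma smooth_weighted_speed: "smooth_on U (\<lambda>x. k * nu x ^ j * speed x)"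
  by (intro smooth_on_mult open_U smooth_on_const smooth_nu_power smooth_speed)

text \<open>The rate of change of the tension field is the Jacobi operator applied to the velocity; it is
symmetric, so it can be evaluated on the normal field instead.\<close>

lemma int_eq_dt0_tension:
  "int_eq (\<lambda>x. normal g m x \<bullet> dt0 joint_tension x) (\<lambda>x. g * (N * s\<^sup>2 - lap_coeff N c m) * nu x ^ (m + 2) * speed x)"
proof -
  have v: "varied (dx e joint)" for e by (intro varied_dx varied_joint)
  have "int_eq (\<lambda>x. normal g m x \<bullet> dt0 (nabla e (dx e joint)) x)
      (\<lambda>x. pd (pd (normal g m) e) e x \<bullet> dt0 joint x - (pd (pd \<phi> e) e x \<bullet> \<phi> x) * (normal g m x \<bullet> dt0 joint x))" for e
  proof -
    let ?R = "\<lambda>x. - 1 * ((pd (pd \<phi> e) e x \<bullet> \<phi> x) * (normal g m x \<bullet> dt0 joint x))"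
    have R: "int_eq ?R ?R"
      by (intro int_eq_refl smooth_on_mult smooth_on_inner open_U smooth_on_const smooth_on_frechet_derivative
          smooth_phi smooth_normal smooth_dt0 smooth_joint)
    have "int_eq (\<lambda>x. normal g m x \<bullet> dt0 (nabla e (dx e joint)) x)
       (\<lambda>x. - (pd (normal g m) e x \<bullet> dt0 (dx e joint) x) - (dx e (dx e joint) (0, x) \<bullet> \<phi> x) * (normal g m x \<bullet> dt0 joint x))"
      by (rule int_eq_nabla[OF smooth_normal normal_tangent v])
    also have "int_eq \<dots> (\<lambda>x. - 1 * (pd (normal g m) e x \<bullet> pd (dt0 joint) e x) + ?R x)"
    proof (rule int_eq_cong)
      fix x assume x: "x \<in> U"
      have "dx e (dx e joint) (0, x) = pd (pd \<phi> e) e x"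
        by (intro pull_conn_base(2) smooth_dx smooth_joint x) (auto simp: joint_0)
      then show "- (pd (normal g m) e x \<bullet> dt0 (dx e joint) x) - (dx e (dx e joint) (0, x) \<bullet> \<phi> x) * (normal g m x \<bullet> dt0 joint x)
         = - 1 * (pd (normal g m) e x \<bullet> pd (dt0 joint) e x) + ?R x"
        by (simp add: dt0_dx[OF smooth_joint x])
    qed (use int_eq_nabla[OF smooth_normal normal_tangent v] in \<open>auto simp: int_eq_def\<close>)
    also have "int_eq \<dots> (\<lambda>x. - 1 * - (pd (pd (normal g m) e) e x \<bullet> dt0 joint x) + ?R x)"
      by (intro int_eq_add int_eq_cmult R int_eq_parts smooth_on_frechet_derivative smooth_normal varied_joint)
    finally show ?thesis by simp
  qed
  then have "int_eq (\<lambda>x. \<Sum>e\<in>Basis. normal g m x \<bullet> dt0 (nabla e (dx e joint)) x)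
     (\<lambda>x. \<Sum>e\<in>Basis. pd (pd (normal g m) e) e x \<bullet> dt0 joint x - (pd (pd \<phi> e) e x \<bullet> \<phi> x) * (normal g m x \<bullet> dt0 joint x))"
    by (intro int_eq_sum)
  also have "int_eq \<dots> (\<lambda>x. g * (N * s\<^sup>2 - lap_coeff N c m) * nu x ^ (m + 2) * speed x)"
  proof (rule int_eq_cong)
    fix x assume x: "x \<in> U"
    have "(\<Sum>e\<in>Basis. pd (pd (normal g m) e) e x \<bullet> dt0 joint x - (pd (pd \<phi> e) e x \<bullet> \<phi> x) * (normal g m x \<bullet> dt0 joint x))
       = (\<Sum>e\<in>Basis. pd (pd (normal g m) e) e x) \<bullet> dt0 joint x
        - (\<Sum>e\<in>Basis. pd (pd \<phi> e) e x \<bullet> \<phi> x) * (normal g m x \<bullet> dt0 joint x)"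
      by (simp add: sum_subtractf inner_sum_left sum_distrib_right)
    then show "(\<Sum>e\<in>Basis. pd (pd (normal g m) e) e x \<bullet> dt0 joint x - (pd (pd \<phi> e) e x \<bullet> \<phi> x) * (normal g m x \<bullet> dt0 joint x))
       = g * (N * s\<^sup>2 - lap_coeff N c m) * nu x ^ (m + 2) * speed x"
      unfolding laplacian_normal[OF x] laplacian_phi_inner_phi[OF x]
      by (simp add: inner_diff_left inner_phi_W[OF x] normal_inner_W power_add power2_eq_square algebra_simps)
  qed (use calculation in \<open>simp add: int_eq_def\<close>)
  finally show ?thesis
  proof (rule int_eq_trans[rotated])
    show "int_eq (\<lambda>x. normal g m x \<bullet> dt0 joint_tension x)
        (\<lambda>x. \<Sum>e\<in>Basis. normal g m x \<bullet> dt0 (nabla e (dx e joint)) x)"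
      by (intro int_eq_cong smooth_on_inner open_U smooth_normal smooth_dt0 smooth_joint_tension)
        (simp add: joint_tension_def[abs_def] dt0_sum smooth_nabla smooth_dx smooth_joint inner_sum_right)
  qed
qed

text \<open>Moving the derivative onto the normal field produces its full Laplacian, whose component along \<open>\<phi>\<close>
meets \<open>\<phi> \<bullet> dt0 X = - X \<bullet> W\<close>. This is the origin of the last term.\<close>

lemma int_eq_dt0_nabla:
  assumes X: "varied X" and tan: "\<And>p. p \<in> cyl \<Longrightarrow> X p \<bullet> joint p = 0"
    and base: "\<And>x. x \<in> U \<Longrightarrow> X (0, x) = normal h j x"
  shows "int_eq (\<lambda>x. \<Sum>e\<in>Basis. pd (normal g m) e x \<bullet> dt0 (nabla e X) x)
     (\<lambda>x. normal (g * lap_coeff N c m) (m + 2) x \<bullet> dt0 X x + - (g * h * N * s * c) * nu x ^ (m + j + 2) * speed x)"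
proof -
  have "int_eq (\<lambda>x. \<Sum>e\<in>Basis. pd (normal g m) e x \<bullet> dt0 (nabla e X) x)
     (\<lambda>x. \<Sum>e\<in>Basis. - (pd (pd (normal g m) e) e x \<bullet> dt0 X x) - (dx e X (0, x) \<bullet> \<phi> x) * (pd (normal g m) e x \<bullet> dt0 joint x))"
    by (intro int_eq_sum int_eq_nabla X pd_normal_tangent smooth_on_frechet_derivative smooth_normal)
  also have "int_eq \<dots> (\<lambda>x. normal (g * lap_coeff N c m) (m + 2) x \<bullet> dt0 X x + - (g * h * N * s * c) * nu x ^ (m + j + 2) * speed x)"
  proof (rule int_eq_cong)
    fix x assume x: "x \<in> U"
    have 0: "dx e X (0, x) \<bullet> \<phi> x = 0" for e
      using pull_conn_base(2)[OF varied_smooth[OF X] x base] pd_normal_tangent[OF x] by simp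
    have 1: "\<phi> x \<bullet> dt0 X x = - (h * nu x ^ j * speed x)"
      using inner_dt0_tangent[OF varied_smooth[OF X] tan x] by (simp add: base[OF x] normal_inner_W)
    have "(\<Sum>e\<in>Basis. - (pd (pd (normal g m) e) e x \<bullet> dt0 X x) - (dx e X (0, x) \<bullet> \<phi> x) * (pd (normal g m) e x \<bullet> dt0 joint x))
       = - ((\<Sum>e\<in>Basis. pd (pd (normal g m) e) e x) \<bullet> dt0 X x)"
      by (simp add: 0 sum_negf inner_sum_left)
    also have "\<dots> = normal (g * lap_coeff N c m) (m + 2) x \<bullet> dt0 X x + - (g * h * N * s * c) * nu x ^ (m + j + 2) * speed x"
      unfolding laplacian_normal[OF x] by (simp add: inner_diff_left 1 power_add algebra_simps)
    finally show "(\<Sum>e\<in>Basis. - (pd (pd (normal g m) e) e x \<bullet> dt0 X x) - (dx e X (0, x) \<bullet> \<phi> x) * (pd (normal g m) e x \<bullet> dt0 joint x))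
      = normal (g * lap_coeff N c m) (m + 2) x \<bullet> dt0 X x + - (g * h * N * s * c) * nu x ^ (m + j + 2) * speed x" .
  qed (use calculation in \<open>simp add: int_eq_def\<close>)
  finally show ?thesis .
qed

text \<open>Only the outer derivative of the rough Laplacian is moved; the last term stems from the
corresponding projection and is evaluated with the component of the Laplacian of \<open>X\<close> along \<open>\<phi>\<close>.\<close>

lemma int_eq_dt0_laplacian:
  assumes X: "varied X" and base: "\<And>x. x \<in> U \<Longrightarrow> X (0, x) = normal h j x"
  shows "int_eq (\<lambda>x. normal g m x \<bullet> dt0 (joint_laplacian X) x)
     (\<lambda>x. (\<Sum>e\<in>Basis. pd (normal g m) e x \<bullet> dt0 (nabla e X) x) + - (g * h * N * s * c) * nu x ^ (m + j + 2) * speed x)"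
proof -
  have "int_eq (\<lambda>x. normal g m x \<bullet> dt0 (joint_laplacian X) x)
      (\<lambda>x. - 1 * (\<Sum>e\<in>Basis. normal g m x \<bullet> dt0 (nabla e (nabla e X)) x))"
  proof (intro int_eq_cong smooth_on_inner open_U smooth_normal smooth_dt0 smooth_joint_laplacian varied_smooth[OF X])
    fix x assume x: "x \<in> U"
    have s: "smooth_on cyl (nabla e (nabla e X))" for e by (intro smooth_nabla varied_smooth[OF X])
    have "dt0 (joint_laplacian X) x = - dt0 (\<lambda>p. \<Sum>e\<in>Basis. nabla e (nabla e X) p) x"
      unfolding joint_laplacian_def[abs_def] dt0_def
      by (intro frechet_derivative_eqI has_derivative_minus smooth_on_has_derivative[OF _ cyl_0[OF x]]
          smooth_on_sum open_cyl s)
    then show "normal g m x \<bullet> dt0 (joint_laplacian X) x = - 1 * (\<Sum>e\<in>Basis. normal g m x \<bullet> dt0 (nabla e (nabla e X)) x)"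
      by (simp add: dt0_sum[OF s x] inner_sum_right)
  qed
  also have "int_eq \<dots> (\<lambda>x. - 1 * (\<Sum>e\<in>Basis. - (pd (normal g m) e x \<bullet> dt0 (nabla e X) x)
       - (dx e (nabla e X) (0, x) \<bullet> \<phi> x) * (normal g m x \<bullet> dt0 joint x)))"
    by (intro int_eq_cmult int_eq_sum int_eq_nabla varied_nabla X normal_tangent smooth_normal)
  also have "int_eq \<dots> (\<lambda>x. (\<Sum>e\<in>Basis. pd (normal g m) e x \<bullet> dt0 (nabla e X) x) + - (g * h * N * s * c) * nu x ^ (m + j + 2) * speed x)"
  proof (rule int_eq_cong)
    fix x assume x: "x \<in> U"
    have "dx e (nabla e X) (0, x) = pd (pd (normal h j) e) e x" for e
    proof (rule pull_conn_base(2)[OF smooth_nabla[OF varied_smooth[OF X]] x])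
      fix y assume y: "y \<in> U"
      show "nabla e X (0, y) = pd (normal h j) e y"
        using pull_conn_base(1)[OF varied_smooth[OF X] y base] by (simp add: pull_conn_normal[OF y])
    qed
    then have "- 1 * (\<Sum>e\<in>Basis. - (pd (normal g m) e x \<bullet> dt0 (nabla e X) x)
       - (dx e (nabla e X) (0, x) \<bullet> \<phi> x) * (normal g m x \<bullet> dt0 joint x))
      = (\<Sum>e\<in>Basis. pd (normal g m) e x \<bullet> dt0 (nabla e X) x)
        + (\<Sum>e\<in>Basis. pd (pd (normal h j) e) e x \<bullet> \<phi> x) * (normal g m x \<bullet> dt0 joint x)"
      by (simp add: sum_subtractf sum_negf sum_distrib_right)
    then show "- 1 * (\<Sum>e\<in>Basis. - (pd (normal g m) e x \<bullet> dt0 (nabla e X) x)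
       - (dx e (nabla e X) (0, x) \<bullet> \<phi> x) * (normal g m x \<bullet> dt0 joint x))
      = (\<Sum>e\<in>Basis. pd (normal g m) e x \<bullet> dt0 (nabla e X) x) + - (g * h * N * s * c) * nu x ^ (m + j + 2) * speed x"
      unfolding laplacian_normal_inner_phi[OF x] by (simp add: normal_inner_W power_add algebra_simps)
  qed (use calculation in \<open>simp add: int_eq_def\<close>)
  finally show ?thesis .
qed

end

section \<open>Powers of the Hodge--Dirac operator\<close>

lemma pull_conn_zero: "pull_conn \<psi> v (\<lambda>y. 0) x = 0"
  by (simp add: pull_conn_def sphere_proj_def)

text \<open>The forms below have no component of degree above 3.\<close>

lemma list_length_cases:
  obtains "vs = []" | a where "vs = [a]" | a b where "vs = [a, b]" | a b c where "vs = [a, b, c]"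
    | "length vs \<ge> 4"
proof (cases "length vs \<ge> 4")
  case False
  then have "length vs = 0 \<or> length vs = 1 \<or> length vs = 2 \<or> length vs = 3" by linarith
  then show ?thesis using that by (auto simp: length_Suc_conv eval_nat_numeral)
qed (use that in blast)

lemma ext_deriv_eq_0:
  assumes "\<And>us y. Suc (length us) = length vs \<Longrightarrow> \<omega> y us = 0"
  shows "ext_deriv \<psi> \<omega> x vs = 0"
  unfolding ext_deriv_def
proof (intro sum.neutral ballI)
  fix k assume "k \<in> {..<length vs}"
  then have "Suc (length (take k vs @ drop (Suc k) vs)) = length vs" by auto
  note 0 = assms[OF this]
  show "(- 1) ^ k *\<^sub>R pull_conn \<psi> (vs ! k) (\<lambda>y. \<omega> y (take k vs @ drop (Suc k) vs)) x = 0"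
    by (simp only: 0 pull_conn_zero scaleR_zero_right)
qed

lemma hodge_dirac_section:
  "hodge_dirac \<psi> (section_form V) x vs = (if length vs = 1 then pull_conn \<psi> (hd vs) V x else 0)"
proof -
  have "ext_deriv \<psi> (section_form V) x vs = (if length vs = 1 then pull_conn \<psi> (hd vs) V x else 0)"
  proof (cases "length vs = 1")
    case True
    then obtain v where "vs = [v]" by (auto simp: length_Suc_conv)
    then show ?thesis by (simp add: ext_deriv_def section_form_def)
  next
    case False
    then have "ext_deriv \<psi> (section_form V) x vs = 0"
      by (intro ext_deriv_eq_0) (auto simp: section_form_def)
    then show ?thesis using False by simp
  qed
  then show ?thesis by (simp add: hodge_dirac_def codiff_section_form)
qed

text \<open>\<open>d\<^sup>2 V\<close>, evaluated on constant vector fields. It is the curvature of the pull-back connection.\<close>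

definition curv :: "('a::euclidean_space \<Rightarrow> 'b::euclidean_space) \<Rightarrow> ('a \<Rightarrow> 'b) \<Rightarrow> 'a \<Rightarrow> 'a \<Rightarrow> 'a \<Rightarrow> 'b" where
  "curv \<psi> V v w x = pull_conn \<psi> v (pull_conn \<psi> w V) x - pull_conn \<psi> w (pull_conn \<psi> v V) x"

text \<open>In degree 0 this is \<open>d\<^sup>* d\<close>, in degree 2 it is \<open>d\<^sup>2\<close>; \<open>d\<^sup>*\<close> of a section is 0.\<close>

lemma hodge_dirac_section_2:
  "hodge_dirac \<psi> (hodge_dirac \<psi> (section_form V)) x vs =
    (if vs = [] then rough_laplacian \<psi> V x
     else if length vs = 2 then curv \<psi> V (vs ! 0) (vs ! 1) x else 0)"
proof -
  define \<omega> where "\<omega> = (\<lambda>y vs. if length vs = 1 then pull_conn \<psi> (hd vs) V y else 0)"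
  have w: "hodge_dirac \<psi> (section_form V) = \<omega>"
    by (intro ext) (simp add: \<omega>_def hodge_dirac_section)
  have ext_long: "ext_deriv \<psi> \<omega> x vs = 0" if "length vs \<noteq> 2"
    using that by (intro ext_deriv_eq_0) (auto simp: \<omega>_def)
  show ?thesis
    unfolding w
    by (cases vs rule: list_length_cases)
      (auto simp: hodge_dirac_def codiff_def ext_long, auto simp: \<omega>_def pull_conn_zero rough_laplacian_def ext_deriv_def eval_nat_numeral curv_def)
qed

text \<open>In degree 1 the differential of the function part meets the codifferential of the curvature part.\<close>

lemma hodge_dirac_section_3:
  "hodge_dirac \<psi> (hodge_dirac \<psi> (hodge_dirac \<psi> (section_form V))) x vs =
    (if length vs = 1 then pull_conn \<psi> (vs ! 0) (rough_laplacian \<psi> V) x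
          - (\<Sum>e\<in>Basis. pull_conn \<psi> e (curv \<psi> V e (vs ! 0)) x)
     else if length vs = 3 then pull_conn \<psi> (vs ! 0) (curv \<psi> V (vs ! 1) (vs ! 2)) x
          - pull_conn \<psi> (vs ! 1) (curv \<psi> V (vs ! 0) (vs ! 2)) x
          + pull_conn \<psi> (vs ! 2) (curv \<psi> V (vs ! 0) (vs ! 1)) x
     else 0)"
proof -
  define \<omega> where "\<omega> = (\<lambda>y vs. if vs = [] then rough_laplacian \<psi> V y
     else if length vs = 2 then curv \<psi> V (vs ! 0) (vs ! 1) y else 0)"
  have w: "hodge_dirac \<psi> (hodge_dirac \<psi> (section_form V)) = \<omega>"
    by (intro ext) (simp add: \<omega>_def hodge_dirac_section_2)
  have ext_long: "ext_deriv \<psi> \<omega> x vs = 0" if "length vs \<ge> 4"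
    using that by (intro ext_deriv_eq_0) (auto simp: \<omega>_def)
  have \<omega>: "\<omega> y [] = rough_laplacian \<psi> V y" "\<omega> y [a] = 0" "\<omega> y [a, b] = curv \<psi> V a b y"
    "\<omega> y (a # b # c # us) = 0" for y a b c us
    by (simp_all add: \<omega>_def)
  show ?thesis
  proof (cases vs rule: list_length_cases)
    case 5
    then have "\<omega> y (e # vs) = 0" for e y by (simp add: \<omega>_def)
    with 5 show ?thesis unfolding w by (simp add: hodge_dirac_def codiff_def ext_long pull_conn_zero)
  qed (simp_all add: w hodge_dirac_def codiff_def ext_deriv_def \<omega> pull_conn_zero lessThan_Suc)
qed

context sphere_variation
begin

definition joint_curv :: "(real \<times> 'a \<Rightarrow> 'b) \<Rightarrow> 'a \<Rightarrow> 'a \<Rightarrow> real \<times> 'a \<Rightarrow> 'b" where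
  "joint_curv X v w p = nabla v (nabla w X) p - nabla w (nabla v X) p"

lemma smooth_joint_curv: "smooth_on cyl X \<Longrightarrow> smooth_on cyl (joint_curv X v w)"
  unfolding joint_curv_def[abs_def] by (intro smooth_on_diff open_cyl smooth_nabla)

lemma varied_joint_curv: "varied X \<Longrightarrow> varied (joint_curv X v w)"
  unfolding joint_curv_def[abs_def] by (intro varied_diff varied_nabla)

lemma curv_slice:
  assumes "smooth_on cyl X" "t \<in> {- \<epsilon><..<\<epsilon>}" "x \<in> U" "\<And>y. y \<in> U \<Longrightarrow> V y = X (t, y)"
  shows "curv (F t) V v w x = joint_curv X v w (t, x)"
  unfolding curv_def joint_curv_def
  by (intro arg_cong2[where f = minus]
      pull_conn_slice[OF smooth_nabla[OF assms(1)] assms(2,3)] pull_conn_slice[OF assms(1,2)] assms(4))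

definition basis_tuples :: "nat \<Rightarrow> 'a list set" where "basis_tuples p = {vs. set vs \<subseteq> Basis \<and> length vs = p}"

lemma sum_basis_tuples_1: "(\<Sum>vs\<in>basis_tuples 1. f vs) = (\<Sum>e\<in>Basis. f [e])"
proof (rule sum.reindex_cong[where l = "\<lambda>e. [e]"])
  show "basis_tuples 1 = (\<lambda>e. [e]) ` Basis" by (auto simp: basis_tuples_def length_Suc_conv)
qed (auto simp: inj_on_def)

lemma basis_tuples_0: "basis_tuples 0 = {[]}" by (auto simp: basis_tuples_def)

definition form_density :: "(real \<times> 'a \<Rightarrow> 'a list \<Rightarrow> 'b) \<Rightarrow> real \<times> 'a \<Rightarrow> real" where
  "form_density J p = (\<Sum>k\<le>DIM('a). (\<Sum>vs\<in>basis_tuples k. (norm (J p vs))\<^sup>2) / fact k)"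

lemma form_norm_sq_eq_form_density:
  assumes "\<And>vs. norm (\<omega> x vs) = norm (J p vs)"
  shows "form_norm_sq \<omega> x = form_density J p"
  unfolding form_norm_sq_def form_density_def basis_tuples_def using assms by simp

lemma smooth_form_density:
  assumes "\<And>vs. smooth_on cyl (\<lambda>p. J p vs)"
  shows "smooth_on cyl (form_density J)"
  unfolding form_density_def[abs_def] divide_inverse
  by (intro smooth_on_sum smooth_on_mult smooth_on_const smooth_norm_sq open_cyl assms)

lemma dt0_form_density:
  assumes s: "\<And>vs. smooth_on cyl (\<lambda>p. J p vs)" and x: "x \<in> U"
  shows "1 / 2 * dt0 (form_density J) x
     = (\<Sum>k\<le>DIM('a). (\<Sum>vs\<in>basis_tuples k. J (0, x) vs \<bullet> dt0 (\<lambda>p. J p vs) x) / fact k)"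
proof -
  have d: "dt0 (\<lambda>p. (\<Sum>vs\<in>basis_tuples k. (norm (J p vs))\<^sup>2) / fact k) x
     = (\<Sum>vs\<in>basis_tuples k. 2 * (J (0, x) vs \<bullet> dt0 (\<lambda>p. J p vs) x)) / fact k" for k
  proof -
    have "dt0 (\<lambda>p. (\<Sum>vs\<in>basis_tuples k. (norm (J p vs))\<^sup>2) / fact k) x = dt0 (\<lambda>p. \<Sum>vs\<in>basis_tuples k. (norm (J p vs))\<^sup>2) x / fact k"
      unfolding dt0_def
      by (rule frechet_derivative_eqI) (intro bounded_linear.has_derivative[OF bounded_linear_divide]
          smooth_on_has_derivative[OF _ cyl_0[OF x]] smooth_on_sum smooth_norm_sq open_cyl s)
    then show ?thesis by (simp add: dt0_sum smooth_norm_sq s x dt0_norm_sq)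
  qed
  have "dt0 (form_density J) x = (\<Sum>k\<le>DIM('a). dt0 (\<lambda>p. (\<Sum>vs\<in>basis_tuples k. (norm (J p vs))\<^sup>2) / fact k) x)"
    unfolding form_density_def[abs_def]
    by (rule dt0_sum[OF _ x]) (unfold divide_inverse, intro smooth_on_sum smooth_on_mult smooth_on_const smooth_norm_sq open_cyl s)
  then show ?thesis unfolding d by (simp add: sum_distrib_left sum_divide_distrib)
qed

text \<open>The part of the energy's rate of change that comes from the components of degree 0 and 1.\<close>

definition low_pairing :: "(real \<times> 'a \<Rightarrow> 'a list \<Rightarrow> 'b) \<Rightarrow> 'a \<Rightarrow> real" where
  "low_pairing J x = J (0, x) [] \<bullet> dt0 (\<lambda>p. J p []) x + (\<Sum>e\<in>Basis. J (0, x) [e] \<bullet> dt0 (\<lambda>p. J p [e]) x)"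

text \<open>Components that vanish at time 0 enter the energy quadratically and do not contribute to its first
variation.\<close>

lemma dt0_form_density_base:
  assumes s: "\<And>vs. smooth_on cyl (\<lambda>p. J p vs)" and x: "x \<in> U"
    and high: "\<And>vs. length vs \<ge> 2 \<Longrightarrow> J (0, x) vs = 0"
  shows "1 / 2 * dt0 (form_density J) x
     = low_pairing J x"
proof -
  have "1 / 2 * dt0 (form_density J) x
     = (\<Sum>k\<le>DIM('a). (\<Sum>vs\<in>basis_tuples k. J (0, x) vs \<bullet> dt0 (\<lambda>p. J p vs) x) / fact k)"
    by (rule dt0_form_density[OF s x])
  also have "\<dots> = (\<Sum>k\<in>{0, 1}. (\<Sum>vs\<in>basis_tuples k. J (0, x) vs \<bullet> dt0 (\<lambda>p. J p vs) x) / fact k)"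
  proof (rule sum.mono_neutral_right)
    show "\<forall>k\<in>{..DIM('a)} - {0, 1}. (\<Sum>vs\<in>basis_tuples k. J (0, x) vs \<bullet> dt0 (\<lambda>p. J p vs) x) / fact k = 0"
    proof
      fix k assume "k \<in> {..DIM('a)} - {0, 1}"
      then have "J (0, x) vs = 0" if "vs \<in> basis_tuples k" for vs
        using that high[of vs] by (auto simp: basis_tuples_def)
      then show "(\<Sum>vs\<in>basis_tuples k. J (0, x) vs \<bullet> dt0 (\<lambda>p. J p vs) x) / fact k = 0" by simp
    qed
  qed (use DIM_positive[where 'a = 'a] in \<open>auto simp: Suc_le_eq\<close>)
  finally show ?thesis by (simp add: low_pairing_def basis_tuples_0 sum_basis_tuples_1[simplified])
qed

lemma energy_derivative_form:
  assumes s: "\<And>vs. smooth_on cyl (\<lambda>p. J p vs)"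
    and high: "\<And>vs x. x \<in> U \<Longrightarrow> length vs \<ge> 2 \<Longrightarrow> J (0, x) vs = 0"
    and eq: "\<And>t x. t \<in> {- \<epsilon><..<\<epsilon>} \<Longrightarrow> x \<in> U \<Longrightarrow> e (F t) x = form_density J (t, x)"
    and g: "int_eq (low_pairing J) g"
  shows "first_variation e K F (LINT x:K|lebesgue. g x)"
proof (rule energy_derivative[OF smooth_form_density[OF s] eq])
  have "int_eq (\<lambda>x. 1 / 2 * dt0 (form_density J) x)
     (low_pairing J)"
    by (intro int_eq_cong smooth_on_mult open_U smooth_on_const smooth_dt0 smooth_form_density s)
      (rule dt0_form_density_base[OF s _ high])
  then show "int_eq (\<lambda>x. 1 / 2 * dt0 (form_density J) x) g" using g by (rule int_eq_trans)
qed

definition ES3_form :: "real \<times> 'a \<Rightarrow> 'a list \<Rightarrow> 'b" where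
  "ES3_form p vs = (if length vs = 1 then nabla (hd vs) joint_tension p else 0)"

definition ES4_form :: "real \<times> 'a \<Rightarrow> 'a list \<Rightarrow> 'b" where
  "ES4_form p vs = (if vs = [] then joint_laplacian joint_tension p
     else if length vs = 2 then joint_curv joint_tension (vs ! 0) (vs ! 1) p else 0)"

definition ES5_form :: "real \<times> 'a \<Rightarrow> 'a list \<Rightarrow> 'b" where
  "ES5_form p vs = (if length vs = 1 then nabla (vs ! 0) (joint_laplacian joint_tension) p
          - (\<Sum>e\<in>Basis. nabla e (joint_curv joint_tension e (vs ! 0)) p)
     else if length vs = 3 then nabla (vs ! 0) (joint_curv joint_tension (vs ! 1) (vs ! 2)) p
          - nabla (vs ! 1) (joint_curv joint_tension (vs ! 0) (vs ! 2)) p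
          + nabla (vs ! 2) (joint_curv joint_tension (vs ! 0) (vs ! 1)) p
     else 0)"

lemma smooth_ES3_form: "smooth_on cyl (\<lambda>p. ES3_form p vs)"
  unfolding ES3_form_def by (cases "length vs = 1") (auto intro: smooth_nabla smooth_joint_tension smooth_on_const)

lemma smooth_ES4_form: "smooth_on cyl (\<lambda>p. ES4_form p vs)"
  unfolding ES4_form_def
  by (cases "vs = []"; cases "length vs = 2")
    (auto intro: smooth_joint_laplacian smooth_joint_curv smooth_joint_tension smooth_on_const)

lemma smooth_ES5_form: "smooth_on cyl (\<lambda>p. ES5_form p vs)"
  unfolding ES5_form_def
  by (cases "length vs = 1"; cases "length vs = 3")
    (auto intro!: smooth_on_diff smooth_on_add smooth_on_sum open_cyl smooth_nabla smooth_joint_laplacian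
      smooth_joint_curv smooth_joint_tension smooth_on_const)

lemma ES_density_3:
  assumes "t \<in> {- \<epsilon><..<\<epsilon>}" "x \<in> U"
  shows "ES_density 3 (F t) x = form_density ES3_form (t, x)"
  unfolding ES_density_def
proof (rule form_norm_sq_eq_form_density)
  fix vs
  have "pull_conn (F t) (hd vs) (tension (F t)) x = nabla (hd vs) joint_tension (t, x)"
    by (rule pull_conn_slice[OF smooth_joint_tension assms tension_slice[OF assms(1)]])
  then show "norm (ES_form 3 (F t) x vs) = norm (ES3_form (t, x) vs)"
    by (simp add: ES_form_def ES3_form_def hodge_dirac_section)
qed

lemma ES_density_4:
  assumes "t \<in> {- \<epsilon><..<\<epsilon>}" "x \<in> U"
  shows "ES_density 4 (F t) x = form_density ES4_form (t, x)"
  unfolding ES_density_def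
proof (rule form_norm_sq_eq_form_density)
  fix vs
  have "rough_laplacian (F t) (tension (F t)) x = joint_laplacian joint_tension (t, x)"
    by (intro rough_laplacian_slice smooth_joint_tension assms tension_slice)
  moreover have "curv (F t) (tension (F t)) v w x = joint_curv joint_tension v w (t, x)" for v w
    by (intro curv_slice smooth_joint_tension assms tension_slice)
  ultimately show "norm (ES_form 4 (F t) x vs) = norm (ES4_form (t, x) vs)"
    by (simp add: ES_form_def ES4_form_def hodge_dirac_section_2 numeral_2_eq_2)
qed

lemma ES_density_5:
  assumes "t \<in> {- \<epsilon><..<\<epsilon>}" "x \<in> U"
  shows "ES_density 5 (F t) x = form_density ES5_form (t, x)"
  unfolding ES_density_def
proof (rule form_norm_sq_eq_form_density)
  fix vs
  have "pull_conn (F t) v (rough_laplacian (F t) (tension (F t))) x = nabla v (joint_laplacian joint_tension) (t, x)" for v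
    by (intro pull_conn_slice[OF _ assms] rough_laplacian_slice tension_slice smooth_joint_laplacian smooth_joint_tension assms)
  moreover have "pull_conn (F t) u (curv (F t) (tension (F t)) v w) x = nabla u (joint_curv joint_tension v w) (t, x)" for u v w
    by (intro pull_conn_slice[OF _ assms] curv_slice tension_slice smooth_joint_curv smooth_joint_tension assms)
  ultimately show "norm (ES_form 5 (F t) x vs) = norm (ES5_form (t, x) vs)"
    by (auto simp: ES_form_def ES5_form_def hodge_dirac_section_3 numeral_3_eq_3 norm_minus_commute norm_minus_cancel[symmetric, of "_ + _"] simp del: norm_minus_cancel)
qed

end

section \<open>First variation of the energies at a radial map\<close>

text \<open>This and the next two constants are the ratios between the first variation of an energy at the radial
map and the moment of the velocity defined by \<open>first_moment\<close> below.\<close>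

definition var_coeff3 :: "real \<Rightarrow> real \<Rightarrow> real \<Rightarrow> real" where
  "var_coeff3 N s c = (- N * s * c) * (lap_coeff N c 2 * (N * s\<^sup>2 - lap_coeff N c 4) + (N * s * c)\<^sup>2)"

definition var_coeff4 :: "real \<Rightarrow> real \<Rightarrow> real \<Rightarrow> real" where
  "var_coeff4 N s c = (- N * s * c) * lap_coeff N c 2 *
     (lap_coeff N c 4 * (N * s\<^sup>2 - lap_coeff N c 6) + 2 * (N * s * c)\<^sup>2)"

definition var_coeff5 :: "real \<Rightarrow> real \<Rightarrow> real \<Rightarrow> real" where
  "var_coeff5 N s c = (- N * s * c) * lap_coeff N c 2 *
     (lap_coeff N c 4 * (lap_coeff N c 6 * (N * s\<^sup>2 - lap_coeff N c 8) + 2 * (N * s * c)\<^sup>2) + lap_coeff N c 2 * (N * s * c)\<^sup>2)"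

context radial_variation
begin

abbreviation \<tau> :: "real \<times> 'a \<Rightarrow> 'a \<times> real" where "\<tau> \<equiv> joint_tension"
abbreviation \<Delta>\<tau> :: "real \<times> 'a \<Rightarrow> 'a \<times> real" where "\<Delta>\<tau> \<equiv> joint_laplacian joint_tension"

lemma tension_base: "x \<in> U \<Longrightarrow> \<tau> (0, x) = normal (- N * s * c) 2 x"
  by (simp add: joint_tension_base tension_phi)

lemma joint_laplacian_normal:
  assumes "smooth_on cyl X" "\<And>x. x \<in> U \<Longrightarrow> X (0, x) = normal h j x" "x \<in> U"
  shows "joint_laplacian X (0, x) = normal (h * lap_coeff N c j) (j + 2) x"
  using joint_laplacian_base[OF assms(1,3,2)] rough_laplacian_normal[OF assms(3)] by simp

lemma laplacian_tension_base: "x \<in> U \<Longrightarrow> \<Delta>\<tau> (0, x) = normal (- N * s * c * lap_coeff N c 2) 4 x"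
  using joint_laplacian_normal[OF smooth_joint_tension tension_base] by simp

lemma nabla_normal:
  assumes "smooth_on cyl X" "\<And>x. x \<in> U \<Longrightarrow> X (0, x) = normal h j x" "x \<in> U"
  shows "nabla e X (0, x) = pd (normal h j) e x"
  using pull_conn_base(1)[OF assms(1,3,2)] pull_conn_normal[OF assms(3)] by simp

lemma varied_laplacian_tension: "varied \<Delta>\<tau>"
  by (intro varied_joint_laplacian varied_joint_tension)

lemma int_eq_nabla_tension:
  "int_eq (\<lambda>x. \<Sum>e\<in>Basis. pd (normal g m) e x \<bullet> dt0 (nabla e \<tau>) x)
     (\<lambda>x. g * (lap_coeff N c m * (N * s\<^sup>2 - lap_coeff N c (m + 2)) + (N * s * c)\<^sup>2) * nu x ^ (m + 4) * speed x)"
proof -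
  have "int_eq (\<lambda>x. \<Sum>e\<in>Basis. pd (normal g m) e x \<bullet> dt0 (nabla e \<tau>) x)
     (\<lambda>x. normal (g * lap_coeff N c m) (m + 2) x \<bullet> dt0 \<tau> x + - (g * (- N * s * c) * N * s * c) * nu x ^ (m + 2 + 2) * speed x)"
    by (rule int_eq_dt0_nabla[OF varied_joint_tension joint_tension_tangent tension_base])
  also have "int_eq \<dots> (\<lambda>x. g * lap_coeff N c m * (N * s\<^sup>2 - lap_coeff N c (m + 2)) * nu x ^ (m + 2 + 2) * speed x
        + - (g * (- N * s * c) * N * s * c) * nu x ^ (m + 2 + 2) * speed x)"
    by (intro int_eq_add int_eq_dt0_tension int_eq_refl smooth_weighted_speed)
  finally have "int_eq (\<lambda>x. \<Sum>e\<in>Basis. pd (normal g m) e x \<bullet> dt0 (nabla e \<tau>) x)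
     (\<lambda>x. (g * lap_coeff N c m * (N * s\<^sup>2 - lap_coeff N c (m + 2)) + - (g * (- N * s * c) * N * s * c)) * nu x ^ (m + 2 + 2) * speed x)"
    by (simp only: distrib_right)
  moreover have "g * lap_coeff N c m * (N * s\<^sup>2 - lap_coeff N c (m + 2)) + - (g * (- N * s * c) * N * s * c)
    = g * (lap_coeff N c m * (N * s\<^sup>2 - lap_coeff N c (m + 2)) + (N * s * c)\<^sup>2)"
    by (simp add: algebra_simps power2_eq_square)
  moreover have "m + 2 + 2 = m + 4" by simp
  ultimately show ?thesis by (simp only:)
qed

lemma int_eq_laplacian_tension:
  "int_eq (\<lambda>x. normal g m x \<bullet> dt0 \<Delta>\<tau> x)
     (\<lambda>x. g * (lap_coeff N c m * (N * s\<^sup>2 - lap_coeff N c (m + 2)) + 2 * (N * s * c)\<^sup>2) * nu x ^ (m + 4) * speed x)"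
proof -
  have e: "m + 2 + 2 = m + 4" by simp
  have "int_eq (\<lambda>x. normal g m x \<bullet> dt0 \<Delta>\<tau> x)
     (\<lambda>x. (\<Sum>e\<in>Basis. pd (normal g m) e x \<bullet> dt0 (nabla e \<tau>) x) + - (g * (- N * s * c) * N * s * c) * nu x ^ (m + 2 + 2) * speed x)"
    by (rule int_eq_dt0_laplacian[OF varied_joint_tension tension_base])
  also have "int_eq \<dots> (\<lambda>x. g * (lap_coeff N c m * (N * s\<^sup>2 - lap_coeff N c (m + 2)) + (N * s * c)\<^sup>2) * nu x ^ (m + 4) * speed x
        + - (g * (- N * s * c) * N * s * c) * nu x ^ (m + 2 + 2) * speed x)"
    by (intro int_eq_add int_eq_nabla_tension int_eq_refl smooth_weighted_speed)
  finally have "int_eq (\<lambda>x. normal g m x \<bullet> dt0 \<Delta>\<tau> x)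
     (\<lambda>x. (g * (lap_coeff N c m * (N * s\<^sup>2 - lap_coeff N c (m + 2)) + (N * s * c)\<^sup>2) + - (g * (- N * s * c) * N * s * c)) * nu x ^ (m + 4) * speed x)"
    by (simp only: distrib_right e)
  moreover have "g * (lap_coeff N c m * (N * s\<^sup>2 - lap_coeff N c (m + 2)) + (N * s * c)\<^sup>2) + - (g * (- N * s * c) * N * s * c)
    = g * (lap_coeff N c m * (N * s\<^sup>2 - lap_coeff N c (m + 2)) + 2 * (N * s * c)\<^sup>2)"
    by (simp add: algebra_simps power2_eq_square)
  ultimately show ?thesis by (simp only:)
qed

lemma int_eq_3:
  "int_eq (\<lambda>x. \<Sum>e\<in>Basis. nabla e \<tau> (0, x) \<bullet> dt0 (nabla e \<tau>) x) (\<lambda>x. var_coeff3 N s c * nu x ^ 6 * speed x)"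
proof -
  have "int_eq (\<lambda>x. \<Sum>e\<in>Basis. nabla e \<tau> (0, x) \<bullet> dt0 (nabla e \<tau>) x)
     (\<lambda>x. \<Sum>e\<in>Basis. pd (normal (- N * s * c) 2) e x \<bullet> dt0 (nabla e \<tau>) x)"
    by (rule int_eq_cong, intro smooth_on_sum smooth_on_inner open_U smooth_dt0 smooth_slice smooth_nabla smooth_joint_tension)
      (use eps nabla_normal[OF smooth_joint_tension tension_base] in auto)
  also have "int_eq \<dots> (\<lambda>x. var_coeff3 N s c * nu x ^ 6 * speed x)"
    using int_eq_nabla_tension[of "- N * s * c" 2] by (simp add: var_coeff3_def)
  finally show ?thesis .
qed

lemma int_eq_4: "int_eq (\<lambda>x. \<Delta>\<tau> (0, x) \<bullet> dt0 \<Delta>\<tau> x) (\<lambda>x. var_coeff4 N s c * nu x ^ 8 * speed x)"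
proof -
  have "int_eq (\<lambda>x. \<Delta>\<tau> (0, x) \<bullet> dt0 \<Delta>\<tau> x) (\<lambda>x. normal (- N * s * c * lap_coeff N c 2) 4 x \<bullet> dt0 \<Delta>\<tau> x)"
    by (rule int_eq_cong, intro smooth_on_inner open_U smooth_dt0 smooth_slice smooth_joint_laplacian smooth_joint_tension)
      (use eps laplacian_tension_base in auto)
  also have "int_eq \<dots> (\<lambda>x. var_coeff4 N s c * nu x ^ 8 * speed x)"
    using int_eq_laplacian_tension[of "- N * s * c * lap_coeff N c 2" 4] by (simp add: var_coeff4_def mult.assoc)
  finally show ?thesis .
qed

lemma int_eq_5:
  "int_eq (\<lambda>x. \<Sum>e\<in>Basis. nabla e \<Delta>\<tau> (0, x) \<bullet> dt0 (nabla e \<Delta>\<tau>) x) (\<lambda>x. var_coeff5 N s c * nu x ^ 10 * speed x)"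
proof -
  let ?h = "- N * s * c * lap_coeff N c 2"
  have e: "(4::nat) + 2 = 6" "(6::nat) + 2 = 8" "(6::nat) + 4 = 10" "(4::nat) + 4 + 2 = 10" by simp_all
  have "int_eq (\<lambda>x. \<Sum>e\<in>Basis. nabla e \<Delta>\<tau> (0, x) \<bullet> dt0 (nabla e \<Delta>\<tau>) x)
     (\<lambda>x. \<Sum>e\<in>Basis. pd (normal ?h 4) e x \<bullet> dt0 (nabla e \<Delta>\<tau>) x)"
    by (rule int_eq_cong, intro smooth_on_sum smooth_on_inner open_U smooth_dt0 smooth_slice smooth_nabla
        smooth_joint_laplacian smooth_joint_tension)
      (use eps nabla_normal[OF smooth_joint_laplacian[OF smooth_joint_tension] laplacian_tension_base] in auto)
  also have "int_eq \<dots> (\<lambda>x. normal (?h * lap_coeff N c 4) (4 + 2) x \<bullet> dt0 \<Delta>\<tau> x + - (?h * ?h * N * s * c) * nu x ^ (4 + 4 + 2) * speed x)"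
    by (rule int_eq_dt0_nabla[OF varied_laplacian_tension joint_laplacian_tangent laplacian_tension_base])
  also have "int_eq \<dots> (\<lambda>x. ?h * lap_coeff N c 4 * (lap_coeff N c (4 + 2) * (N * s\<^sup>2 - lap_coeff N c (4 + 2 + 2)) + 2 * (N * s * c)\<^sup>2)
       * nu x ^ (4 + 2 + 4) * speed x + - (?h * ?h * N * s * c) * nu x ^ (4 + 4 + 2) * speed x)"
    by (intro int_eq_add int_eq_laplacian_tension int_eq_refl smooth_weighted_speed)
  finally have "int_eq (\<lambda>x. \<Sum>e\<in>Basis. nabla e \<Delta>\<tau> (0, x) \<bullet> dt0 (nabla e \<Delta>\<tau>) x)
    (\<lambda>x. (?h * lap_coeff N c 4 * (lap_coeff N c 6 * (N * s\<^sup>2 - lap_coeff N c 8) + 2 * (N * s * c)\<^sup>2)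
       + - (?h * ?h * N * s * c)) * nu x ^ 10 * speed x)"
    by (simp only: distrib_right e)
  moreover have "?h * lap_coeff N c 4 * (lap_coeff N c 6 * (N * s\<^sup>2 - lap_coeff N c 8) + 2 * (N * s * c)\<^sup>2)
       + - (?h * ?h * N * s * c) = var_coeff5 N s c"
    unfolding var_coeff5_def by (simp only: power2_eq_square) algebra
  ultimately show ?thesis by (simp only:)
qed

definition first_moment :: "nat \<Rightarrow> real" where
  "first_moment r = (LINT x:K|lebesgue. nu x ^ (2 * r) * speed x)"

lemma first_variation_density:
  assumes "smooth_on cyl D" "\<And>t x. t \<in> {- \<epsilon><..<\<epsilon>} \<Longrightarrow> x \<in> U \<Longrightarrow> e (F t) x = D (t, x)"
    and "int_eq (\<lambda>x. 1 / 2 * dt0 D x) (\<lambda>x. l * nu x ^ k * speed x)" and "k = 2 * r"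
  shows "first_variation e K F (l * first_moment r)"
  using energy_derivative[OF assms(1-3)] by (simp add: assms(4) first_moment_def mult.assoc)

lemma first_variation_form:
  assumes "\<And>vs. smooth_on cyl (\<lambda>p. J p vs)"
    and "\<And>vs x. x \<in> U \<Longrightarrow> length vs \<ge> 2 \<Longrightarrow> J (0, x) vs = 0"
    and "\<And>t x. t \<in> {- \<epsilon><..<\<epsilon>} \<Longrightarrow> x \<in> U \<Longrightarrow> e (F t) x = form_density J (t, x)"
    and "int_eq (low_pairing J) (\<lambda>x. l * nu x ^ k * speed x)" and "k = 2 * r"
  shows "first_variation e K F (l * first_moment r)"
  using energy_derivative_form[OF assms(1-4)] by (simp add: assms(5) first_moment_def mult.assoc)

text \<open>The tension field of the radial map is a normal field, and covariant derivatives of such a field are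
projections of ordinary derivatives. These commute.\<close>

lemma joint_curv_base:
  assumes x: "x \<in> U"
  shows "joint_curv \<tau> v u (0, x) = 0"
proof -
  have "joint_curv \<tau> v u (0, x) = sphere_proj (\<phi> x) (pd (pd (normal (- N * s * c) 2) u) v x)
      - sphere_proj (\<phi> x) (pd (pd (normal (- N * s * c) 2) v) u x)"
  proof -
    have "nabla v (nabla u \<tau>) (0, x) = pull_conn \<phi> v (pd (normal (- N * s * c) 2) u) x" for u v
      by (intro pull_conn_base(1) smooth_nabla smooth_joint_tension x nabla_normal tension_base)
    then show ?thesis by (simp add: joint_curv_def pull_conn_def)
  qed
  then show ?thesis using mixed_partials[OF open_U smooth_normal x] by simp
qed

lemma nabla_joint_curv_base:
  assumes x: "x \<in> U"
  shows "nabla e (joint_curv \<tau> v u) (0, x) = 0"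
  using pull_conn_base(1)[OF smooth_joint_curv[OF smooth_joint_tension] x joint_curv_base]
  by (simp add: pull_conn_zero)

lemma dx_joint_curv_base:
  assumes x: "x \<in> U"
  shows "dx e (joint_curv \<tau> v u) (0, x) = 0"
  using pull_conn_base(2)[OF smooth_joint_curv[OF smooth_joint_tension] x joint_curv_base] by simp

text \<open>After integration by parts, the rate of change of the curvature, which is antisymmetric, is paired
with second derivatives, which are symmetric.\<close>

lemma int_eq_curvature_terms:
  "int_eq (\<lambda>x. \<Sum>v\<in>Basis. \<Sum>e\<in>Basis. pd (normal h j) v x \<bullet> dt0 (nabla e (joint_curv \<tau> e v)) x) (\<lambda>x. 0)"
proof -
  note v = varied_joint_curv[OF varied_joint_tension]
  have "int_eq (\<lambda>x. \<Sum>v\<in>Basis. \<Sum>e\<in>Basis. pd (normal h j) v x \<bullet> dt0 (nabla e (joint_curv \<tau> e v)) x)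
    (\<lambda>x. \<Sum>v\<in>Basis. \<Sum>e\<in>Basis. - (pd (pd (normal h j) v) e x \<bullet> dt0 (joint_curv \<tau> e v) x)
      - (dx e (joint_curv \<tau> e v) (0, x) \<bullet> \<phi> x) * (pd (normal h j) v x \<bullet> dt0 joint x))"
    by (intro int_eq_sum int_eq_nabla v pd_normal_tangent smooth_on_frechet_derivative smooth_normal)
  also have "int_eq \<dots> (\<lambda>x. 0)"
  proof (rule int_eq_cong)
    fix x assume x: "x \<in> U"
    let ?a = "\<lambda>v e. pd (pd (normal h j) v) e x \<bullet> dt0 (joint_curv \<tau> e v) x"
    have d: "(joint_curv \<tau> e v) = (\<lambda>p. - joint_curv \<tau> v e p)" for e v
      by (simp add: joint_curv_def fun_eq_iff)
    have anti: "dt0 (joint_curv \<tau> e v) x = - dt0 (joint_curv \<tau> v e) x" for e v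
      unfolding dt0_def
      by (subst d, rule frechet_derivative_eqI)
        (intro has_derivative_minus smooth_on_has_derivative[OF _ cyl_0[OF x]] smooth_joint_curv smooth_joint_tension)
    have a: "?a v e = - ?a e v" for e v
      using mixed_partials[OF open_U smooth_normal x, of h j v e] anti[of e v] by simp
    have "(\<Sum>v\<in>Basis. \<Sum>e\<in>Basis. ?a v e) = (\<Sum>v\<in>Basis. \<Sum>e\<in>Basis. - ?a e v)"
      by (intro sum.cong refl a)
    also have "\<dots> = - (\<Sum>v\<in>Basis. \<Sum>e\<in>Basis. ?a v e)"
      by (subst sum.swap) (simp add: sum_negf)
    finally show "(\<Sum>v\<in>Basis. \<Sum>e\<in>Basis. - ?a v e
        - (dx e (joint_curv \<tau> e v) (0, x) \<bullet> \<phi> x) * (pd (normal h j) v x \<bullet> dt0 joint x)) = 0"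
      by (simp add: dx_joint_curv_base[OF x] sum_negf)
  qed (use calculation in \<open>simp add: int_eq_def\<close>)
  finally show ?thesis .
qed

lemma ES_energy_3:
  "first_variation (ES_density 3) K F (var_coeff3 N s c * first_moment 3)"
proof (rule first_variation_form[OF smooth_ES3_form _ ES_density_3])
  show "int_eq (low_pairing ES3_form)
     (\<lambda>x. var_coeff3 N s c * nu x ^ 6 * speed x)"
    using int_eq_3 by (simp add: ES3_form_def low_pairing_def[abs_def])
qed (auto simp: ES3_form_def)

lemma ES_energy_4:
  "first_variation (ES_density 4) K F (var_coeff4 N s c * first_moment 4)"
proof (rule first_variation_form[OF smooth_ES4_form _ ES_density_4])
  show "int_eq (low_pairing ES4_form)
     (\<lambda>x. var_coeff4 N s c * nu x ^ 8 * speed x)"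
    using int_eq_4 by (simp add: ES4_form_def low_pairing_def[abs_def])
qed (auto simp: ES4_form_def joint_curv_base)

text \<open>The degree 1 component of the form differs from the covariant differential of the Laplacian of the
tension field by a term that vanishes at time 0 but has a nonzero rate of change; only its integral
against a normal field vanishes.\<close>

lemma ES_energy_5:
  "first_variation (ES_density 5) K F (var_coeff5 N s c * first_moment 5)"
proof -
  let ?h = "- N * s * c * lap_coeff N c 2"
  have s1: "smooth_on cyl (nabla v \<Delta>\<tau>)" for v
    by (intro smooth_nabla smooth_joint_laplacian smooth_joint_tension)
  have s2: "smooth_on cyl (\<lambda>p. \<Sum>e\<in>Basis. nabla e (joint_curv \<tau> e v) p)" for v
    by (intro smooth_on_sum open_cyl smooth_nabla smooth_joint_curv smooth_joint_tension)
  have b: "nabla v \<Delta>\<tau> (0, x) = pd (normal ?h 4) v x" if "x \<in> U" for v x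
    by (rule nabla_normal[OF smooth_joint_laplacian[OF smooth_joint_tension] laplacian_tension_base that])
  show ?thesis
  proof (rule first_variation_form[OF smooth_ES5_form _ ES_density_5])
    have "int_eq (low_pairing ES5_form)
      (\<lambda>x. (\<Sum>v\<in>Basis. nabla v \<Delta>\<tau> (0, x) \<bullet> dt0 (nabla v \<Delta>\<tau>) x)
         + - 1 * (\<Sum>v\<in>Basis. \<Sum>e\<in>Basis. pd (normal ?h 4) v x \<bullet> dt0 (nabla e (joint_curv \<tau> e v)) x))"
    proof (rule int_eq_cong)
      show "smooth_on U (low_pairing ES5_form)"
        unfolding low_pairing_def[abs_def]
        by (intro smooth_on_add smooth_on_sum smooth_on_inner open_U smooth_dt0 smooth_ES5_form
            smooth_slice[OF smooth_ES5_form]) (use eps in auto)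
      fix x assume x: "x \<in> U"
      have "ES5_form (0, x) [v] = nabla v \<Delta>\<tau> (0, x)" for v
        by (simp add: ES5_form_def nabla_joint_curv_base[OF x])
      moreover have "dt0 (\<lambda>p. ES5_form p [v]) x = dt0 (nabla v \<Delta>\<tau>) x - (\<Sum>e\<in>Basis. dt0 (nabla e (joint_curv \<tau> e v)) x)" for v
      proof -
        have "dt0 (\<lambda>p. ES5_form p [v]) x = dt0 (nabla v \<Delta>\<tau>) x - dt0 (\<lambda>p. \<Sum>e\<in>Basis. nabla e (joint_curv \<tau> e v) p) x"
          unfolding ES5_form_def dt0_def using smooth_on_differentiable[OF s1 cyl_0[OF x]] smooth_on_differentiable[OF s2 cyl_0[OF x]]
          by (simp add: frechet_derivative_diff)
        then show ?thesis by (simp add: dt0_sum smooth_nabla smooth_joint_curv smooth_joint_tension x)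
      qed
      ultimately show "low_pairing ES5_form x
        = (\<Sum>v\<in>Basis. nabla v \<Delta>\<tau> (0, x) \<bullet> dt0 (nabla v \<Delta>\<tau>) x)
         + - 1 * (\<Sum>v\<in>Basis. \<Sum>e\<in>Basis. pd (normal ?h 4) v x \<bullet> dt0 (nabla e (joint_curv \<tau> e v)) x)"
        by (simp add: low_pairing_def ES5_form_def b[OF x] inner_diff_right inner_sum_right sum_subtractf)
    qed
    also have "int_eq \<dots> (\<lambda>x. var_coeff5 N s c * nu x ^ 10 * speed x + - 1 * 0)"
      by (intro int_eq_add int_eq_cmult int_eq_5 int_eq_curvature_terms)
    finally show "int_eq (low_pairing ES5_form)
       (\<lambda>x. var_coeff5 N s c * nu x ^ 10 * speed x)" by simp
  qed (auto simp: ES5_form_def nabla_joint_curv_base)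
qed

lemma r_energy_3:
  "first_variation (r_density 3) K F (var_coeff3 N s c * first_moment 3)"
proof (rule first_variation_density)
  show sm: "smooth_on cyl (\<lambda>p. \<Sum>e\<in>Basis. (norm (nabla e \<tau> p))\<^sup>2)"
    by (intro smooth_on_sum open_cyl smooth_norm_sq smooth_nabla smooth_joint_tension)
  show "r_density 3 (F t) x = (\<Sum>e\<in>Basis. (norm (nabla e \<tau> (t, x)))\<^sup>2)"
    if "t \<in> {- \<epsilon><..<\<epsilon>}" "x \<in> U" for t x
    by (simp add: r_density_def pull_conn_slice[OF smooth_joint_tension that tension_slice[OF that(1)]])
  have "int_eq (\<lambda>x. 1 / 2 * dt0 (\<lambda>p. \<Sum>e\<in>Basis. (norm (nabla e \<tau> p))\<^sup>2) x)
     (\<lambda>x. \<Sum>e\<in>Basis. nabla e \<tau> (0, x) \<bullet> dt0 (nabla e \<tau>) x)"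
    by (rule int_eq_cong, intro smooth_on_mult open_U smooth_on_const smooth_dt0 sm)
      (simp add: dt0_sum smooth_norm_sq smooth_nabla smooth_joint_tension dt0_norm_sq sum_distrib_left)
  also note int_eq_3
  finally show "int_eq (\<lambda>x. 1 / 2 * dt0 (\<lambda>p. \<Sum>e\<in>Basis. (norm (nabla e \<tau> p))\<^sup>2) x)
     (\<lambda>x. var_coeff3 N s c * nu x ^ 6 * speed x)" .
qed simp

lemma r_energy_4:
  "first_variation (r_density 4) K F (var_coeff4 N s c * first_moment 4)"
proof -
  have sm': "smooth_on cyl \<Delta>\<tau>" by (intro smooth_joint_laplacian smooth_joint_tension)
  show ?thesis
  proof (rule first_variation_density)
    show sm: "smooth_on cyl (\<lambda>p. (norm (\<Delta>\<tau> p))\<^sup>2)" by (intro smooth_norm_sq sm')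
    show "r_density 4 (F t) x = (norm (\<Delta>\<tau> (t, x)))\<^sup>2"
      if "t \<in> {- \<epsilon><..<\<epsilon>}" "x \<in> U" for t x
      by (simp add: r_density_def rough_laplacian_slice[OF smooth_joint_tension that tension_slice[OF that(1)]])
    have "int_eq (\<lambda>x. 1 / 2 * dt0 (\<lambda>p. (norm (\<Delta>\<tau> p))\<^sup>2) x) (\<lambda>x. \<Delta>\<tau> (0, x) \<bullet> dt0 \<Delta>\<tau> x)"
      by (rule int_eq_cong, intro smooth_on_mult open_U smooth_on_const smooth_dt0 sm)
        (simp add: sm' dt0_norm_sq)
    also note int_eq_4
    finally show "int_eq (\<lambda>x. 1 / 2 * dt0 (\<lambda>p. (norm (\<Delta>\<tau> p))\<^sup>2) x) (\<lambda>x. var_coeff4 N s c * nu x ^ 8 * speed x)" .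
  qed simp
qed

lemma r_energy_5:
  "first_variation (r_density 5) K F (var_coeff5 N s c * first_moment 5)"
proof -
  have sm': "smooth_on cyl \<Delta>\<tau>" by (intro smooth_joint_laplacian smooth_joint_tension)
  show ?thesis
  proof (rule first_variation_density)
    show sm: "smooth_on cyl (\<lambda>p. \<Sum>e\<in>Basis. (norm (nabla e \<Delta>\<tau> p))\<^sup>2)"
      by (intro smooth_on_sum open_cyl smooth_norm_sq smooth_nabla sm')
    show "r_density 5 (F t) x = (\<Sum>e\<in>Basis. (norm (nabla e \<Delta>\<tau> (t, x)))\<^sup>2)"
      if "t \<in> {- \<epsilon><..<\<epsilon>}" "x \<in> U" for t x
    proof -
      have "rough_laplacian (F t) (tension (F t)) y = \<Delta>\<tau> (t, y)" if "y \<in> U" for y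
        by (rule rough_laplacian_slice[OF smooth_joint_tension _ that tension_slice])
          (use \<open>t \<in> {- \<epsilon><..<\<epsilon>}\<close> in auto)
      from pull_conn_slice[OF sm' that this] show ?thesis by (simp add: r_density_def)
    qed
    have "int_eq (\<lambda>x. 1 / 2 * dt0 (\<lambda>p. \<Sum>e\<in>Basis. (norm (nabla e \<Delta>\<tau> p))\<^sup>2) x)
       (\<lambda>x. \<Sum>e\<in>Basis. nabla e \<Delta>\<tau> (0, x) \<bullet> dt0 (nabla e \<Delta>\<tau>) x)"
      by (rule int_eq_cong, intro smooth_on_mult open_U smooth_on_const smooth_dt0 sm)
        (simp add: dt0_sum smooth_norm_sq smooth_nabla sm' dt0_norm_sq sum_distrib_left)
    also note int_eq_5
    finally show "int_eq (\<lambda>x. 1 / 2 * dt0 (\<lambda>p. \<Sum>e\<in>Basis. (norm (nabla e \<Delta>\<tau> p))\<^sup>2) x)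
       (\<lambda>x. var_coeff5 N s c * nu x ^ 10 * speed x)" .
  qed simp
qed

end

section \<open>Criticality and harmonicity of radial maps\<close>

definition bump :: "'a::euclidean_space \<Rightarrow> real \<Rightarrow> 'a \<Rightarrow> real" where
  "bump x0 \<delta> x = flat_exp 1 (\<delta>\<^sup>2 - (x - x0) \<bullet> (x - x0))"

lemma smooth_bump: "smooth_on UNIV (bump x0 \<delta>)"
  unfolding bump_def[abs_def]
  by (intro smooth_on_flat_exp smooth_on_diff smooth_on_inner smooth_on_const smooth_on_id open_UNIV)

lemma bump_nonneg: "bump x0 \<delta> x \<ge> 0"
  by (simp add: bump_def flat_exp_1_nonneg)

lemma bump_pos: "x \<in> ball x0 \<delta> \<Longrightarrow> bump x0 \<delta> x > 0"
  unfolding bump_def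
  by (intro flat_exp_1_pos) (simp add: dist_norm norm_minus_commute power_strict_mono flip: power2_norm_eq_inner)

lemma bump_zero: "\<delta> \<ge> 0 \<Longrightarrow> x \<notin> ball x0 \<delta> \<Longrightarrow> bump x0 \<delta> x = 0"
  unfolding bump_def
  by (intro flat_exp_nonpos) (simp add: dist_norm norm_minus_commute power_mono flip: power2_norm_eq_inner)

lemma bump_integral_pos:
  assumes \<delta>: "\<delta> > 0" and g: "continuous_on (cball x0 \<delta>) g" and pos: "\<And>x. x \<in> cball x0 \<delta> \<Longrightarrow> g x > 0"
  shows "(LINT x:cball x0 \<delta>|lebesgue. bump x0 \<delta> x * g x) > (0::real)"
proof -
  let ?f = "\<lambda>x. indicator (cball x0 \<delta>) x *\<^sub>R (bump x0 \<delta> x * g x)"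
  have "continuous_on (cball x0 \<delta>) (\<lambda>x. bump x0 \<delta> x * g x)"
    by (intro continuous_on_mult g continuous_on_subset[OF smooth_on_continuous_on[OF smooth_bump]]) auto
  then have int: "integrable lebesgue ?f"
    using set_integrable_continuous_compact[OF compact_cball] unfolding set_integrable_def by blast
  have nn: "AE x in lebesgue. 0 \<le> ?f x"
    by (intro AE_I2) (auto simp: indicator_def intro!: mult_nonneg_nonneg bump_nonneg less_imp_le[OF pos])
  have "integral\<^sup>L lebesgue ?f \<noteq> 0"
  proof
    assume "integral\<^sup>L lebesgue ?f = 0"
    then have "AE x in lebesgue. ?f x = 0" using integral_nonneg_eq_0_iff_AE[OF int nn] by simp
    then have "AE x in lebesgue. x \<notin> ball x0 \<delta>"
    proof (rule AE_mp, intro AE_I2 impI notI)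
      fix x assume "?f x = 0" "x \<in> ball x0 \<delta>"
      then show False using bump_pos[of x x0 \<delta>] pos[of x] by (auto simp: indicator_def)
    qed
    then have "emeasure lebesgue (ball x0 \<delta>) = 0"
      by (subst (asm) AE_iff_measurable[OF _ refl]) (auto simp: ball_def)
    then have "measure lebesgue (ball x0 \<delta>) = 0" by (simp add: measure_def)
    then show False using \<delta> by simp
  qed
  moreover have "integral\<^sup>L lebesgue ?f \<ge> 0" by (rule integral_nonneg_AE[OF nn])
  ultimately show ?thesis by (simp add: set_lebesgue_integral_def)
qed

abbreviation punctured_ball :: "'a::euclidean_space set" where "punctured_ball \<equiv> ball 0 1 - {0}"

lemma open_punctured_ball: "open (punctured_ball :: 'a::euclidean_space set)"
  by (intro open_Diff) auto

lemma radial_variationI: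
  fixes F :: "real \<Rightarrow> 'a::euclidean_space \<Rightarrow> 'a \<times> real"
  assumes "variation punctured_ball (radial s c 0) \<epsilon> K F" "s\<^sup>2 + c\<^sup>2 = 1"
  shows "radial_variation punctured_ball s c \<epsilon> K F"
  using assms open_punctured_ball
  by (simp add: radial_variation_def radial_variation_axioms_def sphere_variation_def)

lemma smooth_sphere_map_radial:
  assumes "s\<^sup>2 + c\<^sup>2 = 1"
  shows "smooth_sphere_map punctured_ball (radial s c 0 :: 'a::euclidean_space \<Rightarrow> _)"
  unfolding smooth_sphere_map_def
proof (intro conjI ballI)
  show "smooth_on punctured_ball (radial s c 0 :: 'a \<Rightarrow> _)"
    by (rule smooth_radial[OF open_punctured_ball]) simp
  fix x :: 'a assume "x \<in> punctured_ball"
  then have "radial s c 0 x \<bullet> radial s c 0 x = 1"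
    using assms by (simp add: radial_inner power2_eq_square)
  then show "radial s c 0 x \<in> sphere 0 1" by (simp add: norm_eq_sqrt_inner)
qed

text \<open>The constant variation gives access to the identities for the radial map itself.\<close>

lemma trivial_variation:
  assumes "s\<^sup>2 + c\<^sup>2 = 1"
  shows "variation punctured_ball (radial s c 0 :: 'a::euclidean_space \<Rightarrow> _) 1 {} (\<lambda>t. radial s c 0)"
proof -
  have "smooth_on ({- 1<..<1} \<times> punctured_ball) (\<lambda>p::real \<times> 'a. radial s c 0 (snd p + 0))"
    by (rule smooth_on_affine[OF open_punctured_ball _ bounded_linear_snd smooth_radial])
      (auto intro!: open_Times open_punctured_ball)
  then show ?thesis
    using smooth_sphere_map_radial[OF assms, where 'a = 'a]
    by (auto simp: variation_def smooth_sphere_map_def case_prod_beta')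
qed

lemma tension_radial:
  assumes "s\<^sup>2 + c\<^sup>2 = 1" "x \<in> punctured_ball"
  shows "tension (radial s c 0) x = radial (- (real DIM('a) - 1) * s * c * c) ((real DIM('a) - 1) * s * c * s) 2 (x::'a::euclidean_space)"
proof -
  interpret radial_variation "punctured_ball :: 'a set" s c 1 "{}" "\<lambda>t. radial s c 0"
    by (rule radial_variationI[OF trivial_variation]) (rule assms)+
  show ?thesis using tension_phi[OF assms(2)] by (simp add: normal_def N_def algebra_simps)
qed

lemma harmonic_radial_iff:
  assumes "s\<^sup>2 + c\<^sup>2 = 1" "s > 0" "c > 0"
  shows "harmonic_on punctured_ball (radial s c 0 :: 'a::euclidean_space \<Rightarrow> _) \<longleftrightarrow> DIM('a) = 1"
proof
  assume h: "harmonic_on punctured_ball (radial s c 0 :: 'a \<Rightarrow> _)"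
  obtain e :: 'a where e: "e \<in> Basis" using nonempty_Basis by blast
  define x where "x = (1/2) *\<^sub>R e"
  have x: "x \<in> punctured_ball" "norm x = 1/2" using e by (auto simp: x_def)
  then have "tension (radial s c 0) x = 0" using h by (simp add: harmonic_on_def)
  then have "(real DIM('a) - 1) * s * c * s * nu x ^ 2 = 0"
    by (simp add: tension_radial[OF assms(1) x(1)] radial_def zero_prod_def)
  then show "DIM('a) = 1" using assms x by (simp add: nu_def)
next
  assume "DIM('a) = 1"
  then show "harmonic_on punctured_ball (radial s c 0 :: 'a \<Rightarrow> _)"
    using smooth_sphere_map_radial[OF assms(1), where 'a = 'a]
    by (simp add: harmonic_on_def tension_radial[OF assms(1)] radial_def zero_prod_def)
qed

text \<open>Increasing the angle \<open>a\<close> rotates the map in the direction of \<open>\<eta>\<close>. With \<open>x0\<close> of norm \<open>1 / 2\<close>, the radius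
\<open>1 / 4\<close> keeps the support of the bump inside the punctured ball.\<close>

definition normal_rotation :: "real \<Rightarrow> 'a::euclidean_space \<Rightarrow> real \<Rightarrow> 'a \<Rightarrow> 'a \<times> real" where
  "normal_rotation a x0 t x = radial (sin (a + t * bump x0 (1/4) x)) (cos (a + t * bump x0 (1/4) x)) 0 x"

lemma normal_variation:
  fixes x0 :: "'a::euclidean_space"
  assumes x0: "norm x0 = 1/2"
  shows "variation punctured_ball (radial (sin a) (cos a) 0) 1 (cball x0 (1/4)) (normal_rotation a x0)"
proof -
  have K: "cball x0 (1/4) \<subseteq> punctured_ball"
  proof
    fix x assume "x \<in> cball x0 (1/4)"
    then have "norm (x0 - x) \<le> 1/4" by (simp add: dist_norm)
    moreover have "norm x \<le> norm x0 + norm (x0 - x)" "norm x0 \<le> norm x + norm (x0 - x)"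
      using norm_triangle_ineq4[of x0 "x0 - x"] norm_triangle_ineq[of x "x0 - x"] by auto
    ultimately show "x \<in> punctured_ball" using x0 by auto
  qed
  let ?C = "{- 1<..<1::real} \<times> (punctured_ball :: 'a set)"
  have C: "open ?C" by (intro open_Times open_punctured_ball) auto
  have t: "smooth_on ?C fst" by (rule smooth_on_bounded_linear[OF bounded_linear_fst])
  have sn: "smooth_on ?C snd" by (rule smooth_on_bounded_linear[OF bounded_linear_snd])
  have nu: "smooth_on ?C (\<lambda>p. nu (snd p))"
    using smooth_on_affine[OF _ C bounded_linear_snd smooth_nu, of 0] by (auto simp: open_Compl)
  have b: "smooth_on ?C (\<lambda>p. bump x0 (1/4) (snd p))"
    using smooth_on_affine[OF open_UNIV C bounded_linear_snd smooth_bump, of 0 x0 "1/4"] by simp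
  have "smooth_on ?C (\<lambda>p. normal_rotation a x0 (fst p) (snd p))"
    unfolding normal_rotation_def radial_def
    by (intro smooth_on_Pair smooth_on_scaleR smooth_on_mult smooth_on_power smooth_on_sin smooth_on_cos
        smooth_on_add C t sn nu b smooth_on_const)
  moreover have "normal_rotation a x0 t x \<in> sphere 0 1" if "x \<in> punctured_ball" for t x
  proof -
    have "normal_rotation a x0 t x \<bullet> normal_rotation a x0 t x = 1" using that by (simp add: normal_rotation_def radial_inner flip: power2_eq_square)
    then show ?thesis by (simp add: norm_eq_sqrt_inner)
  qed
  moreover have "normal_rotation a x0 t x = radial (sin a) (cos a) 0 x" if "x \<notin> cball x0 (1/4)" for t x
  proof -
    have "bump x0 (1/4) x = 0" by (rule bump_zero) (use that in auto)
    then show ?thesis by (simp add: normal_rotation_def)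
  qed
  moreover have "normal_rotation a x0 0 x = radial (sin a) (cos a) 0 x" for x by (simp add: normal_rotation_def)
  ultimately show ?thesis
    using K by (auto simp: variation_def case_prod_beta')
qed

lemma normal_variation_moment_pos:
  fixes x0 :: "'a::euclidean_space"
  assumes x0: "norm x0 = 1/2"
  shows "radial_variation.first_moment (sin a) (cos a) (cball x0 (1/4)) (normal_rotation a x0) r > 0"
proof -
  interpret radial_variation "punctured_ball :: 'a set" "sin a" "cos a" 1 "cball x0 (1/4)" "normal_rotation a x0"
    by (rule radial_variationI[OF normal_variation[OF x0]]) simp
  have w: "speed x = bump x0 (1/4) x" if x: "x \<in> punctured_ball" for x
  proof -
    let ?b = "bump x0 (1/4) x"
    have c: "(0, x) + 0 *\<^sub>R (1, 0) \<in> cyl" using x cyl_0 by simp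
    have "((\<lambda>s. joint ((0, x) + s *\<^sub>R (1, 0))) has_vector_derivative dt0 joint x) (at 0)"
      using line_has_vector_derivative[OF smooth_joint c] by (simp add: dt0_def)
    then have 1: "((\<lambda>s. normal_rotation a x0 s x) has_vector_derivative dt0 joint x) (at 0)" by (simp add: joint_eq)
    have "((\<lambda>s. ((sin (a + s * ?b) * nu x) *\<^sub>R x, cos (a + s * ?b))) has_vector_derivative
       ((cos a * ?b * nu x) *\<^sub>R x, - sin a * ?b)) (at 0)"
      by (auto intro!: derivative_eq_intros has_vector_derivative_Pair simp flip: has_real_derivative_iff_has_vector_derivative)
    then have "((\<lambda>s. normal_rotation a x0 s x) has_vector_derivative ?b *\<^sub>R normal 1 0 x) (at 0)"
      by (simp add: normal_rotation_def radial_def normal_def mult_ac)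
    with 1 have "dt0 joint x = ?b *\<^sub>R normal 1 0 x" by (rule vector_derivative_unique_at)
    then show ?thesis
      using x by (simp add: speed_def normal_def radial_inner flip: power2_eq_square)
  qed
  have "first_moment r = (LINT x:cball x0 (1/4)|lebesgue. bump x0 (1/4) x * nu x ^ (2 * r))"
    unfolding first_moment_def by (rule set_integral_cong_U) (simp add: w)
  also have "\<dots> > 0"
  proof (rule bump_integral_pos)
    show "continuous_on (cball x0 (1/4)) (\<lambda>x. nu x ^ (2 * r))"
      by (rule continuous_on_subset[OF smooth_on_continuous_on[OF smooth_nu_power] K_subset])
    show "nu x ^ (2 * r) > 0" if "x \<in> cball x0 (1/4)" for x
      using K_subset that by (intro zero_less_power nu_pos) blast
  qed simp
  finally show ?thesis .
qed

text \<open>If \<open>l = 0\<close>, all first variations vanish. Conversely, the rotation towards the normal field has a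
positive moment.\<close>

lemma critical_point_radial_iff:
  fixes e :: "('a::euclidean_space \<Rightarrow> 'a \<times> real) \<Rightarrow> 'a \<Rightarrow> real"
  assumes deriv: "\<And>\<epsilon> K F. radial_variation punctured_ball (sin a) (cos a) \<epsilon> K F \<Longrightarrow>
      first_variation e K F (l * radial_variation.first_moment (sin a) (cos a) K F r)"
  shows "critical_point e punctured_ball (radial (sin a) (cos a) 0) \<longleftrightarrow> l = 0"
proof
  assume crit: "critical_point e punctured_ball (radial (sin a) (cos a) 0)"
  obtain b :: 'a where b: "b \<in> Basis" using nonempty_Basis by blast
  define x0 where "x0 = (1/2) *\<^sub>R b"
  have x0: "norm x0 = 1/2" using b by (auto simp: x0_def)
  let ?F = "normal_rotation a x0"
  note v = normal_variation[OF x0, of a]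
  have "((\<lambda>t. 1 / 2 * (LINT x:cball x0 (1/4)|lebesgue. e (?F t) x)) has_real_derivative 0) (at 0)"
    using crit v unfolding critical_point_def by blast
  moreover have "((\<lambda>t. 1 / 2 * (LINT x:cball x0 (1/4)|lebesgue. e (?F t) x)) has_real_derivative
      l * radial_variation.first_moment (sin a) (cos a) (cball x0 (1/4)) ?F r) (at 0)"
    by (rule deriv[OF radial_variationI[OF v], unfolded first_variation_def]) simp
  ultimately have "l * radial_variation.first_moment (sin a) (cos a) (cball x0 (1/4)) ?F r = 0"
    by (rule DERIV_unique[symmetric])
  then show "l = 0" using normal_variation_moment_pos[OF x0, of a r] by simp
next
  assume "l = 0"
  then show "critical_point e punctured_ball (radial (sin a) (cos a) 0)"
    unfolding critical_point_def using deriv[OF radial_variationI, unfolded first_variation_def] by simp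
qed

lemmas (in radial_variation) energies = r_energy_3[unfolded N_def] r_energy_4[unfolded N_def]
  r_energy_5[unfolded N_def] ES_energy_3[unfolded N_def] ES_energy_4[unfolded N_def] ES_energy_5[unfolded N_def]

lemma critical_point_iffs:
  fixes a :: real
  defines "\<phi> \<equiv> radial (sin a) (cos a) 0 :: 'a::euclidean_space \<Rightarrow> 'a \<times> real"
    and "N \<equiv> real DIM('a) - 1"
  shows "critical_point (r_density 3) punctured_ball \<phi> \<longleftrightarrow> var_coeff3 N (sin a) (cos a) = 0"
    "critical_point (r_density 4) punctured_ball \<phi> \<longleftrightarrow> var_coeff4 N (sin a) (cos a) = 0"
    "critical_point (r_density 5) punctured_ball \<phi> \<longleftrightarrow> var_coeff5 N (sin a) (cos a) = 0"
    "critical_point (ES_density 3) punctured_ball \<phi> \<longleftrightarrow> var_coeff3 N (sin a) (cos a) = 0"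
    "critical_point (ES_density 4) punctured_ball \<phi> \<longleftrightarrow> var_coeff4 N (sin a) (cos a) = 0"
    "critical_point (ES_density 5) punctured_ball \<phi> \<longleftrightarrow> var_coeff5 N (sin a) (cos a) = 0"
  unfolding \<phi>_def N_def
  by (rule critical_point_radial_iff, erule radial_variation.energies)+

section \<open>Homogeneous functions\<close>

definition homogeneous :: "nat \<Rightarrow> ('a::real_normed_vector \<Rightarrow> 'b::real_normed_vector) \<Rightarrow> bool" where
  "homogeneous j f \<longleftrightarrow> (\<forall>l>0. \<forall>x. x \<noteq> 0 \<longrightarrow> f (l *\<^sub>R x) = (1 / l) ^ j *\<^sub>R f x)"

lemma homogeneousD: "homogeneous j f \<Longrightarrow> l > 0 \<Longrightarrow> x \<noteq> 0 \<Longrightarrow> f (l *\<^sub>R x) = (1 / l) ^ j *\<^sub>R f x"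
  by (simp add: homogeneous_def)

lemma open_nonzero: "open (- {0::'a::real_normed_vector})" by (simp add: open_Compl)

lemma homogeneous_frechet_derivative:
  fixes f :: "'a::real_normed_vector \<Rightarrow> 'b::real_normed_vector"
  assumes f: "smooth_on (- {0}) f" and h: "homogeneous j f"
  shows "homogeneous (Suc j) (pd f v)"
  unfolding homogeneous_def
proof (intro allI impI)
  fix l :: real and x :: 'a assume l: "l > 0" and x: "x \<noteq> 0"
  have "iter_deriv [v] (\<lambda>x. f (l *\<^sub>R x + 0)) x = iter_deriv (map (\<lambda>x. l *\<^sub>R x) [v]) f (l *\<^sub>R x + 0)"
    by (rule iter_deriv_affine[OF open_nonzero open_nonzero bounded_linear_scaleR_right f]) (use l x in auto)
  then have "pd (\<lambda>x. f (l *\<^sub>R x)) v x = pd f (l *\<^sub>R v) (l *\<^sub>R x)"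
    by simp
  also have "\<dots> = l *\<^sub>R pd f v (l *\<^sub>R x)"
    by (rule linear_scale[OF linear_frechet_derivative]) (use smooth_on_differentiable[OF f] l x in auto)
  finally have 1: "pd (\<lambda>x. f (l *\<^sub>R x)) v x = l *\<^sub>R pd f v (l *\<^sub>R x)" .
  have "frechet_derivative (\<lambda>x. f (l *\<^sub>R x)) (at x) = frechet_derivative (\<lambda>x. (1 / l) ^ j *\<^sub>R f x) (at x)"
    by (rule frechet_derivative_cong_open[OF open_nonzero]) (use x l homogeneousD[OF h] in auto)
  moreover have "pd (\<lambda>x. (1 / l) ^ j *\<^sub>R f x) v x = (1 / l) ^ j *\<^sub>R pd f v x"
    by (rule frechet_derivative_eqI) (intro has_derivative_scaleR_right smooth_on_has_derivative[OF f], use x in auto)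
  ultimately have "l *\<^sub>R pd f v (l *\<^sub>R x) = (1 / l) ^ j *\<^sub>R pd f v x"
    using 1 by simp
  then have "(1 / l) *\<^sub>R (l *\<^sub>R pd f v (l *\<^sub>R x)) = (1 / l) *\<^sub>R ((1 / l) ^ j *\<^sub>R pd f v x)"
    by simp
  then show "pd f v (l *\<^sub>R x) = (1 / l) ^ Suc j *\<^sub>R pd f v x"
    using l by simp
qed

lemma homogeneous_iter_deriv:
  assumes f: "smooth_on (- {0}) f" and h: "homogeneous j f"
  shows "homogeneous (length vs + j) (iter_deriv vs f)"
proof (induction vs)
  case (Cons v vs)
  then show ?case using homogeneous_frechet_derivative[OF smooth_on_iter_deriv[OF f]] by simp
qed (use h in simp)

lemma homogeneous_bound:
  fixes f :: "'a::euclidean_space \<Rightarrow> 'b::real_normed_vector"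
  assumes f: "continuous_on (- {0}) f" and h: "homogeneous j f"
  obtains C where "C \<ge> 0" "\<And>x. x \<noteq> 0 \<Longrightarrow> norm (f x) \<le> C * nu x ^ j"
proof -
  have "bounded (f ` sphere 0 1)"
    by (intro compact_imp_bounded compact_continuous_image continuous_on_subset[OF f]) auto
  then obtain C where C: "C > 0" "\<And>y. y \<in> sphere 0 1 \<Longrightarrow> norm (f y) \<le> C"
    unfolding bounded_pos by blast
  have "norm (f x) \<le> C * nu x ^ j" if x: "x \<noteq> 0" for x
  proof -
    have "f x = f (norm x *\<^sub>R (x /\<^sub>R norm x))" using x by simp
    also have "\<dots> = (1 / norm x) ^ j *\<^sub>R f (x /\<^sub>R norm x)"
      by (rule homogeneousD[OF h]) (use x in auto)
    finally have "norm (f x) = nu x ^ j * norm (f (x /\<^sub>R norm x))"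
      using x by (simp add: nu_def divide_inverse)
    also have "\<dots> \<le> nu x ^ j * C"
      by (intro mult_left_mono C) (use x nu_pos[OF x] in auto)
    finally show ?thesis by (simp add: mult.commute)
  qed
  then show ?thesis using that[of C] C by simp
qed

text \<open>Euler's relation: \<open>f\<close> behaves like a power with exponent \<open>- j\<close> along each ray, so its radial derivative
at \<open>x\<close> is \<open>- j f x\<close>.\<close>

lemma homogeneous_zero:
  fixes f :: "'a::euclidean_space \<Rightarrow> 'b::euclidean_space"
  assumes f: "smooth_on (- {0}) f" and h: "homogeneous j f" and j: "j > 0" and x: "x \<noteq> 0"
    and z: "\<And>e. e \<in> Basis \<Longrightarrow> pd f e x = 0"
  shows "f x = 0"
proof -
  have lin: "linear (frechet_derivative f (at x))"
    by (rule linear_frechet_derivative) (use smooth_on_differentiable[OF f] x in auto)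
  have "pd f x x = pd f (\<Sum>e\<in>Basis. (x \<bullet> e) *\<^sub>R e) x"
    by (simp add: euclidean_representation)
  also have "\<dots> = 0" using z by (simp add: linear_sum[OF lin] linear_scale[OF lin])
  finally have d0: "pd f x x = 0" .
  have "((\<lambda>\<sigma>. f (x + \<sigma> *\<^sub>R x)) has_vector_derivative pd f x (x + 0 *\<^sub>R x)) (at 0)"
    by (rule line_has_vector_derivative[OF f]) (use x in auto)
  then have "((\<lambda>\<sigma>. f (x + \<sigma> *\<^sub>R x)) has_vector_derivative 0) (at 0)" using d0 by simp
  moreover have "((\<lambda>\<sigma>. f (x + \<sigma> *\<^sub>R x)) has_vector_derivative - (real j *\<^sub>R f x)) (at 0)"
  proof (rule has_vector_derivative_transform_within_open[where S = "{-1<..}" and f = "\<lambda>\<sigma>. (1 / (1 + \<sigma>)) ^ j *\<^sub>R f x"])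
    have "((\<lambda>\<sigma>. (1 / (1 + \<sigma>)) ^ j) has_real_derivative - real j) (at (0::real))"
      by (auto intro!: derivative_eq_intros)
    then show "((\<lambda>\<sigma>. (1 / (1 + \<sigma>)) ^ j *\<^sub>R f x) has_vector_derivative - (real j *\<^sub>R f x)) (at 0)"
      by (auto intro!: derivative_eq_intros)
    show "(1 / (1 + \<sigma>)) ^ j *\<^sub>R f x = f (x + \<sigma> *\<^sub>R x)" if "\<sigma> \<in> {-1<..}" for \<sigma>
      using homogeneousD[OF h, of "1 + \<sigma>" x] that x by (simp add: scaleR_add_left)
  qed auto
  ultimately have "- (real j *\<^sub>R f x) = 0" by (rule vector_derivative_unique_at[symmetric])
  then show ?thesis using j by simp
qed

text \<open>Downward induction on the order: a derivative of order \<open>i > 0\<close> is homogeneous of negative degree, hence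
determined by its own first derivatives.\<close>

lemma all_derivatives_zero:
  fixes f :: "'a::euclidean_space \<Rightarrow> 'b::euclidean_space"
  assumes f: "smooth_on (- {0}) f" and h: "homogeneous 0 f"
    and i: "1 \<le> i" "i \<le> r"
    and z: "\<And>vs x. set vs \<subseteq> Basis \<Longrightarrow> length vs = r \<Longrightarrow> x \<noteq> 0 \<Longrightarrow> iter_deriv vs f x = 0"
  shows "set vs \<subseteq> Basis \<Longrightarrow> length vs = i \<Longrightarrow> x \<noteq> 0 \<Longrightarrow> iter_deriv vs f x = 0"
  using i(2,1)
proof (induction i arbitrary: vs x rule: inc_induct)
  case base
  then show ?case using z by blast
next
  case (step i)
  show ?case
  proof (rule homogeneous_zero[OF smooth_on_iter_deriv[OF f] homogeneous_iter_deriv[OF f h]])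
    fix e :: 'a assume e: "e \<in> Basis"
    have "iter_deriv (e # vs) f x = 0" by (rule step.IH) (use e step.prems in auto)
    then show "pd (iter_deriv vs f) e x = 0" by simp
  qed (use step.prems in auto)
qed

text \<open>Dyadic shells: where \<open>|x|\<close> lies between \<open>2\<^sup>-\<^sup>i\<^sup>-\<^sup>1\<close> and \<open>2\<^sup>-\<^sup>i\<close> the integrand is at most \<open>2\<^sup>(\<^sup>i\<^sup>+\<^sup>1\<^sup>)\<^sup>m\<close>, which the
volume of the ball of radius \<open>2\<^sup>-\<^sup>i\<close> compensates if \<open>m\<close> is less than the dimension.\<close>

lemma nn_integral_nu_power_finite:
  assumes m: "m < DIM('a::euclidean_space)"
  shows "(\<integral>\<^sup>+x\<in>ball 0 1. ennreal (nu (x::'a) ^ m) \<partial>lborel) < \<infinity>"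
proof -
  let ?V = "unit_ball_vol (real DIM('a))" and ?n = "DIM('a)"
  let ?g = "\<lambda>i x. ennreal ((2 ^ Suc i) ^ m) * indicator (ball (0::'a) ((1/2) ^ i)) x"
  have le: "ennreal (nu x ^ m) * indicator (ball 0 1) x \<le> (\<Sum>i. ?g i x)" if x0: "x \<noteq> 0" for x :: 'a
  proof (cases "norm x < 1")
    case True
    have "\<exists>k. (1/2) ^ k \<le> norm x"
      using real_arch_pow_inv[of "norm x" "1/2"] x0 by (auto intro: less_imp_le)
    \<comment> \<open>the shell containing \<open>x\<close>\<close>
    define k where "k = (LEAST k. (1/2::real) ^ k \<le> norm x)"
    have k: "(1/2) ^ k \<le> norm x"
      unfolding k_def by (rule LeastI_ex) fact
    have "k \<noteq> 0" using True k by (intro notI) simp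
    then obtain i where i: "k = Suc i" by (cases k) auto
    have "\<not> (1/2) ^ i \<le> norm x"
      using not_less_Least[of i "\<lambda>k. (1/2::real) ^ k \<le> norm x"] i by (simp add: k_def)
    then have mem: "x \<in> ball 0 ((1/2) ^ i)" by simp
    have "nu x \<le> inverse ((1/2) ^ Suc i)"
      unfolding nu_def using k i by (intro le_imp_inverse_le) auto
    also have "inverse ((1/2::real) ^ Suc i) = 2 ^ Suc i" by (simp add: power_one_over)
    finally have "nu x ^ m \<le> (2 ^ Suc i) ^ m" using nu_pos[OF x0] by (intro power_mono) auto
    then have "ennreal (nu x ^ m) * indicator (ball 0 1) x \<le> ?g i x"
      using True mem by (auto intro: ennreal_leI)
    also have "\<dots> = (\<Sum>j\<in>{i}. ?g j x)"
      by (simp only: sum.insert[OF finite.emptyI] empty_iff not_False_eq_True sum.empty add_0_right)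
    also have "\<dots> \<le> (\<Sum>i. ?g i x)" by (rule sum_le_suminf) auto
    finally show ?thesis .
  qed auto
  have "(\<integral>\<^sup>+x\<in>ball 0 1. ennreal (nu (x::'a) ^ m) \<partial>lborel) \<le> (\<integral>\<^sup>+x. (\<Sum>i. ?g i x) \<partial>lborel)"
  proof (rule nn_integral_mono_AE)
    have "AE x in lborel. x \<noteq> (0::'a)" by (rule AE_lborel_singleton)
    then show "AE x in lborel. ennreal (nu x ^ m) * indicator (ball 0 1) x \<le> (\<Sum>i. ?g i x)"
      by eventually_elim (rule le)
  qed
  also have "\<dots> = (\<Sum>i. \<integral>\<^sup>+x. ?g i x \<partial>lborel)"
  proof (rule nn_integral_suminf)
    show "?g i \<in> borel_measurable lborel" for i
      by (intro borel_measurable_times_ennreal borel_measurable_const borel_measurable_indicator) simp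
  qed
  also have "\<dots> = (\<Sum>i. ennreal (?V * 2 ^ m * ((1/2) ^ (?n - m)) ^ i))"
  proof (rule suminf_cong)
    fix i
    have "(\<integral>\<^sup>+x. ?g i x \<partial>lborel) = ennreal ((2 ^ Suc i) ^ m) * emeasure lborel (ball (0::'a) ((1/2) ^ i))"
      by (rule nn_integral_cmult_indicator) simp
    also have "\<dots> = ennreal ((2 ^ Suc i) ^ m * (?V * ((1/2) ^ i) ^ ?n))"
      by (subst emeasure_ball) (auto simp: ennreal_mult)
    also have "(2 ^ Suc i) ^ m * (?V * ((1/2) ^ i) ^ ?n) = ?V * 2 ^ m * ((1/2) ^ (?n - m)) ^ i"
    proof -
      have "((1/2::real) ^ i) ^ ?n = ((1/2) ^ i) ^ (m + (?n - m))" using m by simp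
      also have "\<dots> = ((1/2) ^ i) ^ m * ((1/2) ^ i) ^ (?n - m)" by (rule power_add)
      also have "((1/2::real) ^ i) ^ (?n - m) = ((1/2) ^ (?n - m)) ^ i"
        by (simp only: power_mult[symmetric] mult.commute)
      finally have A: "((1/2::real) ^ i) ^ ?n = ((1/2) ^ i) ^ m * ((1/2) ^ (?n - m)) ^ i" .
      have "(2::real) ^ Suc i * (1/2) ^ i = 2" by (simp add: power_one_over)
      then have B: "((2::real) ^ Suc i) ^ m * ((1/2) ^ i) ^ m = 2 ^ m"
        by (metis power_mult_distrib)
      have "(2 ^ Suc i) ^ m * (?V * (((1/2) ^ i) ^ m * ((1/2) ^ (?n - m)) ^ i))
         = ?V * ((2 ^ Suc i) ^ m * ((1/2) ^ i) ^ m) * ((1/2) ^ (?n - m)) ^ i"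
        by (simp only: mult.assoc mult.left_commute[of _ ?V])
      then show ?thesis by (simp only: A B)
    qed
    finally show "(\<integral>\<^sup>+x. ?g i x \<partial>lborel) = ennreal (?V * 2 ^ m * ((1/2) ^ (?n - m)) ^ i)" .
  qed
  also have "\<dots> < \<infinity>"
  proof -
    have "summable (\<lambda>i. ?V * 2 ^ m * ((1/2) ^ (?n - m)) ^ i)"
      using m by (intro summable_mult summable_geometric) (simp add: power_less_one_iff)
    then show ?thesis
      by (subst suminf_ennreal2) auto
  qed
  finally show ?thesis .
qed

lemma set_integrable_nu_power:
  assumes m: "m < DIM('a::euclidean_space)"
  shows "set_integrable lebesgue punctured_ball (\<lambda>x::'a. nu x ^ m)"
proof -
  have meas: "(\<lambda>x::'a. indicator punctured_ball x *\<^sub>R nu x ^ m) \<in> borel_measurable borel"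
    unfolding nu_def
    by (intro borel_measurable_scaleR borel_measurable_indicator borel_open open_punctured_ball) measurable
  have "integrable lborel (\<lambda>x::'a. indicator punctured_ball x *\<^sub>R nu x ^ m)"
  proof (rule integrableI_bounded)
    show "(\<lambda>x::'a. indicator punctured_ball x *\<^sub>R nu x ^ m) \<in> borel_measurable lborel"
      using meas by simp
    have "(\<integral>\<^sup>+x. ennreal (norm (indicator punctured_ball x *\<^sub>R nu (x::'a) ^ m)) \<partial>lborel)
       \<le> (\<integral>\<^sup>+x\<in>ball 0 1. ennreal (nu (x::'a) ^ m) \<partial>lborel)"
      by (intro nn_integral_mono) (auto simp: indicator_def nu_def)
    also note nn_integral_nu_power_finite[OF m]
    finally show "(\<integral>\<^sup>+x. ennreal (norm (indicator punctured_ball x *\<^sub>R nu (x::'a) ^ m)) \<partial>lborel) < \<infinity>" .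
  qed
  then show ?thesis
    unfolding set_integrable_def using meas by (subst integrable_completion) auto
qed

lemma set_borel_measurable_punctured:
  fixes h :: "'a::euclidean_space \<Rightarrow> 'b::euclidean_space"
  assumes "continuous_on punctured_ball h"
  shows "set_borel_measurable lebesgue punctured_ball h"
proof -
  have "(\<lambda>x. indicator punctured_ball x *\<^sub>R h x) \<in> borel_measurable lborel"
    unfolding measurable_lborel2
    by (rule borel_measurable_continuous_on_indicator[OF borel_open[OF open_punctured_ball] assms])
  then show ?thesis unfolding set_borel_measurable_def by (rule measurable_completion)
qed

lemma set_integrable_punctured:
  fixes h :: "'a::euclidean_space \<Rightarrow> 'b::euclidean_space"
  assumes "continuous_on punctured_ball h" "m < DIM('a)"
    and "\<And>x. x \<in> punctured_ball \<Longrightarrow> norm (h x) \<le> C * nu x ^ m"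
  shows "set_integrable lebesgue punctured_ball h"
  unfolding set_integrable_def
proof (rule Bochner_Integration.integrable_bound)
  show "integrable lebesgue (\<lambda>x::'a. indicator punctured_ball x *\<^sub>R (C * nu x ^ m))"
    using set_integrable_nu_power[OF assms(2)] unfolding set_integrable_def
    by (simp add: mult.left_commute[of _ C])
  show "(\<lambda>x. indicator punctured_ball x *\<^sub>R h x) \<in> borel_measurable lebesgue"
    using set_borel_measurable_punctured[OF assms(1)] by (simp add: set_borel_measurable_def)
  show "AE x in lebesgue. norm (indicator punctured_ball x *\<^sub>R h x) \<le> norm (indicator punctured_ball x *\<^sub>R (C * nu x ^ m))"
    using assms(3) by (intro AE_I2) (auto simp: indicator_def intro: order_trans[OF _ abs_ge_self])
qed

text \<open>The centre is a null set. This disposes of the values at 0 of derivatives, which are not controlled.\<close>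

lemma ball_eq_punctured_ball:
  fixes h :: "'a::euclidean_space \<Rightarrow> 'b::euclidean_space"
  assumes "set_borel_measurable lebesgue punctured_ball h"
  shows "set_borel_measurable lebesgue (ball 0 1) h"
    "(LINT x:ball 0 1|lebesgue. h x) = (LINT x:punctured_ball|lebesgue. h x)"
    "set_integrable lebesgue (ball 0 1) h \<longleftrightarrow> set_integrable lebesgue punctured_ball h"
proof -
  have eq: "(\<lambda>x. indicator (ball 0 1) x *\<^sub>R h x) = (\<lambda>x. indicator punctured_ball x *\<^sub>R h x + indicator {0} x *\<^sub>R h 0)"
    by (auto simp: indicator_def fun_eq_iff)
  have m: "(\<lambda>x. indicator punctured_ball x *\<^sub>R h x) \<in> borel_measurable lebesgue"
    using assms by (simp add: set_borel_measurable_def)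
  have s: "(\<lambda>x::'a. indicator {0} x *\<^sub>R h 0) \<in> borel_measurable lebesgue"
    by (intro measurable_completion borel_measurable_scaleR borel_measurable_indicator) auto
  show m': "set_borel_measurable lebesgue (ball 0 1) h"
    unfolding set_borel_measurable_def eq using m s by (rule borel_measurable_add)
  have "AE x in lborel. x \<noteq> (0::'a)" by (rule AE_lborel_singleton)
  then have ae: "AE x in lebesgue. x \<noteq> (0::'a)" by (rule AE_completion)
  have ae': "AE x in lebesgue. indicator (ball 0 1) x *\<^sub>R h x = indicator punctured_ball x *\<^sub>R h x"
    using ae by eventually_elim (simp add: indicator_def)
  show "(LINT x:ball 0 1|lebesgue. h x) = (LINT x:punctured_ball|lebesgue. h x)"
    unfolding set_lebesgue_integral_def
    by (rule integral_cong_AE[OF m'[unfolded set_borel_measurable_def] m ae'])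
  show "set_integrable lebesgue (ball 0 1) h \<longleftrightarrow> set_integrable lebesgue punctured_ball h"
    unfolding set_integrable_def
    by (rule integrable_cong_AE[OF m'[unfolded set_borel_measurable_def] m ae'])
qed

section \<open>Sobolev regularity in high dimension\<close>

text \<open>Zero near the origin, with pointwise limit 1 elsewhere as \<open>k\<close> tends to infinity.\<close>

definition cutoff :: "nat \<Rightarrow> 'a::euclidean_space \<Rightarrow> real" where
  "cutoff k x = flat_exp 1 ((real k + 1)\<^sup>2 * (x \<bullet> x) - 1)"

lemma smooth_cutoff: "smooth_on UNIV (cutoff k)"
  unfolding cutoff_def[abs_def]
  by (intro smooth_on_flat_exp smooth_on_diff smooth_on_mult smooth_on_inner smooth_on_const smooth_on_id open_UNIV)

lemma cutoff_zero: "norm x < 1 / (real k + 1) \<Longrightarrow> cutoff k x = 0"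
proof -
  assume "norm x < 1 / (real k + 1)"
  then have "(real k + 1) * norm x \<le> 1" by (simp add: field_simps)
  then have "((real k + 1) * norm x)\<^sup>2 \<le> 1" by (simp add: power_le_one)
  then show ?thesis
    unfolding cutoff_def by (intro flat_exp_nonpos) (simp add: power_mult_distrib power2_norm_eq_inner)
qed

lemma cutoff_bounds: "0 \<le> cutoff k x" "cutoff k x \<le> 1"
  by (auto simp: cutoff_def flat_exp_def)

lemma cutoff_derivative:
  "pd (cutoff k) v x
    = flat_exp [:0, 0, 1:] ((real k + 1)\<^sup>2 * (x \<bullet> x) - 1) * (2 * (real k + 1)\<^sup>2 * (x \<bullet> v))"
proof -
  have 1: "((\<lambda>x. (real k + 1)\<^sup>2 * (x \<bullet> x) - 1) has_derivative (\<lambda>v. 2 * (real k + 1)\<^sup>2 * (x \<bullet> v))) (at x)"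
    by (auto intro!: derivative_eq_intros simp: fun_eq_iff inner_commute)
  have 2: "(flat_exp 1 has_derivative (\<lambda>v. flat_exp [:0, 0, 1:] y * v)) (at y)" for y
    using flat_exp_has_derivative[of 1 y] by (simp add: has_field_derivative_def pderiv_1)
  show ?thesis
    unfolding cutoff_def[abs_def] by (rule frechet_derivative_eqI[OF has_derivative_compose[OF 1 2]])
qed

text \<open>With \<open>u = 1 / y\<close> the expression is \<open>(u + u\<^sup>2) exp (- u)\<close>. The bound makes the gradient of the cutoff
functions at most a constant times \<open>1 / |x|\<close>, uniformly in \<open>k\<close>.\<close>

lemma flat_exp_square_bound: "0 \<le> flat_exp [:0, 0, 1:] y * (y + 1)" "flat_exp [:0, 0, 1:] y * (y + 1) \<le> 2"
proof -
  have "0 \<le> flat_exp [:0, 0, 1:] y * (y + 1) \<and> flat_exp [:0, 0, 1:] y * (y + 1) \<le> 2"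
  proof (cases "y > 0")
    case True
    define u where "u = 1 / y"
    have u: "u > 0" "u * y = 1" using True by (auto simp: u_def)
    have "flat_exp [:0, 0, 1:] y = u * u * exp (- u)" using True by (simp add: flat_exp_def u_def)
    moreover have "u * u * exp (- u) * (y + 1) = (u * (u * y) + u * u) * exp (- u)" by (simp add: algebra_simps)
    ultimately have eq: "flat_exp [:0, 0, 1:] y * (y + 1) = (u + u\<^sup>2) * exp (- u)"
      by (simp add: u power2_eq_square)
    have "1 + u + u\<^sup>2 / 2 \<le> exp u" using u by (intro exp_lower_Taylor_quadratic) simp
    then have "u + u\<^sup>2 \<le> 2 * exp u" using u by linarith
    then have "(u + u\<^sup>2) * exp (- u) \<le> 2 * exp u * exp (- u)" by (intro mult_right_mono) auto
    moreover have "2 * exp u * exp (- u) = 2" by (simp add: exp_minus)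
    ultimately show ?thesis using u unfolding eq by simp
  qed (simp add: flat_exp_def)
  then show "0 \<le> flat_exp [:0, 0, 1:] y * (y + 1)" "flat_exp [:0, 0, 1:] y * (y + 1) \<le> 2" by auto
qed

lemma cutoff_derivative_alt:
  assumes "x \<noteq> 0"
  shows "pd (cutoff k) v x
    = (flat_exp [:0, 0, 1:] ((real k + 1)\<^sup>2 * (x \<bullet> x) - 1) * (((real k + 1)\<^sup>2 * (x \<bullet> x) - 1) + 1)) * (2 * (nu x)\<^sup>2 * (x \<bullet> v))"
proof -
  have "(real k + 1)\<^sup>2 * (x \<bullet> x) * (nu x)\<^sup>2 = (real k + 1)\<^sup>2"
    using nu_sq[OF assms] by (simp add: mult.assoc mult.commute)
  then show ?thesis unfolding cutoff_derivative by (simp add: algebra_simps)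
qed

lemma cutoff_derivative_bound:
  assumes x: "x \<noteq> 0"
  shows "\<bar>pd (cutoff k) v x\<bar> \<le> 4 * norm v * nu x"
proof -
  let ?E = "flat_exp [:0, 0, 1:] ((real k + 1)\<^sup>2 * (x \<bullet> x) - 1) * (((real k + 1)\<^sup>2 * (x \<bullet> x) - 1) + 1)"
  have "\<bar>pd (cutoff k) v x\<bar> = ?E * (2 * (nu x)\<^sup>2 * \<bar>x \<bullet> v\<bar>)"
    unfolding cutoff_derivative_alt[OF x]
    by (subst abs_mult, subst abs_of_nonneg[OF flat_exp_square_bound(1)]) (simp add: abs_mult)
  also have "\<dots> \<le> 2 * (2 * (nu x)\<^sup>2 * (norm x * norm v))"
    by (intro mult_mono flat_exp_square_bound Cauchy_Schwarz_ineq2) auto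
  also have "\<dots> = 4 * norm v * nu x"
    using x by (simp add: nu_def power2_eq_square)
  finally show ?thesis .
qed

lemma flat_exp_at_top:
  "(flat_exp 1 \<longlongrightarrow> 1) at_top" "((\<lambda>y. flat_exp [:0, 0, 1:] y * (y + 1)) \<longlongrightarrow> 0) at_top"
proof -
  have inv: "((\<lambda>y::real. 1 / y) \<longlongrightarrow> 0) at_top"
    using tendsto_inverse_0_at_top[OF filterlim_ident] by (simp add: divide_inverse)
  have "((\<lambda>y::real. exp (- (1 / y))) \<longlongrightarrow> exp (- 0)) at_top"
    by (intro tendsto_intros inv)
  then have e: "((\<lambda>y::real. exp (- (1 / y))) \<longlongrightarrow> 1) at_top" by simp
  show "(flat_exp 1 \<longlongrightarrow> 1) at_top"
    by (rule Lim_transform_eventually[OF e]) (auto intro!: eventually_mono[OF eventually_gt_at_top[of 0]] simp: flat_exp_def)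
  have "((\<lambda>y::real. (1 / y + 1 / y * (1 / y)) * exp (- (1 / y))) \<longlongrightarrow> (0 + 0 * 0) * 1) at_top"
    by (intro tendsto_intros inv e)
  then have e2: "((\<lambda>y::real. (1 / y + 1 / y * (1 / y)) * exp (- (1 / y))) \<longlongrightarrow> 0) at_top" by simp
  show "((\<lambda>y. flat_exp [:0, 0, 1:] y * (y + 1)) \<longlongrightarrow> 0) at_top"
    by (rule Lim_transform_eventually[OF e2])
      (auto intro!: eventually_mono[OF eventually_gt_at_top[of 0]] simp: flat_exp_def field_simps)
qed

lemma cutoff_argument_at_top:
  assumes "x \<noteq> (0::'a::euclidean_space)"
  shows "filterlim (\<lambda>k. (real k + 1)\<^sup>2 * (x \<bullet> x) - 1) at_top sequentially"
proof (rule filterlim_at_top_mono)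
  have "filterlim (\<lambda>k. - 1 + (x \<bullet> x) * real k) at_top sequentially"
    by (intro filterlim_tendsto_add_at_top[OF tendsto_const]
        filterlim_tendsto_pos_mult_at_top[OF tendsto_const _ filterlim_real_sequentially]) (use assms in auto)
  then show "filterlim (\<lambda>k. - 1 + (x \<bullet> x) * real k) at_top sequentially" .
  have "- 1 + (x \<bullet> x) * real k \<le> (real k + 1)\<^sup>2 * (x \<bullet> x) - 1" for k
  proof -
    have "real k \<le> (real k + 1)\<^sup>2" by (simp add: power2_eq_square algebra_simps)
    from mult_right_mono[OF this inner_ge_zero[of x]] show ?thesis by (simp add: mult.commute)
  qed
  then show "\<forall>\<^sub>F k in sequentially. - 1 + (x \<bullet> x) * real k \<le> (real k + 1)\<^sup>2 * (x \<bullet> x) - 1"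
    by (rule always_eventually[OF allI])
qed

lemma cutoff_tendsto:
  assumes "x \<noteq> 0"
  shows "(\<lambda>k. cutoff k x) \<longlonglongrightarrow> 1" "(\<lambda>k. pd (cutoff k) v x) \<longlonglongrightarrow> 0"
proof -
  show "(\<lambda>k. cutoff k x) \<longlonglongrightarrow> 1"
    unfolding cutoff_def by (rule filterlim_compose[OF flat_exp_at_top(1) cutoff_argument_at_top[OF assms]])
  have "(\<lambda>k. (flat_exp [:0, 0, 1:] ((real k + 1)\<^sup>2 * (x \<bullet> x) - 1) * (((real k + 1)\<^sup>2 * (x \<bullet> x) - 1) + 1))
      * (2 * (nu x)\<^sup>2 * (x \<bullet> v))) \<longlonglongrightarrow> 0 * (2 * (nu x)\<^sup>2 * (x \<bullet> v))"
    by (intro tendsto_mult tendsto_const filterlim_compose[OF flat_exp_at_top(2) cutoff_argument_at_top[OF assms]])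
  then show "(\<lambda>k. pd (cutoff k) v x) \<longlonglongrightarrow> 0"
    unfolding cutoff_derivative_alt[OF assms] by simp
qed

lemma frechet_derivative_mult:
  fixes f g :: "'a::real_normed_vector \<Rightarrow> real"
  assumes "f differentiable (at x)" "g differentiable (at x)"
  shows "pd (\<lambda>y. f y * g y) v x
     = f x * pd g v x + pd f v x * g x"
  by (rule frechet_derivative_eqI) (intro has_derivative_mult assms[unfolded frechet_derivative_works])

lemma nu_ge_1: "x \<in> punctured_ball \<Longrightarrow> nu x \<ge> 1"
  by (auto simp: nu_def intro!: one_le_inverse)

text \<open>Integrate by parts for the product with a cutoff function, which vanishes near the origin, and remove
the cutoff. The term with its gradient is dominated by a multiple of \<open>|x|\<^sup>-\<^sup>j\<^sup>-\<^sup>1\<close>, which is integrable,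
and tends to 0 pointwise.\<close>

lemma singular_integration_by_parts:
  fixes q \<psi> :: "'a::euclidean_space \<Rightarrow> real"
  assumes q: "smooth_on (- {0}) q" and C: "C \<ge> 0" "\<And>x. x \<noteq> 0 \<Longrightarrow> \<bar>q x\<bar> \<le> C * nu x ^ j"
      "\<And>x. x \<noteq> 0 \<Longrightarrow> \<bar>pd q v x\<bar> \<le> C * nu x ^ Suc j"
    and j: "Suc j < DIM('a)"
    and \<psi>: "smooth_on UNIV \<psi>" and K: "compact K" "K \<subseteq> ball 0 1" "\<And>x. x \<notin> K \<Longrightarrow> \<psi> x = 0"
  shows "(LINT x:punctured_ball|lebesgue. pd \<psi> v x * q x)
       = - (LINT x:punctured_ball|lebesgue. \<psi> x * pd q v x)"
proof -
  let ?d\<psi> = "\<lambda>x. pd \<psi> v x" and ?dq = "\<lambda>x. pd q v x"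
  have d\<psi>: "smooth_on UNIV ?d\<psi>" and dq: "smooth_on (- {0}) ?dq"
    using \<psi> q by (auto intro: smooth_on_frechet_derivative)
  have cont: "continuous_on punctured_ball g" if "smooth_on UNIV g \<or> smooth_on (- {0}) g" for g :: "'a \<Rightarrow> real"
    using that by (elim disjE; intro continuous_on_subset[OF smooth_on_continuous_on]) auto
  have "bounded (\<psi> ` cball 0 1)" "bounded (?d\<psi> ` cball 0 1)"
    by (intro compact_imp_bounded compact_continuous_image compact_cball
        continuous_on_subset[OF smooth_on_continuous_on[OF \<psi>] subset_UNIV]
        continuous_on_subset[OF smooth_on_continuous_on[OF d\<psi>] subset_UNIV])+
  then obtain M1 M2 where M12: "\<And>x. x \<in> cball 0 1 \<Longrightarrow> \<bar>\<psi> x\<bar> \<le> M1" "\<And>x. x \<in> cball 0 1 \<Longrightarrow> \<bar>?d\<psi> x\<bar> \<le> M2"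
    unfolding bounded_iff by force
  define M where "M = max M1 M2"
  have M: "\<bar>\<psi> x\<bar> \<le> M" "\<bar>?d\<psi> x\<bar> \<le> M" if "x \<in> punctured_ball" for x
    using M12[of x] that by (auto simp: M_def)
  have M0: "M \<ge> 0" using M12(1)[of 0] by (simp add: M_def)
  have qb: "\<bar>q x\<bar> \<le> C * nu x ^ Suc j" if "x \<in> punctured_ball" for x
  proof -
    have "nu x ^ j \<le> nu x ^ Suc j" using nu_ge_1[OF that] by (intro power_increasing) auto
    then have "C * nu x ^ j \<le> C * nu x ^ Suc j" using C(1) by (rule mult_left_mono)
    then show ?thesis using C(2)[of x] that by force
  qed
  have b1: "\<bar>?d\<psi> x * q x\<bar> \<le> M * C * nu x ^ Suc j" if "x \<in> punctured_ball" for x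
    unfolding abs_mult mult.assoc using M[OF that] qb[OF that] M0 by (intro mult_mono) auto
  have b2: "\<bar>\<psi> x * ?dq x\<bar> \<le> M * C * nu x ^ Suc j" if "x \<in> punctured_ball" for x
    unfolding abs_mult mult.assoc using M[OF that] C(3)[of x] that M0 by (intro mult_mono) auto
  have i1: "set_integrable lebesgue punctured_ball (\<lambda>x. ?d\<psi> x * q x)"
    by (rule set_integrable_punctured[OF _ j]) (use b1 cont d\<psi> q in \<open>auto intro!: continuous_on_mult\<close>)
  have i2: "set_integrable lebesgue punctured_ball (\<lambda>x. \<psi> x * ?dq x)"
    by (rule set_integrable_punctured[OF _ j]) (use b2 cont \<psi> dq in \<open>auto intro!: continuous_on_mult\<close>)
  define h where "h = (\<lambda>k x. cutoff k x * (\<psi> x * q x))"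
  have sn: "smooth_on UNIV g \<Longrightarrow> smooth_on (- {0}) g" for g :: "'a \<Rightarrow> real"
    by (rule smooth_on_subset) auto
  have sh: "smooth_on (- {0}) (h k)" for k
    unfolding h_def by (intro smooth_on_mult open_nonzero sn smooth_cutoff \<psi> q)
  have dh: "pd (h k) v x
     = cutoff k x * (?d\<psi> x * q x + \<psi> x * ?dq x) + pd (cutoff k) v x * (\<psi> x * q x)"
    if "x \<noteq> 0" for x k
  proof -
    have "\<psi> differentiable (at x)" "q differentiable (at x)" "cutoff k differentiable (at x)"
      using smooth_on_differentiable[OF \<psi>] smooth_on_differentiable[OF q] smooth_on_differentiable[OF smooth_cutoff] that by auto
    then show ?thesis unfolding h_def by (simp add: frechet_derivative_mult add.commute)
  qed
  have zero: "(LINT x:punctured_ball|lebesgue. pd (h k) v x) = 0" for k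
  proof -
    let ?K = "K \<inter> {x. 1 / (real k + 1) \<le> norm x}"
    have K': "compact ?K" by (intro compact_Int_closed K closed_Collect_le continuous_intros)
    have K0: "?K \<subseteq> - {0}" by auto
    have off: "h k x = 0" if "x \<in> - {0} - ?K" for x
      using that K(3) cutoff_zero[of x k] by (auto simp: h_def not_le)
    have "(LINT x:?K|lebesgue. pd (h k) v x) = 0"
      by (rule integral_derivative_supported[OF open_nonzero K' K0 sh off])
    moreover have "pd (h k) v x = 0" if "x \<in> - {0} - ?K" for x
      by (rule frechet_derivative_zero_open[OF _ that off]) (intro open_Diff open_nonzero compact_imp_closed K')
    then have "(LINT x:punctured_ball|lebesgue. pd (h k) v x) = (LINT x:?K|lebesgue. pd (h k) v x)"
      unfolding set_lebesgue_integral_def using K(2) K0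
      by (intro Bochner_Integration.integral_cong) (auto simp: indicator_def)
    ultimately show ?thesis by simp
  qed
  have "(\<lambda>k. LINT x:punctured_ball|lebesgue. pd (h k) v x)
     \<longlonglongrightarrow> (LINT x:punctured_ball|lebesgue. ?d\<psi> x * q x + \<psi> x * ?dq x)"
    unfolding set_lebesgue_integral_def
  proof (rule integral_dominated_convergence[where w = "\<lambda>x. indicator punctured_ball x *\<^sub>R ((2 + 4 * norm v) * M * C * nu x ^ Suc j)"])
    show "(\<lambda>x. indicator punctured_ball x *\<^sub>R (?d\<psi> x * q x + \<psi> x * ?dq x)) \<in> borel_measurable lebesgue"
      using set_integral_add(1)[OF i1 i2] by (simp add: set_integrable_def)
    show "(\<lambda>x. indicator punctured_ball x *\<^sub>R pd (h k) v x) \<in> borel_measurable lebesgue" for k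
      using set_borel_measurable_punctured[OF cont, OF disjI2, OF smooth_on_frechet_derivative[OF sh]]
      by (simp add: set_borel_measurable_def)
    show "integrable lebesgue (\<lambda>x::'a. indicator punctured_ball x *\<^sub>R ((2 + 4 * norm v) * M * C * nu x ^ Suc j))"
      using set_integrable_mult_right[OF set_integrable_nu_power[OF j], of "(2 + 4 * norm v) * M * C"]
      by (simp add: set_integrable_def)
    show "AE x in lebesgue. (\<lambda>k. indicator punctured_ball x *\<^sub>R pd (h k) v x)
       \<longlonglongrightarrow> indicator punctured_ball x *\<^sub>R (?d\<psi> x * q x + \<psi> x * ?dq x)"
    proof (intro AE_I2)
      fix x :: 'a
      show "(\<lambda>k. indicator punctured_ball x *\<^sub>R pd (h k) v x)
       \<longlonglongrightarrow> indicator punctured_ball x *\<^sub>R (?d\<psi> x * q x + \<psi> x * ?dq x)"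
      proof (cases "x \<in> punctured_ball")
        case True
        then have x: "x \<noteq> 0" by simp
        have "(\<lambda>k. cutoff k x * (?d\<psi> x * q x + \<psi> x * ?dq x) + pd (cutoff k) v x * (\<psi> x * q x))
          \<longlonglongrightarrow> 1 * (?d\<psi> x * q x + \<psi> x * ?dq x) + 0 * (\<psi> x * q x)"
          by (intro tendsto_intros cutoff_tendsto x)
        then show ?thesis using True by (simp add: dh[OF x])
      qed auto
    qed
    show "AE x in lebesgue. norm (indicator punctured_ball x *\<^sub>R pd (h k) v x)
       \<le> indicator punctured_ball x *\<^sub>R ((2 + 4 * norm v) * M * C * nu x ^ Suc j)" for k
    proof (intro AE_I2)
      fix x :: 'a
      show "norm (indicator punctured_ball x *\<^sub>R pd (h k) v x)
       \<le> indicator punctured_ball x *\<^sub>R ((2 + 4 * norm v) * M * C * nu x ^ Suc j)"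
      proof (cases "x \<in> punctured_ball")
        case True
        then have x: "x \<noteq> 0" by simp
        let ?B = "M * C * nu x ^ Suc j"
        have "\<bar>?d\<psi> x * q x + \<psi> x * ?dq x\<bar> \<le> ?B + ?B"
          by (intro order_trans[OF abs_triangle_ineq] add_mono b1 b2 True)
        then have "\<bar>cutoff k x\<bar> * \<bar>?d\<psi> x * q x + \<psi> x * ?dq x\<bar> \<le> 1 * (?B + ?B)"
          using cutoff_bounds[of k x] by (intro mult_mono) simp_all
        then have "\<bar>cutoff k x * (?d\<psi> x * q x + \<psi> x * ?dq x)\<bar> \<le> 1 * (?B + ?B)"
          by (simp only: abs_mult)
        moreover have "\<bar>pd (cutoff k) v x * (\<psi> x * q x)\<bar> \<le> (4 * norm v * nu x) * (M * (C * nu x ^ j))"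
          unfolding abs_mult using cutoff_derivative_bound[OF x, of k v] M[OF True] C(2)[OF x] M0 nu_pos[OF x]
          by (intro mult_mono) auto
        moreover have "(4 * norm v * nu x) * (M * (C * nu x ^ j)) = 4 * norm v * ?B" by (simp add: mult_ac)
        ultimately have "\<bar>pd (h k) v x\<bar> \<le> 1 * (?B + ?B) + 4 * norm v * ?B"
          unfolding dh[OF x] by linarith
        also have "\<dots> = (2 + 4 * norm v) * M * C * nu x ^ Suc j" by (simp add: algebra_simps)
        finally show ?thesis using True by simp
      qed auto
    qed
  qed
  then have "(LINT x:punctured_ball|lebesgue. ?d\<psi> x * q x + \<psi> x * ?dq x) = 0"
    unfolding zero by (simp add: LIMSEQ_const_iff)
  then show ?thesis by (simp add: set_integral_add(2)[OF i1 i2])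
qed

lemma smooth_on_nonzero_punctured: "smooth_on (- {0}) f \<Longrightarrow> continuous_on punctured_ball f"
  by (rule continuous_on_subset[OF smooth_on_continuous_on]) auto

lemma iter_deriv_zero_off:
  assumes "closed K" "\<And>x. x \<notin> K \<Longrightarrow> \<psi> x = 0" "x \<notin> K"
  shows "iter_deriv vs \<psi> x = 0"
proof -
  have "iter_deriv vs \<psi> x = iter_deriv vs (\<lambda>_. 0) x"
    by (rule iter_deriv_cong_open[of "- K"]) (use assms in auto)
  then show ?thesis by (cases "vs = []") (simp_all add: iter_deriv_const)
qed

lemma iterated_singular_integration_by_parts:
  fixes q \<psi> :: "'a::euclidean_space \<Rightarrow> real"
  assumes q: "smooth_on (- {0}) q" and h: "homogeneous 0 q"
    and \<psi>: "smooth_on UNIV \<psi>" and K: "compact K" "K \<subseteq> ball 0 1" "\<And>x. x \<notin> K \<Longrightarrow> \<psi> x = 0"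
  shows "length vs + length ws < DIM('a) \<Longrightarrow>
    (LINT x:punctured_ball|lebesgue. iter_deriv vs \<psi> x * iter_deriv ws q x)
     = (- 1) ^ length vs * (LINT x:punctured_ball|lebesgue. \<psi> x * iter_deriv (rev vs @ ws) q x)"
proof (induction vs arbitrary: ws)
  case (Cons v vs)
  note sw = smooth_on_iter_deriv[OF q, of ws]
  have hw: "homogeneous (length ws) (iter_deriv ws q)" using homogeneous_iter_deriv[OF q h] by simp
  obtain C1 where C1: "C1 \<ge> 0" "\<And>x. x \<noteq> 0 \<Longrightarrow> norm (iter_deriv ws q x) \<le> C1 * nu x ^ length ws"
    using homogeneous_bound[OF smooth_on_continuous_on[OF sw] hw] by blast
  obtain C2 where C2: "C2 \<ge> 0" "\<And>x. x \<noteq> 0 \<Longrightarrow> norm (pd (iter_deriv ws q) v x) \<le> C2 * nu x ^ Suc (length ws)"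
    using homogeneous_bound[OF smooth_on_continuous_on[OF smooth_on_frechet_derivative[OF sw]]
        homogeneous_frechet_derivative[OF sw hw]] by blast
  let ?C = "max C1 C2"
  have "(LINT x:punctured_ball|lebesgue. pd (iter_deriv vs \<psi>) v x * iter_deriv ws q x)
     = - (LINT x:punctured_ball|lebesgue. iter_deriv vs \<psi> x * pd (iter_deriv ws q) v x)"
  proof (rule singular_integration_by_parts[OF sw, of ?C "length ws"])
    fix x :: 'a assume x: "x \<noteq> 0"
    have "C1 * nu x ^ length ws \<le> ?C * nu x ^ length ws" "C2 * nu x ^ Suc (length ws) \<le> ?C * nu x ^ Suc (length ws)"
      using nu_pos[OF x] by (intro mult_right_mono; simp)+
    then show "\<bar>iter_deriv ws q x\<bar> \<le> ?C * nu x ^ length ws"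
      "\<bar>pd (iter_deriv ws q) v x\<bar> \<le> ?C * nu x ^ Suc (length ws)"
      using C1(2)[OF x] C2(2)[OF x] by (auto simp only: real_norm_def)
  qed (use C1(1) Cons.prems \<psi> K in \<open>auto intro: smooth_on_iter_deriv iter_deriv_zero_off compact_imp_closed\<close>)
  then show ?case using Cons.IH[of "v # ws"] Cons.prems by simp
qed simp

lemma iter_deriv_inner:
  assumes V: "open V" and f: "smooth_on V f" and x: "x \<in> V"
  shows "iter_deriv vs (\<lambda>y. f y \<bullet> b) x = iter_deriv vs f x \<bullet> b"
  using x
proof (induction vs arbitrary: x)
  case (Cons v vs)
  have "frechet_derivative (iter_deriv vs (\<lambda>y. f y \<bullet> b)) (at x) = frechet_derivative (\<lambda>y. iter_deriv vs f y \<bullet> b) (at x)"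
    by (rule frechet_derivative_cong_open[OF V Cons.prems Cons.IH])
  then show ?case
    by (simp add: frechet_derivative_inner_const smooth_on_differentiable[OF smooth_on_iter_deriv[OF f] Cons.prems])
qed simp

lemma set_integral_inner:
  fixes f :: "'a \<Rightarrow> 'b::euclidean_space"
  assumes "set_integrable M A f"
  shows "(LINT x:A|M. f x) \<bullet> b = (LINT x:A|M. f x \<bullet> b)"
  using integral_inner_left[of b M "\<lambda>x. indicator A x *\<^sub>R f x"] assms
  by (simp add: set_lebesgue_integral_def set_integrable_def)

text \<open>The first integration by parts removes the outermost derivative from the test function and makes it
the innermost one on \<open>f\<close>; hence the reversed list.\<close>

lemma weak_derivative_homogeneous:
  fixes f :: "'a::euclidean_space \<Rightarrow> 'b::euclidean_space"
  assumes f: "smooth_on (- {0}) f" and h: "homogeneous 0 f" and vs: "length vs < DIM('a)"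
  shows "weak_derivative (ball 0 1) vs f (iter_deriv (rev vs) f)"
  unfolding weak_derivative_def
proof (intro allI impI)
  fix \<psi> :: "'a \<Rightarrow> real" assume "test_function (ball 0 1) \<psi>"
  then obtain K where \<psi>: "smooth_on UNIV \<psi>" and K: "compact K" "K \<subseteq> ball 0 1" "\<And>x. x \<notin> K \<Longrightarrow> \<psi> x = 0"
    by (auto simp: test_function_def)
  have int: "set_borel_measurable lebesgue punctured_ball (\<lambda>x. iter_deriv us \<psi> x *\<^sub>R iter_deriv ws f x) \<and>
     set_integrable lebesgue punctured_ball (\<lambda>x. iter_deriv us \<psi> x *\<^sub>R iter_deriv ws f x)"
    if ws: "length ws < DIM('a)" for us ws
  proof -
    have c: "continuous_on punctured_ball (\<lambda>x. iter_deriv us \<psi> x *\<^sub>R iter_deriv ws f x)"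
      by (intro smooth_on_nonzero_punctured smooth_on_scaleR open_nonzero smooth_on_iter_deriv f smooth_on_subset[OF \<psi>]) auto
    have hw: "homogeneous (length ws) (iter_deriv ws f)" using homogeneous_iter_deriv[OF f h] by simp
    obtain C where C: "C \<ge> 0" "\<And>x. x \<noteq> 0 \<Longrightarrow> norm (iter_deriv ws f x) \<le> C * nu x ^ length ws"
      using homogeneous_bound[OF smooth_on_continuous_on[OF smooth_on_iter_deriv[OF f]] hw] by blast
    have "bounded (iter_deriv us \<psi> ` cball 0 1)"
      by (intro compact_imp_bounded compact_continuous_image compact_cball
          continuous_on_subset[OF smooth_on_continuous_on[OF smooth_on_iter_deriv[OF \<psi>]] subset_UNIV])
    then obtain M where M: "\<And>x. x \<in> cball 0 1 \<Longrightarrow> \<bar>iter_deriv us \<psi> x\<bar> \<le> M"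
      unfolding bounded_iff by force
    have "set_integrable lebesgue punctured_ball (\<lambda>x. iter_deriv us \<psi> x *\<^sub>R iter_deriv ws f x)"
    proof (rule set_integrable_punctured[OF c ws])
      fix x :: 'a assume x: "x \<in> punctured_ball"
      have "norm (iter_deriv us \<psi> x *\<^sub>R iter_deriv ws f x) = \<bar>iter_deriv us \<psi> x\<bar> * norm (iter_deriv ws f x)" by simp
      also have "\<dots> \<le> M * (C * nu x ^ length ws)"
        using x M[of x] C(2)[of x] by (intro mult_mono) auto
      finally show "norm (iter_deriv us \<psi> x *\<^sub>R iter_deriv ws f x) \<le> M * C * nu x ^ length ws" by simp
    qed
    then show ?thesis using set_borel_measurable_punctured[OF c] by blast
  qed
  have a: "set_borel_measurable lebesgue punctured_ball (\<lambda>x. iter_deriv vs \<psi> x *\<^sub>R f x)"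
    "set_integrable lebesgue punctured_ball (\<lambda>x. iter_deriv vs \<psi> x *\<^sub>R f x)"
    using int[of "[]" vs] by simp_all
  have b: "set_borel_measurable lebesgue punctured_ball (\<lambda>x. \<psi> x *\<^sub>R iter_deriv (rev vs) f x)"
    "set_integrable lebesgue punctured_ball (\<lambda>x. \<psi> x *\<^sub>R iter_deriv (rev vs) f x)"
    using int[of "rev vs" "[]"] vs by simp_all
  have "(LINT x:punctured_ball|lebesgue. iter_deriv vs \<psi> x *\<^sub>R f x)
     = (- 1) ^ length vs *\<^sub>R (LINT x:punctured_ball|lebesgue. \<psi> x *\<^sub>R iter_deriv (rev vs) f x)"
  proof (rule euclidean_eqI)
    fix e :: 'b
    have q: "smooth_on (- {0}) (\<lambda>x. f x \<bullet> e)"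
      by (intro smooth_on_inner open_nonzero f smooth_on_const)
    have hq: "homogeneous 0 (\<lambda>x. f x \<bullet> e)" using h by (simp add: homogeneous_def)
    have "(LINT x:punctured_ball|lebesgue. iter_deriv vs \<psi> x *\<^sub>R f x) \<bullet> e
      = (LINT x:punctured_ball|lebesgue. iter_deriv vs \<psi> x * iter_deriv [] (\<lambda>x. f x \<bullet> e) x)"
      by (simp add: set_integral_inner[OF a(2)])
    also have "\<dots> = (- 1) ^ length vs * (LINT x:punctured_ball|lebesgue. \<psi> x * iter_deriv (rev vs @ []) (\<lambda>x. f x \<bullet> e) x)"
      by (rule iterated_singular_integration_by_parts[OF q hq \<psi> K]) (use vs in auto)
    also have "(LINT x:punctured_ball|lebesgue. \<psi> x * iter_deriv (rev vs @ []) (\<lambda>x. f x \<bullet> e) x)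
       = (LINT x:punctured_ball|lebesgue. (\<psi> x *\<^sub>R iter_deriv (rev vs) f x) \<bullet> e)"
      unfolding set_lebesgue_integral_def
      by (intro Bochner_Integration.integral_cong) (auto simp: indicator_def iter_deriv_inner[OF open_nonzero f])
    also have "\<dots> = (LINT x:punctured_ball|lebesgue. \<psi> x *\<^sub>R iter_deriv (rev vs) f x) \<bullet> e"
      by (simp only: set_integral_inner[OF b(2)])
    finally show "(LINT x:punctured_ball|lebesgue. iter_deriv vs \<psi> x *\<^sub>R f x) \<bullet> e
      = ((- 1) ^ length vs *\<^sub>R (LINT x:punctured_ball|lebesgue. \<psi> x *\<^sub>R iter_deriv (rev vs) f x)) \<bullet> e" by simp
  qed
  then show "(LINT x:ball 0 1|lebesgue. iter_deriv vs \<psi> x *\<^sub>R f x)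
     = (- 1) ^ length vs *\<^sub>R (LINT x:ball 0 1|lebesgue. \<psi> x *\<^sub>R iter_deriv (rev vs) f x)"
    by (simp only: ball_eq_punctured_ball(2)[OF a(1)] ball_eq_punctured_ball(2)[OF b(1)])
qed

lemma L2_on_homogeneous:
  fixes f :: "'a::euclidean_space \<Rightarrow> 'b::euclidean_space"
  assumes f: "smooth_on (- {0}) f" and h: "homogeneous j f" and j: "2 * j < DIM('a)"
  shows "L2_on (ball 0 1) f"
proof -
  have c: "continuous_on punctured_ball f" by (rule smooth_on_nonzero_punctured[OF f])
  then have c2: "continuous_on punctured_ball (\<lambda>x. (norm (f x))\<^sup>2)" by (intro continuous_intros)
  obtain C where C: "C \<ge> 0" "\<And>x. x \<noteq> 0 \<Longrightarrow> norm (f x) \<le> C * nu x ^ j"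
    using homogeneous_bound[OF smooth_on_continuous_on[OF f] h] by blast
  have "set_integrable lebesgue punctured_ball (\<lambda>x. (norm (f x))\<^sup>2)"
  proof (rule set_integrable_punctured[OF c2 j])
    fix x :: 'a assume "x \<in> punctured_ball"
    then have "(norm (f x))\<^sup>2 \<le> (C * nu x ^ j)\<^sup>2" using C(2)[of x] by (intro power_mono) auto
    then show "norm ((norm (f x))\<^sup>2) \<le> C\<^sup>2 * nu x ^ (2 * j)"
      by (simp add: power_mult_distrib power_even_eq)
  qed
  then show ?thesis
    unfolding L2_on_def
    using ball_eq_punctured_ball(1)[OF set_borel_measurable_punctured[OF c]]
      ball_eq_punctured_ball(3)[OF set_borel_measurable_punctured[OF c2]] by blast
qed

lemma sobolev_homogeneous:
  fixes f :: "'a::euclidean_space \<Rightarrow> 'b::euclidean_space"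
  assumes f: "smooth_on (- {0}) f" and h: "homogeneous 0 f" and r: "2 * r < DIM('a)"
  shows "sobolev r (ball 0 1) f"
  unfolding sobolev_def
proof (intro conjI allI impI)
  show "L2_on (ball 0 1) f" by (rule L2_on_homogeneous[OF f h]) simp
  fix vs :: "'a list" assume "set vs \<subseteq> Basis \<and> length vs \<le> r"
  then have vs: "2 * length vs < DIM('a)" using r by linarith
  have "homogeneous (length vs) (iter_deriv (rev vs) f)" using homogeneous_iter_deriv[OF f h, of "rev vs"] by simp
  then have "L2_on (ball 0 1) (iter_deriv (rev vs) f)"
    by (rule L2_on_homogeneous[OF smooth_on_iter_deriv[OF f] _ vs])
  moreover have "weak_derivative (ball 0 1) vs f (iter_deriv (rev vs) f)"
    by (rule weak_derivative_homogeneous[OF f h]) (use vs in linarith)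
  ultimately show "\<exists>g. L2_on (ball 0 1) g \<and> weak_derivative (ball 0 1) vs f g" by blast
qed

section \<open>Failure of Sobolev regularity in low dimension\<close>

lemma lebesgue_integral_scaling:
  fixes G :: "'a::euclidean_space \<Rightarrow> real"
  assumes G: "G \<in> borel_measurable borel" and e: "e > 0"
  shows "(LINT x|lebesgue. G x) = e ^ DIM('a) * (LINT x|lebesgue. G (e *\<^sub>R x))"
proof -
  have [measurable]: "G \<in> borel_measurable borel" by fact
  have "(LINT x|lebesgue. G x) = (LINT x|lborel. G x)"
    by (rule integral_completion) simp
  also have "\<dots> = (LINT x|density (distr lborel borel (\<lambda>x. 0 + e *\<^sub>R x)) (\<lambda>_. \<bar>e\<bar> ^ DIM('a)). G x)"
    using lborel_affine[of e "0::'a"] e by simp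
  also have "\<dots> = (LINT x|distr lborel borel (\<lambda>x. 0 + e *\<^sub>R x). \<bar>e\<bar> ^ DIM('a) *\<^sub>R G x)"
    by (rule integral_density) auto
  also have "\<dots> = (LINT x|lborel. \<bar>e\<bar> ^ DIM('a) *\<^sub>R G (0 + e *\<^sub>R x))"
    by (rule integral_distr) auto
  also have "\<dots> = e ^ DIM('a) * (LINT x|lborel. G (e *\<^sub>R x))" using e by simp
  also have "(LINT x|lborel. G (e *\<^sub>R x)) = (LINT x|lebesgue. G (e *\<^sub>R x))"
    by (rule integral_completion[symmetric]) simp
  finally show ?thesis .
qed

lemma set_integral_scaling:
  fixes G :: "'a::euclidean_space \<Rightarrow> real"
  assumes K: "compact K" and e: "e > 0" and G: "continuous_on ((\<lambda>x. e *\<^sub>R x) ` K) G"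
  shows "(LINT x:(\<lambda>x. e *\<^sub>R x) ` K|lebesgue. G x) = e ^ DIM('a) * (LINT x:K|lebesgue. G (e *\<^sub>R x))"
proof -
  let ?K = "(\<lambda>x. e *\<^sub>R x) ` K"
  have "compact ?K" by (rule compact_scaling[OF K])
  then have "(\<lambda>x. indicator ?K x *\<^sub>R G x) \<in> borel_measurable borel"
    by (intro borel_measurable_continuous_on_indicator G borel_compact)
  moreover have "e *\<^sub>R x \<in> ?K \<longleftrightarrow> x \<in> K" for x using e by auto
  then have "(\<lambda>x. indicator ?K (e *\<^sub>R x) *\<^sub>R G (e *\<^sub>R x)) = (\<lambda>x. indicator K x *\<^sub>R G (e *\<^sub>R x))"
    by (simp add: indicator_def fun_eq_iff)
  ultimately show ?thesis
    unfolding set_lebesgue_integral_def by (subst lebesgue_integral_scaling[OF _ e]) auto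
qed

lemma iterated_integration_by_parts:
  fixes q \<psi> :: "'a::euclidean_space \<Rightarrow> real"
  assumes V: "open V" and q: "smooth_on V q"
    and \<psi>: "smooth_on UNIV \<psi>" and K: "compact K" "K \<subseteq> V" "\<And>x. x \<notin> K \<Longrightarrow> \<psi> x = 0"
  shows "(LINT x:K|lebesgue. iter_deriv vs \<psi> x * iter_deriv ws q x)
     = (- 1) ^ length vs * (LINT x:K|lebesgue. \<psi> x * iter_deriv (rev vs @ ws) q x)"
proof (induction vs arbitrary: ws)
  case (Cons v vs)
  have "(LINT x:K|lebesgue. iter_deriv ws q x \<bullet> pd (iter_deriv vs \<psi>) v x)
     = - (LINT x:K|lebesgue. pd (iter_deriv ws q) v x \<bullet> iter_deriv vs \<psi> x)"
    by (rule integration_by_parts[OF V K(1,2) smooth_on_iter_deriv[OF q]])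
      (use \<psi> K in \<open>auto intro: smooth_on_iter_deriv smooth_on_subset iter_deriv_zero_off compact_imp_closed\<close>)
  then show ?case using Cons.IH[of "v # ws"] by (simp add: mult.commute)
qed simp

lemma set_integral_supported:
  assumes "\<And>x. x \<notin> K \<Longrightarrow> h x = 0" "K \<subseteq> A"
  shows "(LINT x:A|M. h x) = (LINT x:K|M. h x)" "set_integrable M A h \<longleftrightarrow> set_integrable M K h"
proof -
  have "(\<lambda>x. indicator A x *\<^sub>R h x) = (\<lambda>x. indicator K x *\<^sub>R h x)"
    using assms by (auto simp: indicator_def fun_eq_iff)
  then show "(LINT x:A|M. h x) = (LINT x:K|M. h x)" "set_integrable M A h \<longleftrightarrow> set_integrable M K h"
    by (simp_all add: set_lebesgue_integral_def set_integrable_def)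
qed

lemma set_integrable_L2_mult:
  fixes g :: "'a::euclidean_space \<Rightarrow> 'b::euclidean_space"
  assumes g: "L2_on (ball 0 1) g" and \<psi>: "smooth_on UNIV \<psi>"
  shows "set_integrable lebesgue (ball 0 1) (\<lambda>x. \<psi> x *\<^sub>R g x)"
proof -
  have "bounded (\<psi> ` cball 0 1)"
    by (intro compact_imp_bounded compact_continuous_image compact_cball
        continuous_on_subset[OF smooth_on_continuous_on[OF \<psi>] subset_UNIV])
  then obtain M where M: "\<And>x. x \<in> cball 0 1 \<Longrightarrow> \<bar>\<psi> x\<bar> \<le> M"
    unfolding bounded_iff by force
  have M0: "M \<ge> 0" using M[of 0] by simp
  have one: "set_integrable lebesgue (ball (0::'a) 1) (\<lambda>x. 1::real)"
    by (rule set_integrable_subset[OF set_integrable_continuous_compact[OF compact_cball[of 0 1]]]) auto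
  have "set_integrable lebesgue (ball 0 1) (\<lambda>x. M * (1 + (norm (g x))\<^sup>2))"
    using g by (intro set_integrable_mult_right set_integral_add one) (simp add: L2_on_def)
  then show ?thesis
    unfolding set_integrable_def
  proof (rule Bochner_Integration.integrable_bound)
    have "(\<lambda>x. indicator (ball 0 1) x *\<^sub>R g x) \<in> borel_measurable lebesgue"
      using g by (simp add: L2_on_def set_borel_measurable_def)
    moreover have "\<psi> \<in> borel_measurable lborel"
      using borel_measurable_continuous_onI[OF smooth_on_continuous_on[OF \<psi>]] by simp
    then have "\<psi> \<in> borel_measurable lebesgue" by (rule measurable_completion)
    ultimately have "(\<lambda>x. \<psi> x *\<^sub>R (indicator (ball 0 1) x *\<^sub>R g x)) \<in> borel_measurable lebesgue"
      by (intro borel_measurable_scaleR[of \<psi>])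
    then show "(\<lambda>x. indicator (ball 0 1) x *\<^sub>R (\<psi> x *\<^sub>R g x)) \<in> borel_measurable lebesgue"
      by (simp add: mult.commute)
    have "norm (\<psi> x *\<^sub>R g x) \<le> M * (1 + (norm (g x))\<^sup>2)" if "x \<in> ball 0 1" for x
    proof -
      have "norm (g x) \<le> 1 + (norm (g x))\<^sup>2"
        using sum_squares_ge_zero[of "norm (g x) - 1" 0] by (simp add: power2_eq_square algebra_simps) (use norm_ge_zero[of "g x"] in linarith)
      then show ?thesis using M[of x] that M0 by (simp add: mult_mono)
    qed
    then show "AE x in lebesgue. norm (indicator (ball 0 1) x *\<^sub>R (\<psi> x *\<^sub>R g x))
        \<le> norm (indicator (ball 0 1) x *\<^sub>R (M * (1 + (norm (g x))\<^sup>2)))"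
      by (intro AE_I2) (auto simp: indicator_def intro: order_trans[OF _ abs_ge_self])
  qed
qed

text \<open>Away from the origin \<open>f\<close> is smooth, so its weak and classical derivatives have the same integrals
against test functions.\<close>

lemma weak_derivative_off_zero:
  fixes f :: "'a::euclidean_space \<Rightarrow> 'b::euclidean_space"
  assumes f: "smooth_on (- {0}) f" and w: "weak_derivative (ball 0 1) vs f g" and g: "L2_on (ball 0 1) g"
    and \<psi>: "smooth_on UNIV \<psi>" and K: "compact K" "K \<subseteq> punctured_ball" "\<And>x. x \<notin> K \<Longrightarrow> \<psi> x = 0"
  shows "(LINT x:K|lebesgue. \<psi> x * (g x \<bullet> b)) = (LINT x:K|lebesgue. \<psi> x * (iter_deriv (rev vs) f x \<bullet> b))"
proof -
  have Kb: "K \<subseteq> ball 0 1" "K \<subseteq> - {0}" using K(2) by auto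
  have off: "iter_deriv vs \<psi> x = 0" if "x \<notin> K" for x
    by (rule iter_deriv_zero_off[OF compact_imp_closed[OF K(1)] K(3) that])
  have "test_function (ball 0 1) \<psi>"
    unfolding test_function_def using \<psi> K Kb by blast
  then have "(LINT x:ball 0 1|lebesgue. iter_deriv vs \<psi> x *\<^sub>R f x)
      = (- 1) ^ length vs *\<^sub>R (LINT x:ball 0 1|lebesgue. \<psi> x *\<^sub>R g x)"
    using w unfolding weak_derivative_def by blast
  moreover have "(LINT x:ball 0 1|lebesgue. iter_deriv vs \<psi> x *\<^sub>R f x) = (LINT x:K|lebesgue. iter_deriv vs \<psi> x *\<^sub>R f x)"
    by (rule set_integral_supported(1)[OF _ Kb(1)]) (simp add: off)
  moreover have "(LINT x:ball 0 1|lebesgue. \<psi> x *\<^sub>R g x) = (LINT x:K|lebesgue. \<psi> x *\<^sub>R g x)"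
    by (rule set_integral_supported(1)[OF _ Kb(1)]) (simp add: K(3))
  moreover have gK: "set_integrable lebesgue K (\<lambda>x. \<psi> x *\<^sub>R g x)"
    using set_integrable_L2_mult[OF g \<psi>] set_integral_supported(2)[OF _ Kb(1), of "\<lambda>x. \<psi> x *\<^sub>R g x"] K(3) by simp
  moreover have fK: "set_integrable lebesgue K (\<lambda>x. iter_deriv vs \<psi> x *\<^sub>R f x)"
    by (rule set_integrable_continuous_compact[OF K(1)], intro continuous_on_scaleR
        continuous_on_subset[OF smooth_on_continuous_on[OF smooth_on_iter_deriv[OF \<psi>]] subset_UNIV]
        continuous_on_subset[OF smooth_on_continuous_on[OF f] Kb(2)])
  ultimately have "(LINT x:K|lebesgue. iter_deriv vs \<psi> x *\<^sub>R f x) \<bullet> b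
      = (- 1) ^ length vs * ((LINT x:K|lebesgue. \<psi> x *\<^sub>R g x) \<bullet> b)"
    by simp
  then have "(LINT x:K|lebesgue. (iter_deriv vs \<psi> x *\<^sub>R f x) \<bullet> b)
      = (- 1) ^ length vs * (LINT x:K|lebesgue. (\<psi> x *\<^sub>R g x) \<bullet> b)"
    unfolding set_integral_inner[OF gK] set_integral_inner[OF fK] .
  moreover have "(LINT x:K|lebesgue. iter_deriv vs \<psi> x * iter_deriv [] (\<lambda>x. f x \<bullet> b) x)
     = (- 1) ^ length vs * (LINT x:K|lebesgue. \<psi> x * iter_deriv (rev vs @ []) (\<lambda>x. f x \<bullet> b) x)"
    by (rule iterated_integration_by_parts[OF open_nonzero _ \<psi> K(1) Kb(2) K(3)])
      (intro smooth_on_inner open_nonzero f smooth_on_const)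
  moreover have "(LINT x:K|lebesgue. \<psi> x * iter_deriv (rev vs @ []) (\<lambda>x. f x \<bullet> b) x)
     = (LINT x:K|lebesgue. \<psi> x * (iter_deriv (rev vs) f x \<bullet> b))"
  proof -
    have "iter_deriv (rev vs) (\<lambda>x. f x \<bullet> b) x = iter_deriv (rev vs) f x \<bullet> b" if "x \<in> K" for x
      by (rule iter_deriv_inner[OF open_nonzero f]) (use that Kb(2) in auto)
    then show ?thesis
      unfolding set_lebesgue_integral_def
      by (intro Bochner_Integration.integral_cong) (auto simp: indicator_def)
  qed
  ultimately show ?thesis by simp
qed

lemma shrinking_integral_tendsto_0:
  fixes u :: "'a::euclidean_space \<Rightarrow> real"
  assumes u: "set_integrable lebesgue (ball 0 1) u" and K: "compact K" "K \<subseteq> punctured_ball"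
  shows "(\<lambda>k. LINT x:(\<lambda>x. (1 / (real k + 1)) *\<^sub>R x) ` K|lebesgue. u x) \<longlonglongrightarrow> 0"
proof -
  let ?K = "\<lambda>k. (\<lambda>x. (1 / (real k + 1)) *\<^sub>R x) ` K"
  have Kc: "compact (?K k)" for k by (rule compact_scaling[OF K(1)])
  have Ks: "?K k \<subseteq> punctured_ball" for k
  proof
    fix x assume "x \<in> ?K k"
    then obtain y where y: "y \<in> K" "x = (1 / (real k + 1)) *\<^sub>R y" by blast
    then have "y \<noteq> 0" "norm y < 1" using K(2) by auto
    moreover have "norm x \<le> norm y" using y by (simp add: divide_le_eq mult_left_le algebra_simps)
    ultimately show "x \<in> punctured_ball" using y by auto
  qed
  have "(\<lambda>k. LINT x:?K k|lebesgue. u x) \<longlonglongrightarrow> (LINT x|(lebesgue :: 'a measure). (0::real))"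
    unfolding set_lebesgue_integral_def
  proof (rule integral_dominated_convergence[where w = "\<lambda>x. norm (indicator (ball 0 1) x *\<^sub>R u x)"])
    show "integrable lebesgue (\<lambda>x. norm (indicator (ball 0 1) x *\<^sub>R u x))"
      using u by (simp add: set_integrable_def)
    have "set_integrable lebesgue (?K k) u" for k
    proof (rule set_integrable_subset[OF u])
      show "?K k \<in> sets lebesgue" using Kc by (simp add: compact_imp_closed)
      show "?K k \<subseteq> ball 0 1" using Ks by auto
    qed
    then show "(\<lambda>x. indicator (?K k) x *\<^sub>R u x) \<in> borel_measurable lebesgue" for k
      unfolding set_integrable_def by (rule borel_measurable_integrable)
    show "AE x in lebesgue. norm (indicator (?K k) x *\<^sub>R u x) \<le> norm (indicator (ball 0 1) x *\<^sub>R u x)" for k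
      using Ks[of k] by (intro AE_I2) (auto simp: indicator_def)
    show "AE x in lebesgue. (\<lambda>k. indicator (?K k) x *\<^sub>R u x) \<longlonglongrightarrow> 0"
    proof (intro AE_I2)
      fix x
      have "\<forall>\<^sub>F k in sequentially. x \<notin> ?K k"
      proof (cases "x = 0")
        case True
        then show ?thesis using Ks by (intro always_eventually) auto
      next
        case False
        have "\<forall>\<^sub>F k in sequentially. 1 / norm x < real k"
          using filterlim_real_sequentially by (simp add: filterlim_at_top_dense)
        then show ?thesis
        proof eventually_elim
          case (elim k)
          show "x \<notin> ?K k"
          proof
            assume "x \<in> ?K k"
            then obtain y where y: "y \<in> K" "x = (1 / (real k + 1)) *\<^sub>R y" by blast
            have "norm y < 1" using y K(2) by auto
            then have "norm x < 1 / (real k + 1)" using y by (simp add: divide_strict_right_mono)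
            moreover have "1 < real k * norm x" using elim False by (simp add: field_simps)
            ultimately show False using norm_ge_zero[of x] by (simp add: field_simps)
          qed
        qed
      qed
      then have "\<forall>\<^sub>F k in sequentially. 0 = indicator (?K k) x *\<^sub>R u x"
        by eventually_elim simp
      then show "(\<lambda>k. indicator (?K k) x *\<^sub>R u x) \<longlonglongrightarrow> 0"
        by (rule Lim_transform_eventually[OF tendsto_const])
    qed
  qed simp
  then show ?thesis by simp
qed

text \<open>The weight \<open>l\<close> will be chosen to balance two integrals that scale differently.\<close>

lemma weighted_young:
  fixes v b :: "'b::real_inner" and p l :: real
  assumes l: "l > 0"
  shows "p * (v \<bullet> b) \<le> (1 / 2 * l) * p\<^sup>2 + (1 / 2 * (norm b)\<^sup>2 / l) * (norm v)\<^sup>2"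
proof -
  define q where "q = norm v * norm b"
  have "p * (v \<bullet> b) \<le> \<bar>p * (v \<bullet> b)\<bar>" by simp
  also have "\<dots> \<le> \<bar>p\<bar> * q"
    unfolding abs_mult q_def by (intro mult_left_mono Cauchy_Schwarz_ineq2) simp
  also have "\<dots> \<le> 1 / 2 * l * p\<^sup>2 + 1 / 2 * q\<^sup>2 / l"
  proof -
    have "0 \<le> (l * \<bar>p\<bar> - q)\<^sup>2 / (2 * l)" using l by simp
    also have "\<dots> = 1 / 2 * l * p\<^sup>2 - \<bar>p\<bar> * q + 1 / 2 * q\<^sup>2 / l"
    proof -
      have "(l * \<bar>p\<bar> - q)\<^sup>2 = l\<^sup>2 * p\<^sup>2 - 2 * l * (\<bar>p\<bar> * q) + q\<^sup>2"
        by (simp add: power2_diff power_mult_distrib)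
      then show ?thesis using l by (simp add: add_divide_distrib diff_divide_distrib power2_eq_square)
    qed
    finally show ?thesis by simp
  qed
  finally show ?thesis by (simp add: q_def power_mult_distrib mult_ac)
qed

text \<open>A scaling argument. If the derivative \<open>h\<close> of order \<open>r\<close> is nonzero at some point, take a bump \<open>\<psi>\<close> there with
\<open>C = \<integral> \<psi> (h \<bullet> b) > 0\<close> and rescale it by \<open>e\<close>. As \<open>h\<close> is homogeneous of degree \<open>- r\<close>, the integral becomes
\<open>e\<^sup>n\<^sup>-\<^sup>r C\<close>. On the other hand it can be computed with the weak derivative \<open>g\<close>, and the weighted Young
inequality bounds it by \<open>e\<^sup>n\<^sup>-\<^sup>r \<mu> D / 2\<close> plus a multiple of \<open>e\<^sup>r\<close> times the integral of \<open>|g|\<^sup>2\<close> over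
the shrinking support. Since \<open>n \<le> 2 r\<close>, dividing by \<open>e\<^sup>n\<^sup>-\<^sup>r\<close> and letting \<open>e\<close> tend to 0 gives
\<open>C \<le> \<mu> D / 2\<close> for every \<open>\<mu> > 0\<close>.\<close>

lemma sobolev_derivatives_vanish:
  fixes f :: "'a::euclidean_space \<Rightarrow> 'b::euclidean_space"
  assumes f: "smooth_on (- {0}) f" and h: "homogeneous 0 f" and S: "sobolev r (ball 0 1) f"
    and r: "DIM('a) \<le> 2 * r" and vs: "set vs \<subseteq> Basis" "length vs = r" and x1: "x1 \<noteq> 0"
  shows "iter_deriv vs f x1 = 0"
proof (rule ccontr)
  assume nz: "iter_deriv vs f x1 \<noteq> 0"
  let ?h = "iter_deriv vs f"
  have sh: "smooth_on (- {0}) ?h" by (rule smooth_on_iter_deriv[OF f])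
  have hh: "homogeneous r ?h" using homogeneous_iter_deriv[OF f h, of vs] vs by simp
  obtain g where g: "L2_on (ball 0 1) g" and w: "weak_derivative (ball 0 1) (rev vs) f g"
    using S vs unfolding sobolev_def by (metis length_rev order_refl set_rev)
  \<comment> \<open>by homogeneity \<open>x1\<close> may be moved into the ball\<close>
  define y0 where "y0 = (1 / (2 * norm x1)) *\<^sub>R x1"
  have y0: "y0 \<in> punctured_ball" using x1 by (auto simp: y0_def)
  have "?h y0 \<noteq> 0"
    using homogeneousD[OF hh, of "1 / (2 * norm x1)" x1] x1 nz by (simp add: y0_def)
  define b where "b = ?h y0"
  have b: "?h y0 \<bullet> b > 0" using \<open>?h y0 \<noteq> 0\<close> by (simp add: b_def)
  have "continuous_on punctured_ball (\<lambda>x. ?h x \<bullet> b)"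
    by (intro continuous_intros smooth_on_nonzero_punctured sh)
  then have "open (punctured_ball \<inter> (\<lambda>x. ?h x \<bullet> b) -` {0<..})"
    by (intro continuous_open_preimage open_punctured_ball) auto
  then obtain \<delta> where \<delta>: "\<delta> > 0" "cball y0 \<delta> \<subseteq> punctured_ball \<inter> (\<lambda>x. ?h x \<bullet> b) -` {0<..}"
    using y0 b unfolding open_contains_cball by blast
  define K where "K = cball y0 \<delta>"
  have K: "compact K" "K \<subseteq> punctured_ball" "\<And>x. x \<in> K \<Longrightarrow> ?h x \<bullet> b > 0"
    using \<delta> by (auto simp: K_def)
  let ?\<psi> = "bump y0 \<delta>"
  define C where "C = (LINT x:K|lebesgue. ?\<psi> x * (?h x \<bullet> b))"
  define D where "D = (LINT x:K|lebesgue. (?\<psi> x)\<^sup>2)"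
  define G where "G e = (LINT x:(\<lambda>x. e *\<^sub>R x) ` K|lebesgue. (norm (g x))\<^sup>2)" for e
  have ch: "continuous_on K' (\<lambda>x. ?h x \<bullet> b)" if "K' \<subseteq> punctured_ball" for K'
    by (rule continuous_on_subset[OF \<open>continuous_on punctured_ball (\<lambda>x. ?h x \<bullet> b)\<close> that])
  have C: "C > 0"
    unfolding C_def K_def by (rule bump_integral_pos[OF \<delta>(1)]) (use ch[OF K(2)] K(3) in \<open>auto simp: K_def\<close>)
  have D: "D \<ge> 0"
    unfolding D_def set_lebesgue_integral_def by (intro Bochner_Integration.integral_nonneg) (simp add: indicator_def)
  have main: "C \<le> 1 / 2 * (\<mu> * D) + 1 / 2 * ((norm b)\<^sup>2 / \<mu>) * G e" if e: "0 < e" "e \<le> 1" and \<mu>: "\<mu> > 0" for e \<mu>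
  proof -
    let ?K = "(\<lambda>x. e *\<^sub>R x) ` K" and ?\<psi>e = "\<lambda>x. ?\<psi> ((1 / e) *\<^sub>R x)"
    have Ke: "compact ?K" by (rule compact_scaling[OF K(1)])
    have Ks: "?K \<subseteq> punctured_ball"
    proof
      fix x assume "x \<in> ?K"
      then obtain y where y: "y \<in> K" "x = e *\<^sub>R y" by blast
      then have "y \<noteq> 0" "norm y < 1" using K(2) by auto
      moreover have "norm x \<le> norm y" using y e by (simp add: mult_left_le_one_le)
      ultimately have "norm x < 1" by linarith
      moreover have "x \<noteq> 0" using y e \<open>y \<noteq> 0\<close> by simp
      ultimately have "norm x < 1" "x \<noteq> 0" by auto
      then show "x \<in> punctured_ball" by simp
    qed
    have s: "smooth_on UNIV ?\<psi>e"
      using smooth_on_affine[OF open_UNIV open_UNIV bounded_linear_scaleR_right smooth_bump, of "1 / e" 0 y0 \<delta>] by simp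
    have off: "?\<psi>e x = 0" if "x \<notin> ?K" for x
    proof (rule bump_zero)
      show "(1 / e) *\<^sub>R x \<notin> ball y0 \<delta>"
      proof
        assume "(1 / e) *\<^sub>R x \<in> ball y0 \<delta>"
        then have "(1 / e) *\<^sub>R x \<in> K" by (auto simp: K_def)
        then have "e *\<^sub>R ((1 / e) *\<^sub>R x) \<in> ?K" by (rule imageI)
        then show False using that e by simp
      qed
    qed (use \<delta> in simp)
    have c\<psi>: "continuous_on A ?\<psi>e" for A
      by (rule continuous_on_subset[OF smooth_on_continuous_on[OF s] subset_UNIV])
    let ?n = "DIM('a)"
    have "(LINT x:?K|lebesgue. ?\<psi>e x * (?h x \<bullet> b)) = e ^ ?n * (LINT x:K|lebesgue. ?\<psi>e (e *\<^sub>R x) * (?h (e *\<^sub>R x) \<bullet> b))"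
      by (rule set_integral_scaling[OF K(1) e(1)]) (intro continuous_on_mult c\<psi> ch Ks)
    also have "(LINT x:K|lebesgue. ?\<psi>e (e *\<^sub>R x) * (?h (e *\<^sub>R x) \<bullet> b))
       = (LINT x:K|lebesgue. (1 / e) ^ r * (?\<psi> x * (?h x \<bullet> b)))"
      unfolding set_lebesgue_integral_def
    proof (intro Bochner_Integration.integral_cong refl)
      fix x :: 'a
      show "indicator K x *\<^sub>R (?\<psi>e (e *\<^sub>R x) * (?h (e *\<^sub>R x) \<bullet> b)) = indicator K x *\<^sub>R ((1 / e) ^ r * (?\<psi> x * (?h x \<bullet> b)))"
      proof (cases "x \<in> K")
        case True
        then have "x \<noteq> 0" using K(2) by auto
        then show ?thesis using homogeneousD[OF hh e(1)] e by simp
      qed simp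
    qed
    also have "\<dots> = (1 / e) ^ r * C" unfolding C_def by simp
    finally have lhs: "(LINT x:?K|lebesgue. ?\<psi>e x * (?h x \<bullet> b)) = e ^ ?n * ((1 / e) ^ r * C)" .
    have "(LINT x:?K|lebesgue. (?\<psi>e x)\<^sup>2) = e ^ ?n * (LINT x:K|lebesgue. (?\<psi>e (e *\<^sub>R x))\<^sup>2)"
      by (rule set_integral_scaling[OF K(1) e(1)]) (intro continuous_on_power c\<psi>)
    then have sq: "(LINT x:?K|lebesgue. (?\<psi>e x)\<^sup>2) = e ^ ?n * D"
      using e by (simp add: D_def)
    \<comment> \<open>with this weight, both terms of Young's inequality can be compared with \<open>e\<^sup>n\<^sup>-\<^sup>r\<close>\<close>
    define l where "l = \<mu> * (1 / e) ^ r"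
    have l: "l > 0" using \<mu> e by (simp add: l_def)
    have Kb: "?K \<subseteq> ball 0 1" using Ks by auto
    have i2: "set_integrable lebesgue ?K (\<lambda>x. (norm (g x))\<^sup>2)"
      by (rule set_integrable_subset[OF _ _ Kb]) (use g Ke in \<open>auto simp: L2_on_def compact_imp_closed\<close>)
    have i1: "set_integrable lebesgue ?K (\<lambda>x. (?\<psi>e x)\<^sup>2)"
      by (intro set_integrable_continuous_compact[OF Ke] continuous_on_power c\<psi>)
    have i0: "set_integrable lebesgue ?K (\<lambda>x. ?\<psi>e x * (g x \<bullet> b))"
    proof -
      have "set_integrable lebesgue ?K (\<lambda>x. ?\<psi>e x *\<^sub>R g x)"
        using set_integrable_L2_mult[OF g s] set_integral_supported(2)[OF _ Kb, of "\<lambda>x. ?\<psi>e x *\<^sub>R g x"] off by simp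
      then have "integrable lebesgue (\<lambda>x. (indicator ?K x *\<^sub>R (?\<psi>e x *\<^sub>R g x)) \<bullet> b)"
        unfolding set_integrable_def by (rule integrable_inner_left)
      then show ?thesis by (simp add: set_integrable_def mult.assoc)
    qed
    have "e ^ ?n * ((1 / e) ^ r * C) = (LINT x:?K|lebesgue. ?\<psi>e x * (g x \<bullet> b))"
      using weak_derivative_off_zero[OF f w g s Ke Ks off, of b] lhs by simp
    also have "\<dots> \<le> (LINT x:?K|lebesgue. (1 / 2 * l) * (?\<psi>e x)\<^sup>2 + (1 / 2 * (norm b)\<^sup>2 / l) * (norm (g x))\<^sup>2)"
    proof (rule set_integral_mono[OF i0])
      show "set_integrable lebesgue ?K (\<lambda>x. (1 / 2 * l) * (?\<psi>e x)\<^sup>2 + (1 / 2 * (norm b)\<^sup>2 / l) * (norm (g x))\<^sup>2)"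
        by (intro set_integral_add set_integrable_mult_right i1 i2)
      fix x
      show "?\<psi>e x * (g x \<bullet> b) \<le> (1 / 2 * l) * (?\<psi>e x)\<^sup>2 + (1 / 2 * (norm b)\<^sup>2 / l) * (norm (g x))\<^sup>2"
        by (rule weighted_young[OF l])
    qed
    also have "\<dots> = (1 / 2 * l) * (e ^ ?n * D) + (1 / 2 * (norm b)\<^sup>2 / l) * G e"
      using set_integral_add(2)[OF set_integrable_mult_right[OF i1, of "1 / 2 * l"] set_integrable_mult_right[OF i2, of "1 / 2 * (norm b)\<^sup>2 / l"]]
      by (simp add: sq G_def)
    finally have ineq: "e ^ ?n * ((1 / e) ^ r * C) \<le> (1 / 2 * l) * (e ^ ?n * D) + (1 / 2 * (norm b)\<^sup>2 / l) * G e" .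
    have q: "e ^ ?n * (1 / e) ^ r > 0" using e by simp
    have G0: "G e \<ge> 0"
      unfolding G_def set_lebesgue_integral_def by (intro Bochner_Integration.integral_nonneg) (simp add: indicator_def)
    have m1: "(1 / 2 * (norm b)\<^sup>2 / l) * G e \<le> e ^ ?n * (1 / e) ^ r * (1 / 2 * ((norm b)\<^sup>2 / \<mu>) * G e)"
    proof -
      have "e ^ (2 * r) \<le> e ^ ?n" using e r by (intro power_decreasing) auto
      then have "e ^ r * e ^ r \<le> e ^ ?n" by (simp add: power_add[symmetric] mult_2)
      then have "e ^ r \<le> e ^ ?n * (1 / e) ^ r" using e by (simp add: power_one_over field_simps)
      moreover have "1 / 2 * (norm b)\<^sup>2 / l * G e = e ^ r * (1 / 2 * ((norm b)\<^sup>2 / \<mu>) * G e)"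
        using e \<mu> by (simp add: l_def power_one_over field_simps)
      moreover have "0 \<le> 1 / 2 * ((norm b)\<^sup>2 / \<mu>) * G e" using G0 \<mu> by simp
      ultimately show ?thesis by (simp only: mult_right_mono)
    qed
    have m2: "(1 / 2 * l) * (e ^ ?n * D) = e ^ ?n * (1 / e) ^ r * (1 / 2 * (\<mu> * D))"
      by (simp add: l_def)
    have "e ^ ?n * (1 / e) ^ r * C = e ^ ?n * ((1 / e) ^ r * C)" by (rule mult.assoc)
    also note ineq
    also have "(1 / 2 * l) * (e ^ ?n * D) + (1 / 2 * (norm b)\<^sup>2 / l) * G e
       \<le> e ^ ?n * (1 / e) ^ r * (1 / 2 * (\<mu> * D)) + e ^ ?n * (1 / e) ^ r * (1 / 2 * ((norm b)\<^sup>2 / \<mu>) * G e)"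
      by (rule add_mono[OF eq_refl[OF m2] m1])
    also have "\<dots> = e ^ ?n * (1 / e) ^ r * (1 / 2 * (\<mu> * D) + 1 / 2 * ((norm b)\<^sup>2 / \<mu>) * G e)"
      by (rule distrib_left[symmetric])
    finally have "e ^ ?n * (1 / e) ^ r * C \<le> e ^ ?n * (1 / e) ^ r * (1 / 2 * (\<mu> * D) + 1 / 2 * ((norm b)\<^sup>2 / \<mu>) * G e)" .
    then show ?thesis using q by (simp only: mult_le_cancel_left_pos)
  qed
  have lim: "(\<lambda>k. G (1 / (real k + 1))) \<longlonglongrightarrow> 0"
    unfolding G_def by (rule shrinking_integral_tendsto_0[OF _ K(1,2)]) (use g in \<open>simp add: L2_on_def\<close>)
  \<comment> \<open>any weight with \<open>\<mu> D < 2 C\<close> gives a contradiction\<close>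
  define \<mu> where "\<mu> = C / (D + 1)"
  have \<mu>: "\<mu> > 0" using C D by (simp add: \<mu>_def)
  have "(\<lambda>k. 1 / 2 * (\<mu> * D) + 1 / 2 * ((norm b)\<^sup>2 / \<mu>) * G (1 / (real k + 1))) \<longlonglongrightarrow> 1 / 2 * (\<mu> * D) + 1 / 2 * ((norm b)\<^sup>2 / \<mu>) * 0"
    by (intro tendsto_intros lim)
  moreover have "C \<le> 1 / 2 * (\<mu> * D) + 1 / 2 * ((norm b)\<^sup>2 / \<mu>) * G (1 / (real k + 1))" for k
    by (rule main[OF _ _ \<mu>]) auto
  ultimately have "C \<le> 1 / 2 * (\<mu> * D) + 1 / 2 * ((norm b)\<^sup>2 / \<mu>) * 0"
    by (intro LIMSEQ_le_const) auto
  then have "2 * C \<le> \<mu> * D" by simp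
  also have "\<mu> * D \<le> C" using C D by (simp add: \<mu>_def divide_le_eq)
  finally show False using C by simp
qed

section \<open>Proper weakly critical radial maps\<close>

lemma homogeneous_radial: "homogeneous 0 (radial s c 0)"
  by (auto simp: homogeneous_def radial_def nu_def)

lemma smooth_radial_nonzero: "smooth_on (- {0}) (radial s c 0)"
  by (rule smooth_radial[OF open_nonzero]) simp

lemma sobolev_radial_imp_harmonic:
  assumes sc: "s\<^sup>2 + c\<^sup>2 = 1" and S: "sobolev r (ball 0 1) (radial s c 0 :: 'a::euclidean_space \<Rightarrow> _)"
    and r: "DIM('a) \<le> 2 * r"
  shows "harmonic_on punctured_ball (radial s c 0 :: 'a \<Rightarrow> _)"
proof -
  let ?f = "radial s c 0 :: 'a \<Rightarrow> _"
  note f = smooth_radial_nonzero[of s c] and h = homogeneous_radial[of s c]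
  have r1: "1 \<le> r" using r DIM_positive[where 'a = 'a] by linarith
  have z: "pd ?f e x = 0" if "e \<in> Basis" "x \<noteq> 0" for e x
  proof -
    have "iter_deriv [e] ?f x = 0"
      by (rule all_derivatives_zero[OF f h order_refl r1 sobolev_derivatives_vanish[OF f h S r]])
        (use that in auto)
    then show ?thesis by simp
  qed
  have "tension ?f x = 0" if "x \<in> punctured_ball" for x
  proof -
    have "pd (pd ?f e) e x = 0" if "e \<in> Basis" for e
      by (rule frechet_derivative_zero_open[OF open_nonzero]) (use z that \<open>x \<in> punctured_ball\<close> in auto)
    then show ?thesis by (simp add: tension_def pull_conn_def sphere_proj_def)
  qed
  then show ?thesis using smooth_sphere_map_radial[OF sc] by (simp add: harmonic_on_def)
qed

lemma sobolev_mono: "sobolev r U f \<Longrightarrow> k \<le> r \<Longrightarrow> sobolev k U f"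
  unfolding sobolev_def by (meson order_trans)

lemma AE_radial_sphere:
  assumes "s\<^sup>2 + c\<^sup>2 = 1"
  shows "AE x in lebesgue. x \<in> ball 0 1 \<longrightarrow> radial s c 0 (x::'a::euclidean_space) \<in> sphere 0 1"
proof -
  have "AE x in lborel. x \<noteq> (0::'a)" by (rule AE_lborel_singleton)
  then have "AE x in lebesgue. x \<noteq> (0::'a)" by (rule AE_completion)
  then show ?thesis
    by eventually_elim (use smooth_sphere_map_radial[OF assms, where 'a = 'a] in \<open>auto simp: smooth_sphere_map_def\<close>)
qed

text \<open>\<open>H\<close> stands for criticality on the punctured ball. In low dimension, Sobolev regularity of order \<open>r\<close>
makes the map harmonic off the origin, and it includes regularity of order 1.\<close>

lemma sobolev_not_harmonic_iff:
  fixes H :: bool and s c :: real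
  defines "\<phi> \<equiv> radial s c 0 :: 'a::euclidean_space \<Rightarrow> 'a \<times> real"
  assumes sc: "s\<^sup>2 + c\<^sup>2 = 1" "s > 0" "c > 0" and r: "r \<ge> 1"
  shows "(sobolev_sphere r (ball 0 1) \<phi> \<and> H) \<and> \<not> weakly_harmonic \<phi> \<longleftrightarrow> 2 * r < DIM('a) \<and> H"
proof
  assume L: "(sobolev_sphere r (ball 0 1) \<phi> \<and> H) \<and> \<not> weakly_harmonic \<phi>"
  then have S: "sobolev r (ball 0 1) \<phi>" by (simp add: sobolev_sphere_def)
  have "\<not> DIM('a) \<le> 2 * r"
  proof
    assume "DIM('a) \<le> 2 * r"
    then have "harmonic_on punctured_ball \<phi>"
      using sobolev_radial_imp_harmonic[OF sc(1)] S unfolding \<phi>_def by blast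
    moreover have "sobolev_sphere 1 (ball 0 1) \<phi>"
      using L sobolev_mono[OF S r] by (simp add: sobolev_sphere_def)
    ultimately show False using L by (simp add: weakly_harmonic_def)
  qed
  then show "2 * r < DIM('a) \<and> H" using L by simp
next
  assume R: "2 * r < DIM('a) \<and> H"
  then have "sobolev r (ball 0 1) \<phi>"
    unfolding \<phi>_def by (intro sobolev_homogeneous smooth_radial_nonzero homogeneous_radial) simp
  then have "sobolev_sphere r (ball 0 1) \<phi>"
    using AE_radial_sphere[OF sc(1), where 'a = 'a] by (simp add: sobolev_sphere_def \<phi>_def)
  moreover have "\<not> weakly_harmonic \<phi>"
    using harmonic_radial_iff[OF sc, where 'a = 'a] R r by (auto simp: weakly_harmonic_def \<phi>_def)
  ultimately show "(sobolev_sphere r (ball 0 1) \<phi> \<and> H) \<and> \<not> weakly_harmonic \<phi>" using R by simp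
qed

section \<open>Zeros of the variation constants\<close>

lemma half_arccos_iff:
  assumes a: "0 < a" "a < pi / 2" and z: "-1 \<le> z" "z \<le> 1"
  shows "a = 1 / 2 * arccos z \<longleftrightarrow> cos (2 * a) = z"
proof
  assume "a = 1 / 2 * arccos z"
  then have "2 * a = arccos z" by simp
  then show "cos (2 * a) = z" using z by (simp add: cos_arccos)
next
  assume "cos (2 * a) = z"
  then have "arccos z = 2 * a" using a by (auto intro: arccos_cos)
  then show "a = 1 / 2 * arccos z" by simp
qed

lemma square_root_iff:
  fixes u v :: real
  assumes "u > 0" "v > 0"
  shows "u\<^sup>2 = v\<^sup>2 \<longleftrightarrow> u = v"
  using assms by (auto simp: power2_eq_iff)

lemma half_angle:
  fixes a :: real
  defines "y \<equiv> cos (2 * a)"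
  assumes a: "0 < a" "a < pi / 2"
  shows "-1 < y" "y < 1" "(sin a)\<^sup>2 = (1 - y) / 2" "(cos a)\<^sup>2 = (1 + y) / 2" "sin a > 0" "cos a > 0"
proof -
  have p: "sin a > 0" "cos a > 0" using a by (auto intro: sin_gt_zero cos_gt_zero)
  then show "sin a > 0" "cos a > 0" by auto
  show s: "(sin a)\<^sup>2 = (1 - y) / 2"
    unfolding y_def cos_double_cos sin_squared_eq by (simp add: field_simps)
  show c: "(cos a)\<^sup>2 = (1 + y) / 2"
    unfolding y_def cos_double_cos sin_squared_eq by (simp add: field_simps)
  show "-1 < y" "y < 1"
    using zero_less_power[OF p(1), of 2] zero_less_power[OF p(2), of 2] unfolding s c by auto
qed

text \<open>In powers of \<open>1 + y\<close>, all coefficients of the factor \<open>P\<close> are negative for \<open>n > 7\<close>. For \<open>n = 7\<close> it is a multiple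
of \<open>9 y\<^sup>2 + 22 y + 9\<close>, which has only one root above -1.\<close>

lemma var_coeff3_eq_0_iff:
  assumes a: "0 < a" "a < pi / 2" and n: "n > 6"
  shows "var_coeff3 (real n - 1) (sin a) (cos a) = 0 \<longleftrightarrow> n = 7 \<and> a = 1 / 2 * arccos (1 / 9 * (2 * sqrt 10 - 11))"
proof -
  define y where "y = cos (2 * a)"
  define N where "N = real n - 1"
  note y = half_angle[OF a, folded y_def]
  have N: "N \<ge> 6" using n by (simp add: N_def)
  define P where "P = - 2 * (N - 3) * (3 * N - 20) - N * (3 * N - 16) * (1 + y) - 3 / 4 * N\<^sup>2 * (1 + y)\<^sup>2"
  have "lap_coeff N (cos a) 2 * (N * (sin a)\<^sup>2 - lap_coeff N (cos a) 4) + (N * sin a * cos a)\<^sup>2 = P"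
    unfolding lap_coeff_def power_mult_distrib y(3,4) P_def by (simp add: power2_eq_square field_simps)
  then have "var_coeff3 N (sin a) (cos a) = (- N * sin a * cos a) * P" by (simp add: var_coeff3_def)
  then have "var_coeff3 N (sin a) (cos a) = 0 \<longleftrightarrow> P = 0" using y N by simp
  also have "\<dots> \<longleftrightarrow> n = 7 \<and> y = 1 / 9 * (2 * sqrt 10 - 11)"
  proof (cases "n = 7")
    case True
    then have "N = 6" by (simp add: N_def)
    then have "4 * P = - 12 * (9 * y\<^sup>2 + 22 * y + 9)"
      by (simp add: P_def power2_eq_square algebra_simps)
    then have "P = 0 \<longleftrightarrow> (9 * y + 11)\<^sup>2 = (2 * sqrt 10)\<^sup>2"
      by (simp add: power2_eq_square algebra_simps) (rule iffI; linarith)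
    also have "\<dots> \<longleftrightarrow> 9 * y + 11 = 2 * sqrt 10"
      by (rule square_root_iff) (use y in auto)
    finally show ?thesis using True by auto
  next
    case False
    then have "N \<ge> 7" using n by (simp add: N_def)
    then have "(N - 3) * (3 * N - 20) > 0" "N * (3 * N - 16) * (1 + y) > 0" "N\<^sup>2 * (1 + y)\<^sup>2 > 0"
      using y by auto
    then have "P < 0" unfolding P_def by linarith
    then show ?thesis using False by simp
  qed
  also have "y = 1 / 9 * (2 * sqrt 10 - 11) \<longleftrightarrow> a = 1 / 2 * arccos (1 / 9 * (2 * sqrt 10 - 11))"
  proof -
    have "sqrt 10 \<ge> 3" "sqrt 10 \<le> 4" by (auto intro: real_le_rsqrt real_le_lsqrt)
    then show ?thesis unfolding y_def by (subst half_arccos_iff[OF a]) auto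
  qed
  finally show ?thesis by (simp add: N_def)
qed

text \<open>As in the previous lemma, with the quadratic \<open>8 y\<^sup>2 + 19 y + 8\<close> for \<open>n = 9\<close>.\<close>

lemma var_coeff4_eq_0_iff:
  assumes a: "0 < a" "a < pi / 2" and n: "n > 8"
  shows "var_coeff4 (real n - 1) (sin a) (cos a) = 0 \<longleftrightarrow> n = 9 \<and> a = 1 / 2 * arccos (1 / 16 * (sqrt 105 - 19))"
proof -
  define y where "y = cos (2 * a)"
  define N where "N = real n - 1"
  note y = half_angle[OF a, folded y_def]
  have N: "N \<ge> 8" using n by (simp add: N_def)
  define P where "P = - 4 * (N - 5) * (5 * N - 42) - N * (11 / 2 * N - 41) * (1 + y) - N\<^sup>2 * (1 + y)\<^sup>2"
  have "lap_coeff N (cos a) 4 * (N * (sin a)\<^sup>2 - lap_coeff N (cos a) 6) + 2 * (N * sin a * cos a)\<^sup>2 = P"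
    unfolding lap_coeff_def power_mult_distrib y(3,4) P_def by (simp add: power2_eq_square field_simps)
  then have "var_coeff4 N (sin a) (cos a) = (- N * sin a * cos a) * lap_coeff N (cos a) 2 * P" by (simp add: var_coeff4_def)
  moreover have "lap_coeff N (cos a) 2 > 0" using N by (simp add: lap_coeff_def add_pos_nonneg)
  ultimately have "var_coeff4 N (sin a) (cos a) = 0 \<longleftrightarrow> P = 0" using y N by simp
  also have "\<dots> \<longleftrightarrow> n = 9 \<and> y = 1 / 16 * (sqrt 105 - 19)"
  proof (cases "n = 9")
    case True
    then have "N = 8" by (simp add: N_def)
    then have "P = - 8 * (8 * y\<^sup>2 + 19 * y + 8)"
      by (simp add: P_def power2_eq_square algebra_simps)
    then have "P = 0 \<longleftrightarrow> (16 * y + 19)\<^sup>2 = (sqrt 105)\<^sup>2"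
      by (simp add: power2_eq_square algebra_simps) (rule iffI; linarith)
    also have "\<dots> \<longleftrightarrow> 16 * y + 19 = sqrt 105"
      by (rule square_root_iff) (use y in auto)
    finally show ?thesis using True by auto
  next
    case False
    then have "N \<ge> 9" using n by (simp add: N_def)
    then have "(N - 5) * (5 * N - 42) > 0" "N * (11 / 2 * N - 41) * (1 + y) > 0" "N\<^sup>2 * (1 + y)\<^sup>2 > 0"
      using y by auto
    then have "P < 0" unfolding P_def by linarith
    then show ?thesis using False by simp
  qed
  also have "y = 1 / 16 * (sqrt 105 - 19) \<longleftrightarrow> a = 1 / 2 * arccos (1 / 16 * (sqrt 105 - 19))"
  proof -
    have "sqrt 105 \<ge> 10" "sqrt 105 \<le> 11" by (auto intro: real_le_rsqrt real_le_lsqrt)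
    then show ?thesis unfolding y_def by (subst half_arccos_iff[OF a]) auto
  qed
  finally show ?thesis by (simp add: N_def)
qed

text \<open>For \<open>n = 11\<close> the cubic \<open>P\<close> has the linear factor \<open>5 y + 23\<close>, which is positive. For larger \<open>n\<close> the terms
with \<open>T\<close> are at most \<open>N (1 + y)\<close> times the product of the coefficients for \<open>m = 4\<close> and \<open>m = 6\<close>, because
\<open>3 N / 2\<close> is at most the latter; adding this to the negative term still leaves a negative number.\<close>

lemma var_coeff5_eq_0_iff:
  assumes a: "0 < a" "a < pi / 2" and n: "n > 10"
  shows "var_coeff5 (real n - 1) (sin a) (cos a) = 0 \<longleftrightarrow> n = 11 \<and> a = 1 / 2 * arccos (1 / 25 * (6 * sqrt 6 - 29))"
proof -
  define y where "y = cos (2 * a)"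
  define N where "N = real n - 1"
  note y = half_angle[OF a, folded y_def]
  have N: "N \<ge> 10" using n by (simp add: N_def)
  let ?A = "lap_coeff N (cos a)"
  have A: "?A m = real m * (N - 1 - real m) + N * (1 + y) / 2" for m
    unfolding lap_coeff_def y(4) by simp
  define T where "T = N\<^sup>2 * (1 + y) * (1 - y) / 4"
  have T: "(N * sin a * cos a)\<^sup>2 = T"
    unfolding power_mult_distrib y(3,4) T_def by (simp add: field_simps)
  define P where "P = ?A 4 * (?A 6 * (N * (sin a)\<^sup>2 - ?A 8) + 2 * T) + ?A 2 * T"
  have "var_coeff5 N (sin a) (cos a) = (- N * sin a * cos a) * ?A 2 * P" by (simp add: var_coeff5_def P_def T)
  moreover have pos: "?A 2 > 0" "?A 4 > 0" "?A 6 > 0" using N y unfolding A by (auto intro!: add_pos_pos)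
  ultimately have "var_coeff5 N (sin a) (cos a) = 0 \<longleftrightarrow> P = 0" using y N by simp
  also have "\<dots> \<longleftrightarrow> n = 11 \<and> y = 1 / 25 * (6 * sqrt 6 - 29)"
  proof (cases "n = 11")
    case True
    then have "N = 10" by (simp add: N_def)
    then have "P = - 5 * ((25 * y\<^sup>2 + 58 * y + 25) * (5 * y + 23))"
      unfolding P_def A T_def y(3) by (simp add: power2_eq_square field_simps)
    then have "P = 0 \<longleftrightarrow> 25 * y\<^sup>2 + 58 * y + 25 = 0" using y by simp
    also have "\<dots> \<longleftrightarrow> (25 * y + 29)\<^sup>2 = (6 * sqrt 6)\<^sup>2"
      by (simp add: power2_eq_square algebra_simps) (rule iffI; linarith)
    also have "\<dots> \<longleftrightarrow> 25 * y + 29 = 6 * sqrt 6"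
      by (rule square_root_iff) (use y in auto)
    finally show ?thesis using True by auto
  next
    case False
    then have N11: "N \<ge> 11" using n by (simp add: N_def)
    have "T \<le> N\<^sup>2 * (1 + y) * 2 / 4"
      unfolding T_def using y N by (intro divide_right_mono mult_left_mono) auto
    moreover have "2 * ?A 4 + ?A 2 \<le> 3 * ?A 4" using N unfolding A by simp
    ultimately have "T * (2 * ?A 4 + ?A 2) \<le> (N\<^sup>2 * (1 + y) * 2 / 4) * (3 * ?A 4)"
      using pos y by (intro mult_mono) auto
    also have "\<dots> = N * (1 + y) * ?A 4 * (3 / 2 * N)" by (simp add: power2_eq_square)
    also have "\<dots> \<le> N * (1 + y) * ?A 4 * ?A 6"
    proof -
      have "0 \<le> N * (1 + y)" using y N by simp
      moreover have "?A 6 = 6 * N - 42 + N * (1 + y) / 2" unfolding A by simp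
      ultimately have "3 / 2 * N \<le> ?A 6" using N11 by linarith
      then show ?thesis using pos y N by (intro mult_left_mono) auto
    qed
    finally have "P \<le> ?A 4 * ?A 6 * (N * (sin a)\<^sup>2 - ?A 8) + N * (1 + y) * ?A 4 * ?A 6"
      unfolding P_def by (simp add: algebra_simps)
    also have "\<dots> = - (?A 4 * ?A 6 * (7 * N - 72))"
    proof -
      have "N * (sin a)\<^sup>2 - ?A 8 + N * (1 + y) = - (7 * N - 72)"
        unfolding A y(3) by (simp add: field_simps)
      moreover have "?A 4 * ?A 6 * (N * (sin a)\<^sup>2 - ?A 8) + N * (1 + y) * ?A 4 * ?A 6
         = ?A 4 * ?A 6 * (N * (sin a)\<^sup>2 - ?A 8 + N * (1 + y))" by (simp add: algebra_simps)
      ultimately show ?thesis by (simp only: mult_minus_right)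
    qed
    also have "\<dots> < 0" using pos N11 by simp
    finally show ?thesis using False by simp
  qed
  also have "y = 1 / 25 * (6 * sqrt 6 - 29) \<longleftrightarrow> a = 1 / 2 * arccos (1 / 25 * (6 * sqrt 6 - 29))"
  proof -
    have "sqrt 6 \<ge> 2" "sqrt 6 \<le> 3" by (auto intro: real_le_rsqrt real_le_lsqrt)
    then show ?thesis unfolding y_def by (subst half_arccos_iff[OF a]) auto
  qed
  finally show ?thesis by (simp add: N_def)
qed

section \<open>Dimensions and angles of the proper solutions\<close>

lemma phi_map_eq_radial: "phi_map a = radial (sin a) (cos a) 0"
  by (simp add: phi_map_def radial_def nu_def fun_eq_iff divide_inverse)

theorem theorem1p5:
  fixes a :: real and \<phi> :: "real ^ 'n \<Rightarrow> (real ^ 'n) \<times> real"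
  assumes "0 < a" and "a < pi / 2"
    and "\<phi> = phi_map a"
  shows
    "(proper_weakly_ES_r_harmonic 3 \<phi> \<longleftrightarrow>
        CARD('n) = 7 \<and> a = 1 / 2 * arccos (1 / 9 * (2 * sqrt 10 - 11))) \<and>
     (proper_weakly_r_harmonic 3 \<phi> \<longleftrightarrow>
        CARD('n) = 7 \<and> a = 1 / 2 * arccos (1 / 9 * (2 * sqrt 10 - 11))) \<and>
     (proper_weakly_ES_r_harmonic 4 \<phi> \<longleftrightarrow>
        CARD('n) = 9 \<and> a = 1 / 2 * arccos (1 / 16 * (sqrt 105 - 19))) \<and>
     (proper_weakly_r_harmonic 4 \<phi> \<longleftrightarrow>
        CARD('n) = 9 \<and> a = 1 / 2 * arccos (1 / 16 * (sqrt 105 - 19))) \<and>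
     (proper_weakly_ES_r_harmonic 5 \<phi> \<longleftrightarrow>
        CARD('n) = 11 \<and> a = 1 / 2 * arccos (1 / 25 * (6 * sqrt 6 - 29))) \<and>
     (proper_weakly_r_harmonic 5 \<phi> \<longleftrightarrow>
        CARD('n) = 11 \<and> a = 1 / 2 * arccos (1 / 25 * (6 * sqrt 6 - 29)))"
proof -
  have \<phi>: "\<phi> = radial (sin a) (cos a) 0" using assms(3) by (simp add: phi_map_eq_radial)
  have sc: "(sin a)\<^sup>2 + (cos a)\<^sup>2 = 1" "sin a > 0" "cos a > 0"
    using half_angle(5,6)[OF assms(1,2)] by simp_all
  have dim: "DIM(real ^ 'n) = CARD('n)" by simp
  have smooth: "smooth_sphere_map punctured_ball \<phi>"
    unfolding \<phi> by (rule smooth_sphere_map_radial[OF sc(1)])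
  have r: "proper_weakly_r_harmonic r \<phi> \<longleftrightarrow> 2 * r < CARD('n) \<and> critical_point (r_density r) punctured_ball \<phi>"
    "proper_weakly_ES_r_harmonic r \<phi> \<longleftrightarrow> 2 * r < CARD('n) \<and> critical_point (ES_density r) punctured_ball \<phi>"
    if "r \<ge> 1" for r
    using sobolev_not_harmonic_iff[OF sc that, where 'a = "real ^ 'n"] smooth
    unfolding proper_weakly_r_harmonic_def weakly_r_harmonic_def r_harmonic_on_def
      proper_weakly_ES_r_harmonic_def weakly_ES_r_harmonic_def ES_r_harmonic_on_def dim \<phi> by simp_all
  note crit = critical_point_iffs[of a, where 'a = "real ^ 'n", folded \<phi>, unfolded dim]
  have 3: "6 < CARD('n) \<and> var_coeff3 (real CARD('n) - 1) (sin a) (cos a) = 0 \<longleftrightarrow>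
      CARD('n) = 7 \<and> a = 1 / 2 * arccos (1 / 9 * (2 * sqrt 10 - 11))"
    using var_coeff3_eq_0_iff[OF assms(1,2), of "CARD('n)"] by auto
  have 4: "8 < CARD('n) \<and> var_coeff4 (real CARD('n) - 1) (sin a) (cos a) = 0 \<longleftrightarrow>
      CARD('n) = 9 \<and> a = 1 / 2 * arccos (1 / 16 * (sqrt 105 - 19))"
    using var_coeff4_eq_0_iff[OF assms(1,2), of "CARD('n)"] by auto
  have 5: "10 < CARD('n) \<and> var_coeff5 (real CARD('n) - 1) (sin a) (cos a) = 0 \<longleftrightarrow>
      CARD('n) = 11 \<and> a = 1 / 2 * arccos (1 / 25 * (6 * sqrt 6 - 29))"
    using var_coeff5_eq_0_iff[OF assms(1,2), of "CARD('n)"] by auto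
  show ?thesis
    using 3 4 5 by (simp add: r crit)
qed

end
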